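(* Let $U:\mathbb{R}^d\to\mathbb{R}$ be continuously differentiable, and let $L\ge 0$, $m>0$ be such that for all $x,y\in\mathbb{R}^d$, $\|\nabla U(x)-\nabla U(y)\|\le L\|x-y\|$ and $U(y)\ge U(x)+\langle\nabla U(x),y-x\rangle+(m/2)\|x-y\|^2$. Let $(\gamma_k)_{k\ge1}$ be a non-increasing sequence of positive real numbers with $\gamma_1\le2/(m+L)$ and let $f:\mathbb{R}^d\to\mathbb{R}$ be a measurable and bounded function. Then for all $N\ge0$, $n\ge1$ and $x\in\mathbb{R}^d$, $$\mathrm{Var}_x\{\hat\pi_n^N(f)\}\le\mathrm{osc}(f)^2\left\{2\gamma_1\Gamma_{N+2,N+n+1}^{-1}+u_{N,n}^{(4)}(\gamma)\right\},$$ where, with $\pi_0=3.14159\ldots$ the circle constant, $$u_{N,n}^{(4)}(\gamma)=\sum_{k=N}^{N+n-1}\gamma_{k+1}\left\{\sum_{i=k+2}^{N+n}\frac{\omega_{i,n}^N}{(\pi_0\Lambda_{k+2,i}(\gamma))^{1/2}}\right\}^2+\kappa^{-1}\left\{\sum_{i=N+1}^{N+n}\frac{\omega_{i,n}^N}{(4\pi_0\Lambda_{N+1,i}(\gamma))^{1/2}}\right\}^2.$$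
   Context: Here $d\ge1$, $\kappa=2mL/(m+L)$, $\Gamma_{n,\ell}=\sum_{k=n}^\ell\gamma_k$, and empty sums equal $0$. $(X_k)_{k\ge0}$ is the unadjusted Langevin chain $X_{k+1}=X_k-\gamma_{k+1}\nabla U(X_k)+\sqrt{2\gamma_{k+1}}Z_{k+1}$, where $(Z_k)_{k\ge1}$ are i.i.d. standard $d$-dimensional Gaussian vectors; $\mathrm{Var}_x$ is the variance when $X_0=x$. The weighted average estimator is $\hat\pi_n^N(f)=\sum_{k=N+1}^{N+n}\omega_{k,n}^Nf(X_k)$ with $\omega_{k,n}^N=\gamma_{k+1}\Gamma_{N+2,N+n+1}^{-1}$. For $1\le n_1\le n_2$, $\Lambda_{n_1,n_2}(\gamma)=\kappa^{-1}\{\prod_{j=n_1}^{n_2}(1-\kappa\gamma_j)^{-1}-1\}$, interpreted as $+\infty$ (with $1/(+\infty)=0$) if some $\kappa\gamma_j=1$. $\mathrm{osc}(f)=\sup_{x,y\in\mathbb{R}^d}|f(x)-f(y)|$. *)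

theory Defs
  imports "HOL-Probability.Probability"
begin

definition std_gaussian_density :: "real ^ 'd \<Rightarrow> real" where
  "std_gaussian_density z = exp (- (norm z)\<^sup>2 / 2) / sqrt (2 * pi) ^ CARD('d)"

text \<open>
  Step sizes \<open>\<gamma>\<close> and innovations \<open>Z\<close> are indexed from 1; their values at index 0 are
  never used. The argument \<open>G\<close> is the gradient of the potential, \<open>x\<close> the initial state.
\<close>

primrec ula_chain ::
  "(real ^ 'd \<Rightarrow> real ^ 'd) \<Rightarrow> (nat \<Rightarrow> real) \<Rightarrow> (nat \<Rightarrow> 'w \<Rightarrow> real ^ 'd)
    \<Rightarrow> real ^ 'd \<Rightarrow> nat \<Rightarrow> 'w \<Rightarrow> real ^ 'd"
where
  "ula_chain G \<gamma> Z x 0 w = x"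
| "ula_chain G \<gamma> Z x (Suc k) w =
     ula_chain G \<gamma> Z x k w - \<gamma> (k + 1) *\<^sub>R G (ula_chain G \<gamma> Z x k w)
       + sqrt (2 * \<gamma> (k + 1)) *\<^sub>R Z (k + 1) w"

definition step_sum :: "(nat \<Rightarrow> real) \<Rightarrow> nat \<Rightarrow> nat \<Rightarrow> real" where
  "step_sum \<gamma> n l = (\<Sum>k=n..l. \<gamma> k)"

definition weight :: "(nat \<Rightarrow> real) \<Rightarrow> nat \<Rightarrow> nat \<Rightarrow> nat \<Rightarrow> real" where
  "weight \<gamma> N n k = \<gamma> (k + 1) / step_sum \<gamma> (N + 2) (N + n + 1)"

definition ula_average ::
  "(real ^ 'd \<Rightarrow> real ^ 'd) \<Rightarrow> (nat \<Rightarrow> real) \<Rightarrow> (nat \<Rightarrow> 'w \<Rightarrow> real ^ 'd)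
    \<Rightarrow> real ^ 'd \<Rightarrow> nat \<Rightarrow> nat \<Rightarrow> (real ^ 'd \<Rightarrow> real) \<Rightarrow> 'w \<Rightarrow> real"
where
  "ula_average G \<gamma> Z x N n f w =
     (\<Sum>k=N+1..N+n. weight \<gamma> N n k * f (ula_chain G \<gamma> Z x k w))"

definition kappa :: "real \<Rightarrow> real \<Rightarrow> real" where
  "kappa m L = 2 * m * L / (m + L)"

definition Lambda :: "real \<Rightarrow> (nat \<Rightarrow> real) \<Rightarrow> nat \<Rightarrow> nat \<Rightarrow> ereal" where
  "Lambda \<kappa> \<gamma> n1 n2 =
     (if \<exists>j\<in>{n1..n2}. \<kappa> * \<gamma> j = 1 then \<infinity>
      else ereal (inverse \<kappa> * ((\<Prod>j=n1..n2. inverse (1 - \<kappa> * \<gamma> j)) - 1)))"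

text \<open>Only applied to nonnegative arguments; the value at \<open>-\<infinity>\<close> is irrelevant.\<close>

definition ereal_sqrt :: "ereal \<Rightarrow> ereal" where
  "ereal_sqrt x = (if x = \<infinity> then \<infinity> else ereal (sqrt (real_of_ereal x)))"

text \<open>Division in \<^typ>\<open>ereal\<close> satisfies \<open>a / \<infinity> = 0\<close> for every real \<open>a\<close>.\<close>

definition u4 :: "real \<Rightarrow> (nat \<Rightarrow> real) \<Rightarrow> nat \<Rightarrow> nat \<Rightarrow> ereal" where
  "u4 \<kappa> \<gamma> N n =
     (\<Sum>k\<in>{N..<N+n}. ereal (\<gamma> (k + 1)) *
        (\<Sum>i=k+2..N+n. ereal (weight \<gamma> N n i)
             / ereal_sqrt (ereal pi * Lambda \<kappa> \<gamma> (k + 2) i))\<^sup>2)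
     + ereal (inverse \<kappa>) *
        (\<Sum>i=N+1..N+n. ereal (weight \<gamma> N n i)
             / ereal_sqrt (ereal (4 * pi) * Lambda \<kappa> \<gamma> (N + 1) i))\<^sup>2"

definition osc :: "('a \<Rightarrow> real) \<Rightarrow> real" where
  "osc f = (SUP p. \<bar>f (fst p) - f (snd p)\<bar>)"

end

theory Submission
  imports Defs
begin

text \<open>
  The variance is split into martingale increments \<open>E[S | X\<^sub>k\<^sub>+\<^sub>1] - E[S | X\<^sub>k]\<close>. Conditionally on
  \<open>X\<^sub>k\<close> each increment is a function of a Gaussian vector, so the Gaussian Poincare inequality
  bounds its variance by the squared Lipschitz constant of the conditional expectation. That
  constant is controlled by an induction along the chain: part of the displacement of two starting
  points is contracted by the gradient step, the rest is moved into the noise by Cameron-Martin,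
  and the accumulated change of measure is measured by a Gaussian hockey-stick divergence, whose
  arguments add up in quadrature.

  The increments before the burn-in time \<open>N\<close> only give the constant \<open>2/\<kappa>\<close> in front of the last
  square of \<open>u\<^sup>(\<^sup>4\<^sup>)\<close>, twice the claimed one. The excess is absorbed by the factor 2 that is lost in the
  remaining terms: with \<open>T = \<kappa> \<Gamma>\<close>, for \<open>T \<ge> ln 10\<close> the sum over the increments after \<open>N\<close> already
  dominates the excess, and for \<open>T \<le> ln 10\<close> the right-hand side exceeds the trivial bound 1/4.
\<close>

section \<open>Standard Gaussian measures\<close>

text \<open>A bound on total variation alone does not propagate along the chain: shifting the noise
  multiplies one of the two laws by a random likelihood ratio. Bounding the hockey-stick divergence
  at every level \<open>l\<close> does propagate. In terms of the inverse square of the constant, a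
  noise step adds \<open>2 * \<gamma> j\<close> and a gradient step divides by
  \<open>1 - \<kappa> * \<gamma> j\<close>; the solution is \<open>2 * \<Lambda>\<close>. At level 1
  a factor \<open>1 / sqrt (2 * pi)\<close> enters, which gives the Lipschitz constant
  \<open>1 / sqrt (4 * pi * \<Lambda>)\<close>. The inner sums with \<open>pi\<close> in the
  statement are therefore twice a Lipschitz constant, while Poincare with noise variance
  \<open>2 * \<gamma>\<close> uses only half of the resulting square: this is the lost factor 2.
  Part of it pays for the one new term of the sum in each increment, for which only boundedness is
  available.

  For small rescaled steps \<open>\<kappa> * \<gamma>\<close> the sums of Lipschitz constants are
  Riemann sums of \<open>1 / sqrt (exp r - 1)\<close>, with integral
  \<open>2 * arcsin (sqrt (1 - exp (- T)))\<close> over \<open>[0, T]\<close>. The steps need not be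
  small, so the final comparison needs explicit errors and numerical constants.\<close>

lemma std_gaussian_density_nonneg: "0 \<le> std_gaussian_density z"
  by (simp add: std_gaussian_density_def)

lemma borel_measurable_std_gaussian_density [measurable]:
  "std_gaussian_density \<in> borel_measurable borel"
  unfolding std_gaussian_density_def[abs_def] by measurable

lemma std_gaussian_density_eq_prod:
  fixes z :: "real ^ 'd"
  shows "std_gaussian_density z = (\<Prod>b\<in>Basis. std_normal_density (z \<bullet> b))"
proof -
  have "(norm z)\<^sup>2 = (\<Sum>b\<in>Basis. (z \<bullet> b)\<^sup>2)"
    unfolding power2_norm_eq_inner by (subst euclidean_inner) (simp add: power2_eq_square)
  then have "(\<Sum>b\<in>Basis. - ((z \<bullet> b)\<^sup>2) / 2) = - (norm z)\<^sup>2 / 2"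
    by (simp add: sum_negf sum_divide_distrib)
  then have "(\<Prod>b\<in>Basis. exp (- ((z \<bullet> b)\<^sup>2) / 2)) = exp (- (norm z)\<^sup>2 / 2)"
    by (simp flip: exp_sum)
  then show ?thesis
    by (simp add: std_gaussian_density_def std_normal_density_def prod.distrib
        power_one_over prod_dividef power_divide)
qed

definition gauss :: "(real ^ 'd) measure" where
  "gauss = density lborel (\<lambda>z. ennreal (std_gaussian_density z))"

lemma sets_gauss [simp, measurable_cong]: "sets gauss = sets borel"
  and space_gauss [simp]: "space gauss = UNIV"
  by (simp_all add: gauss_def)

lemma prob_space_gauss: "prob_space (gauss :: (real ^ 'd) measure)"
proof
  have "emeasure (gauss :: (real ^ 'd) measure) UNIV
      = (\<integral>\<^sup>+(z::real^'d). (\<Prod>b\<in>Basis. ennreal (std_normal_density (z \<bullet> b))) \<partial>lborel)"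
    by (auto simp: gauss_def emeasure_density std_gaussian_density_eq_prod prod_ennreal
        intro!: nn_integral_cong)
  also have "\<dots> = 1"
    by (subst nn_integral_lborel_prod)
       (auto simp: nn_integral_eq_integral integral_normal_density)
  finally show "emeasure (gauss :: (real ^ 'd) measure) (space gauss) = 1" by simp
qed

interpretation gauss: prob_space "gauss :: (real ^ 'd) measure"
  by (rule prob_space_gauss)

interpretation std_normal: real_distribution std_normal_distribution
  by (rule real_dist_normal_dist)

text \<open>The integrand factorises over the coordinates, so Fubini on a product of one-dimensional
  Lebesgue measures leaves characteristic functions of standard normals.\<close>

lemma char_gauss_inner:
  fixes u :: "real ^ 'd"
  shows "(CLINT z|gauss. iexp (s * (z \<bullet> u))) = exp (- ((s * norm u)\<^sup>2) / 2)"
proof -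
  let ?f = "\<lambda>b x. std_normal_density x *\<^sub>R iexp (s * (u \<bullet> b) * x)"
  interpret product_sigma_finite "\<lambda>_::real^'d. lborel :: real measure"
    by standard
  have 1: "std_gaussian_density z *\<^sub>R iexp (s * (z \<bullet> u))
      = (\<Prod>b\<in>Basis. ?f b (z \<bullet> b))" for z :: "real ^ 'd"
  proof -
    have "iexp (s * (z \<bullet> u)) = (\<Prod>b\<in>Basis. iexp (s * (u \<bullet> b) * (z \<bullet> b)))"
      by (simp add: euclidean_inner[of z u] sum_distrib_left sum_distrib_right
          flip: exp_sum) (simp add: algebra_simps)
    then show ?thesis
      by (simp add: std_gaussian_density_eq_prod scaleR_conv_of_real prod.distrib)
  qed
  have 2: "(CLINT x|lborel. ?f b x) = exp (- ((s * (u \<bullet> b))\<^sup>2) / 2)" for b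
    using char_std_normal_distribution[THEN fun_cong, of "s * (u \<bullet> b)"]
    by (simp add: char_def integral_density)
  have 3: "complex_integrable lborel (?f b)" for b
  proof -
    have "complex_integrable std_normal_distribution (\<lambda>x. iexp (s * (u \<bullet> b) * x))"
      by (intro std_normal.integrable_const_bound[where B=1]) auto
    then show ?thesis
      by (subst (asm) integrable_density) (auto simp: scaleR_conv_of_real mult_ac)
  qed
  have "(CLINT z|gauss. iexp (s * (z \<bullet> u)))
      = (CLINT z|lborel. \<Prod>b\<in>Basis. ?f b ((z::real^'d) \<bullet> b))"
    unfolding gauss_def
    by (subst integral_density) (auto simp: std_gaussian_density_nonneg 1 simp del: of_real_mult)
  also have "\<dots> = (CLINT g|(\<Pi>\<^sub>M b\<in>(Basis::(real^'d) set). lborel). \<Prod>b\<in>Basis. ?f b (g b))"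
    by (subst lborel_eq, subst integral_distr) (auto intro!: Bochner_Integration.integral_cong prod.cong)
  also have "\<dots> = (\<Prod>b\<in>Basis. CLINT x|lborel. ?f b x)"
    by (rule product_integral_prod[OF finite_Basis 3])
  also have "\<dots> = (\<Prod>b\<in>Basis. complex_of_real (exp (- ((s * (u \<bullet> b))\<^sup>2) / 2)))"
    by (simp only: 2)
  also have "\<dots> = complex_of_real (exp (\<Sum>b\<in>Basis. - ((s * (u \<bullet> b))\<^sup>2) / 2))"
    by (simp add: exp_sum)
  also have "(\<Sum>b\<in>Basis. - ((s * (u \<bullet> b))\<^sup>2) / 2) = - ((s * norm u)\<^sup>2) / 2"
    by (simp add: power_mult_distrib power2_norm_eq_inner euclidean_inner[of u u]
        sum_negf sum_divide_distrib sum_distrib_left) (simp add: power2_eq_square)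
  finally show ?thesis by simp
qed

lemma char_scaled_std_normal:
  "char (distr std_normal_distribution borel (\<lambda>x. c * x)) s = exp (- ((s * c)\<^sup>2) / 2)"
  using char_std_normal_distribution[THEN fun_cong, of "s * c"]
  by (simp add: char_def integral_distr mult.assoc)

text \<open>Both laws have the same characteristic function. Integrals of functions of
  \<open>z \<bullet> u\<close> thus become one-dimensional, which keeps the divergence bounds free
  of the dimension.\<close>

lemma distr_gauss_inner:
  fixes u :: "real ^ 'd"
  shows "distr gauss borel (\<lambda>z. z \<bullet> u)
    = distr std_normal_distribution borel (\<lambda>x. norm u * x)"
proof (rule Levy_uniqueness)
  show "real_distribution (distr gauss borel (\<lambda>z. z \<bullet> u))"
    by (intro gauss.real_distribution_distr) simp
  show "real_distribution (distr std_normal_distribution borel (\<lambda>x. norm u * x))"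
    by (intro std_normal.real_distribution_distr) simp
  show "char (distr gauss borel (\<lambda>z. z \<bullet> u))
      = char (distr std_normal_distribution borel (\<lambda>x. norm u * x))"
    using char_gauss_inner[of _ u]
    by (intro ext, subst char_scaled_std_normal) (simp add: char_def integral_distr)
qed

text \<open>The source of the addition in quadrature: independent normal exponents add their
  variances.\<close>

lemma distr_std_normal_pair:
  "distr (std_normal_distribution \<Otimes>\<^sub>M std_normal_distribution) borel (\<lambda>(x, y). a * x + b * y)
    = distr std_normal_distribution borel (\<lambda>x. sqrt (a\<^sup>2 + b\<^sup>2) * x)"
    (is "distr ?P _ _ = _")
proof (rule Levy_uniqueness)
  interpret P: pair_prob_space std_normal_distribution std_normal_distribution ..
  show "real_distribution (distr ?P borel (\<lambda>(x, y). a * x + b * y))"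
    by (intro P.real_distribution_distr) simp
  show "real_distribution (distr std_normal_distribution borel (\<lambda>x. sqrt (a\<^sup>2 + b\<^sup>2) * x))"
    by (intro std_normal.real_distribution_distr) simp
  show "char (distr ?P borel (\<lambda>(x, y). a * x + b * y))
      = char (distr std_normal_distribution borel (\<lambda>x. sqrt (a\<^sup>2 + b\<^sup>2) * x))"
  proof
    fix s
    have "char (distr ?P borel (\<lambda>(x, y). a * x + b * y)) s
        = (CLINT p|?P. iexp (s * (a * fst p + b * snd p)))"
      by (simp add: char_def integral_distr split_beta)
    also have "\<dots> = (CLINT x|std_normal_distribution. CLINT y|std_normal_distribution.
        iexp (s * (a * x + b * y)))"
      by (subst P.integral_fst'[symmetric])
         (auto intro!: P.integrable_const_bound[where B=1])
    also have "\<dots> = (CLINT x|std_normal_distribution. 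
        iexp (s * a * x) * (CLINT y|std_normal_distribution. iexp (s * b * y)))"
      by (intro Bochner_Integration.integral_cong refl, subst integral_mult_right_zero[symmetric])
         (simp add: algebra_simps exp_add)
    also have "\<dots> = exp (- ((s * a)\<^sup>2) / 2) * exp (- ((s * b)\<^sup>2) / 2)"
      using char_std_normal_distribution[THEN fun_cong, of "s * a"]
        char_std_normal_distribution[THEN fun_cong, of "s * b"]
      by (simp add: char_def)
    also have "\<dots> = exp (- ((s * sqrt (a\<^sup>2 + b\<^sup>2))\<^sup>2) / 2)"
      by (simp add: power_mult_distrib algebra_simps add_divide_distrib diff_divide_distrib
          flip: exp_add of_real_mult)
    finally show "char (distr ?P borel (\<lambda>(x, y). a * x + b * y)) s
      = char (distr std_normal_distribution borel (\<lambda>x. sqrt (a\<^sup>2 + b\<^sup>2) * x)) s"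
      by (simp add: char_scaled_std_normal)
  qed
qed

section \<open>Hockey-stick divergences and Lipschitz estimates\<close>

text \<open>\<open>ennreal\<close> truncates negative reals to 0, so the right-hand side integrates
  the positive part of \<open>f\<close>. The same convention encodes positive parts in
  \<open>hockey\<close> and \<open>hockey_bound\<close>.\<close>

lemma ennreal_integral_le_nn_integral:
  assumes "integrable M f"
  shows "ennreal (integral\<^sup>L M f) \<le> (\<integral>\<^sup>+x. ennreal (f x) \<partial>M)"
proof -
  have "ennreal (integral\<^sup>L M f) \<le> ennreal (LINT x|M. max 0 (f x))"
    using assms by (intro ennreal_leI integral_mono) auto
  also have "\<dots> = (\<integral>\<^sup>+x. ennreal (max 0 (f x)) \<partial>M)"
    using assms by (intro nn_integral_eq_integral[symmetric]) auto
  also have "\<dots> = (\<integral>\<^sup>+x. ennreal (f x) \<partial>M)"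
    by (intro nn_integral_cong) (auto simp: max_def ennreal_neg)
  finally show ?thesis .
qed

text \<open>The density of the standard Gaussian translated by \<open>w\<close> with respect to the
  centred one.\<close>

abbreviation tilt :: "real ^ 'd \<Rightarrow> real ^ 'd \<Rightarrow> real" where
  "tilt w z \<equiv> exp (z \<bullet> w - (norm w)\<^sup>2 / 2)"

lemma distr_gauss_translate:
  fixes w :: "real ^ 'd"
  shows "distr gauss borel (\<lambda>z. z + w)
    = density gauss (\<lambda>z. ennreal (tilt w z))"
proof (rule measure_eqI)
  fix A assume "A \<in> sets (distr gauss borel (\<lambda>z. z + w))"
  then have [measurable]: "A \<in> sets borel" by simp
  have "emeasure (distr gauss borel (\<lambda>z. z + w)) A
      = (\<integral>\<^sup>+z. indicator A z \<partial>distr gauss borel (\<lambda>z. z + w))"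
    by simp
  also have "\<dots> = (\<integral>\<^sup>+z. indicator A (z + w) \<partial>gauss)"
    by (subst nn_integral_distr) simp_all
  also have "\<dots> = (\<integral>\<^sup>+z. ennreal (std_gaussian_density z) * indicator A (z + w) \<partial>lborel)"
    unfolding gauss_def by (subst nn_integral_density) auto
  also have "\<dots> = (\<integral>\<^sup>+z. ennreal (std_gaussian_density (z - w)) * indicator A z \<partial>distr lborel borel ((+) w))"
    by (subst nn_integral_distr) (auto simp: add.commute)
  also have "\<dots> = (\<integral>\<^sup>+z. ennreal (std_gaussian_density z) *
      (ennreal (tilt w z) * indicator A z) \<partial>lborel)"
  proof -
    have "std_gaussian_density (z - w)
        = std_gaussian_density z * tilt w z" for z :: "real ^ 'd"
    proof -
      have "- (norm (z - w))\<^sup>2 / 2 = - (norm z)\<^sup>2 / 2 + (z \<bullet> w - (norm w)\<^sup>2 / 2)"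
        by (simp add: power2_norm_eq_inner inner_diff_left inner_diff_right inner_commute
            add_divide_distrib diff_divide_distrib)
      then show ?thesis
        by (simp only: std_gaussian_density_def exp_add) simp
    qed
    then show ?thesis
      by (simp add: lborel_distr_plus ennreal_mult' std_gaussian_density_nonneg mult.assoc)
  qed
  also have "\<dots> = (\<integral>\<^sup>+z. ennreal (tilt w z) * indicator A z \<partial>gauss)"
    unfolding gauss_def by (subst nn_integral_density) auto
  also have "\<dots> = emeasure (density gauss (\<lambda>z. ennreal (tilt w z))) A"
    by (simp add: emeasure_density)
  finally show "emeasure (distr gauss borel (\<lambda>z. z + w)) A
    = emeasure (density gauss (\<lambda>z. ennreal (tilt w z))) A" .
qed simp

lemma integral_gauss_translate:
  fixes F :: "real ^ 'd \<Rightarrow> real"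
  assumes [measurable]: "F \<in> borel_measurable borel"
  shows "(LINT z|gauss. F (z + w)) = (LINT z|gauss. tilt w z * F z)"
proof -
  have "(LINT z|gauss. F (z + w)) = (LINT z|distr gauss borel (\<lambda>z. z + w). F z)"
    by (simp add: integral_distr)
  then show ?thesis
    by (simp add: distr_gauss_translate integral_density)
qed

lemma integrable_gauss_exp_inner:
  "integrable gauss (\<lambda>z. tilt w z)" (is ?I)
  and integral_gauss_exp_inner:
  "(LINT z|gauss. tilt w z) = 1" (is ?E)
proof -
  have "prob_space (distr gauss borel (\<lambda>z. z + w))"
    by (intro gauss.prob_space_distr) simp
  then have "prob_space (density gauss (\<lambda>z. ennreal (tilt w z)))"
    by (simp add: distr_gauss_translate)
  then have 1: "(\<integral>\<^sup>+z. ennreal (tilt w z) \<partial>gauss) = ennreal 1"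
    using prob_space.emeasure_space_1 by (force simp: emeasure_density)
  then have "has_bochner_integral gauss (\<lambda>z. tilt w z) 1"
    by (intro has_bochner_integral_nn_integral) auto
  then show ?I ?E
    by (auto simp: has_bochner_integral_iff)
qed

lemma nn_integral_gauss_inner:
  fixes w :: "real ^ 'd"
  assumes [measurable]: "h \<in> borel_measurable borel"
  shows "(\<integral>\<^sup>+z. h (z \<bullet> w) \<partial>gauss) = (\<integral>\<^sup>+x. h (norm w * x) \<partial>std_normal_distribution)"
proof -
  have "(\<integral>\<^sup>+z. h (z \<bullet> w) \<partial>gauss) = (\<integral>\<^sup>+y. h y \<partial>distr gauss borel (\<lambda>z. z \<bullet> w))"
    by (simp add: nn_integral_distr)
  then show ?thesis
    by (simp add: distr_gauss_inner nn_integral_distr)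
qed

lemma integral_gauss_inner:
  fixes w :: "real ^ 'd" and h :: "real \<Rightarrow> real"
  assumes [measurable]: "h \<in> borel_measurable borel"
  shows "(LINT z|gauss. h (z \<bullet> w)) = (LINT x|std_normal_distribution. h (norm w * x))"
proof -
  have "(LINT z|gauss. h (z \<bullet> w)) = (LINT y|distr gauss borel (\<lambda>z. z \<bullet> w). h y)"
    by (simp add: integral_distr)
  then show ?thesis
    by (simp add: distr_gauss_inner integral_distr)
qed

lemma nn_integral_std_normal_pair:
  assumes [measurable]: "h \<in> borel_measurable borel"
  shows "(\<integral>\<^sup>+x. \<integral>\<^sup>+y. h (a * x + b * y) \<partial>std_normal_distribution \<partial>std_normal_distribution)
    = (\<integral>\<^sup>+x. h (sqrt (a\<^sup>2 + b\<^sup>2) * x) \<partial>std_normal_distribution)"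
proof -
  let ?N = "std_normal_distribution"
  have "(\<integral>\<^sup>+x. \<integral>\<^sup>+y. h (a * x + b * y) \<partial>?N \<partial>?N)
      = (\<integral>\<^sup>+p. h (a * fst p + b * snd p) \<partial>(?N \<Otimes>\<^sub>M ?N))"
    by (subst std_normal.nn_integral_fst[symmetric]) auto
  also have "\<dots> = (\<integral>\<^sup>+y. h y \<partial>distr (?N \<Otimes>\<^sub>M ?N) borel (\<lambda>(x, y). a * x + b * y))"
    by (subst nn_integral_distr) (auto simp: split_beta)
  also have "\<dots> = (\<integral>\<^sup>+x. h (sqrt (a\<^sup>2 + b\<^sup>2) * x) \<partial>?N)"
    unfolding distr_std_normal_pair by (subst nn_integral_distr) auto
  finally show ?thesis .
qed

text \<open>The hockey-stick divergence at level \<open>l\<close> between \<open>N(\<mu>,1)\<close>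
  and \<open>N(0,1)\<close>: the exponential is the likelihood ratio and \<open>ennreal\<close>
  takes the positive part. At \<open>l = 1\<close> it is the total variation distance.\<close>

definition hockey :: "real \<Rightarrow> real \<Rightarrow> ennreal" where
  "hockey l \<mu> = (\<integral>\<^sup>+x. ennreal (l * exp (\<mu> * x - \<mu>\<^sup>2 / 2) - 1) \<partial>std_normal_distribution)"

lemma borel_measurable_hockey [measurable]: "(\<lambda>l. hockey l \<mu>) \<in> borel_measurable borel"
  unfolding hockey_def by measurable

text \<open>The level carries the random likelihood ratio of a shift by \<open>w\<close>. Its normal
  exponent \<open>z \<bullet> w\<close> and the exponent \<open>\<nu> * x\<close> inside
  \<open>hockey\<close> merge into one normal of variance
  \<open>(norm w)\<^sup>2 + \<nu>\<^sup>2\<close>.\<close>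

lemma hockey_compose:
  fixes w :: "real ^ 'd"
  shows "(\<integral>\<^sup>+z. hockey (l * tilt w z) \<nu> \<partial>gauss)
    = hockey l (sqrt ((norm w)\<^sup>2 + \<nu>\<^sup>2))"
proof -
  define h where "h y = ennreal (l * exp (y - ((norm w)\<^sup>2 + \<nu>\<^sup>2) / 2) - 1)" for y
  have [measurable]: "h \<in> borel_measurable borel" unfolding h_def by measurable
  have "(\<integral>\<^sup>+z. hockey (l * tilt w z) \<nu> \<partial>gauss)
      = (\<integral>\<^sup>+z. (\<integral>\<^sup>+x. h (z \<bullet> w + \<nu> * x) \<partial>std_normal_distribution) \<partial>gauss)"
    unfolding hockey_def h_def
    by (intro nn_integral_cong) (simp add: mult.assoc add_divide_distrib algebra_simps flip: exp_add)
  also have "\<dots> = hockey l (sqrt ((norm w)\<^sup>2 + \<nu>\<^sup>2))"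
    by (subst nn_integral_gauss_inner) (simp_all add: nn_integral_std_normal_pair, simp add: h_def hockey_def)
  finally show ?thesis .
qed

text \<open>The likelihood ratio of the larger shift is that of the smaller one times an independent
  tilt of mean 1. By Jensen, averaging over this tilt can only increase the positive part.\<close>

lemma hockey_mono:
  assumes "0 \<le> \<mu>" "\<mu> \<le> \<mu>'"
  shows "hockey l \<mu> \<le> hockey l \<mu>'"
proof -
  let ?N = std_normal_distribution
  define s where "s = sqrt (\<mu>'\<^sup>2 - \<mu>\<^sup>2)"
  have "\<mu>\<^sup>2 \<le> \<mu>'\<^sup>2" using assms by (intro power_mono) auto
  then have s: "s\<^sup>2 = \<mu>'\<^sup>2 - \<mu>\<^sup>2" and \<mu>': "sqrt (s\<^sup>2 + \<mu>\<^sup>2) = \<mu>'"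
    using assms by (simp_all add: s_def)
  \<comment> \<open>One dimension suffices for the auxiliary tilt, which supplies the missing
    variance \<open>\<mu>'\<^sup>2 - \<mu>\<^sup>2\<close>.\<close>
  define w :: "real ^ 1" where "w = axis 1 s"
  have w: "(norm w)\<^sup>2 = s\<^sup>2" by (simp add: w_def norm_real axis_def)
  have "hockey l \<mu> \<le> (\<integral>\<^sup>+z. hockey (l * tilt w z) \<mu> \<partial>gauss)"
  proof -
    let ?e = "\<lambda>z x. ennreal (l * tilt w z * exp (\<mu> * x - \<mu>\<^sup>2 / 2) - 1)"
    have "ennreal (l * exp (\<mu> * x - \<mu>\<^sup>2 / 2) - 1) \<le> (\<integral>\<^sup>+z. ?e z x \<partial>gauss)" for x
    proof -
      let ?c = "l * exp (\<mu> * x - \<mu>\<^sup>2 / 2)"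
      let ?X = "\<lambda>z. ?c * tilt w z - 1"
      have I: "integrable gauss ?X"
        by (intro Bochner_Integration.integrable_diff integrable_mult_right
            integrable_gauss_exp_inner) simp
      have "(LINT z|gauss. ?X z) = ?c - 1"
        using integrable_gauss_exp_inner[of w] integral_gauss_exp_inner[of w]
        by (subst Bochner_Integration.integral_diff) (auto simp: gauss.prob_space[simplified])
      moreover have "ennreal (LINT z|gauss. ?X z) \<le> (\<integral>\<^sup>+z. ennreal (?X z) \<partial>gauss)"
        using I by (rule ennreal_integral_le_nn_integral)
      ultimately show ?thesis by (simp add: mult_ac)
    qed
    then have "hockey l \<mu> \<le> (\<integral>\<^sup>+x. (\<integral>\<^sup>+z. ?e z x \<partial>gauss) \<partial>?N)"
      unfolding hockey_def by (intro nn_integral_mono)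
    also have "\<dots> = (\<integral>\<^sup>+z. (\<integral>\<^sup>+x. ?e z x \<partial>?N) \<partial>gauss)"
    proof -
      interpret pair_sigma_finite "gauss :: (real ^ 1) measure" ?N ..
      show ?thesis by (rule Fubini') measurable
    qed
    finally show ?thesis by (simp add: hockey_def)
  qed
  also have "\<dots> = hockey l \<mu>'"
    by (subst hockey_compose) (simp only: w \<mu>')
  finally show ?thesis .
qed

text \<open>The densities of \<open>N(0,1)\<close> and \<open>N(\<mu>,1)\<close> cross at
  \<open>\<mu> / 2\<close>, so their total variation distance is the standard normal mass of an
  interval of length \<open>\<mu>\<close>, at most \<open>\<mu>\<close> times the maximal
  density.\<close>

lemma hockey_one_le:
  assumes "0 \<le> \<mu>"
  shows "hockey 1 \<mu> \<le> ennreal (\<mu> / sqrt (2 * pi))"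
proof -
  let ?\<phi> = std_normal_density
  let ?D = "\<lambda>x. (?\<phi> (x - \<mu>) - ?\<phi> x) * indicator {\<mu> / 2<..} x"
  have shift: "?\<phi> x * exp (\<mu> * x - \<mu>\<^sup>2 / 2) = ?\<phi> (x - \<mu>)" for x
    by (simp add: std_normal_density_def power2_diff algebra_simps add_divide_distrib
        diff_divide_distrib flip: exp_add)
  have 1: "(LINT x|lborel. ?\<phi> (x - \<mu>) * indicator {\<mu> / 2<..} x)
      = (LINT x|lborel. ?\<phi> x * indicator {- \<mu> / 2<..} x)"
    and I1: "integrable lborel (\<lambda>x. ?\<phi> (x - \<mu>) * indicator {\<mu> / 2<..} x)"
    using lborel_integral_real_affine[of 1 "\<lambda>x. ?\<phi> x * indicator {- \<mu> / 2<..} x" "- \<mu>"]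
      lborel_integrable_real_affine[of "\<lambda>x. ?\<phi> x * indicator {- \<mu> / 2<..} x" 1 "- \<mu>"]
      integrable_real_mult_indicator[of "{- \<mu> / 2<..}" lborel ?\<phi>]
    by (auto simp: indicator_def algebra_simps field_simps if_distrib cong: if_cong)
  have I2: "integrable lborel (\<lambda>x. ?\<phi> x * indicator A x)" if "A \<in> sets borel" for A
    using integrable_real_mult_indicator[of A lborel ?\<phi>] that by auto
  have "hockey 1 \<mu> = (\<integral>\<^sup>+x. ennreal (?\<phi> x) * ennreal (exp (\<mu> * x - \<mu>\<^sup>2 / 2) - 1) \<partial>lborel)"
    unfolding hockey_def by (subst nn_integral_density) auto
  also have "\<dots> = (\<integral>\<^sup>+x. ennreal (?D x) \<partial>lborel)"
  proof (intro nn_integral_cong)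
    fix x
    have eq: "?\<phi> x * (exp (\<mu> * x - \<mu>\<^sup>2 / 2) - 1) = ?\<phi> (x - \<mu>) - ?\<phi> x"
      using shift[of x] by (simp add: algebra_simps)
    have "exp (\<mu> * x - \<mu>\<^sup>2 / 2) - 1 \<le> 0" if "x \<le> \<mu> / 2"
      using mult_left_mono[OF that, of \<mu>] assms by (simp add: power2_eq_square)
    moreover have "ennreal (?\<phi> x) * ennreal (exp (\<mu> * x - \<mu>\<^sup>2 / 2) - 1)
        = ennreal (?\<phi> (x - \<mu>) - ?\<phi> x)"
      by (simp add: eq flip: ennreal_mult')
    ultimately show "ennreal (?\<phi> x) * ennreal (exp (\<mu> * x - \<mu>\<^sup>2 / 2) - 1) = ennreal (?D x)"
      by (cases "x \<le> \<mu> / 2") (simp_all only: ennreal_neg, auto)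
  qed
  also have "\<dots> = ennreal (LINT x|lborel. ?D x)"
  proof (rule nn_integral_eq_integral)
    show "integrable lborel ?D"
      using I1 I2[of "{\<mu> / 2<..}"] by (simp add: left_diff_distrib)
    have "?\<phi> x \<le> ?\<phi> (x - \<mu>)" if "\<mu> / 2 < x" for x
    proof -
      have "\<mu> * (\<mu> / 2) \<le> \<mu> * x" using that assms by (intro mult_left_mono) auto
      then have "1 \<le> exp (\<mu> * x - \<mu>\<^sup>2 / 2)" by (simp add: power2_eq_square)
      then show ?thesis using mult_left_mono[of 1 "exp (\<mu> * x - \<mu>\<^sup>2 / 2)" "?\<phi> x"]
        by (simp add: shift)
    qed
    then show "AE x in lborel. 0 \<le> ?D x"
      by (intro AE_I2) (auto simp: indicator_def)
  qed
  also have "(LINT x|lborel. ?D x) \<le> \<mu> / sqrt (2 * pi)"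
  proof -
    have "(LINT x|lborel. ?D x)
        = (LINT x|lborel. ?\<phi> x * indicator {- \<mu> / 2<..} x)
          - (LINT x|lborel. ?\<phi> x * indicator {\<mu> / 2<..} x)"
      using I1 I2[of "{\<mu> / 2<..}"] by (simp add: left_diff_distrib 1)
    also have "\<dots> = (LINT x|lborel. ?\<phi> x * indicator {- \<mu> / 2<..\<mu> / 2} x)"
      using assms by (subst Bochner_Integration.integral_diff[symmetric])
        (auto intro!: I2 Bochner_Integration.integral_cong, auto simp: indicator_def)
    also have "\<dots> \<le> (LINT x|lborel. 1 / sqrt (2 * pi) * indicator {- \<mu> / 2<..\<mu> / 2} x)"
    proof (intro integral_mono I2)
      show "integrable lborel (\<lambda>x. 1 / sqrt (2 * pi) * indicator {- \<mu> / 2<..\<mu> / 2} x)"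
        using assms by (intro integrable_mult_right) (auto intro!: integrable_real_indicator)
      show "?\<phi> x * indicator {- \<mu> / 2<..\<mu> / 2} x
          \<le> 1 / sqrt (2 * pi) * indicator {- \<mu> / 2<..\<mu> / 2} x" for x
        unfolding std_normal_density_def
        by (intro mult_right_mono) (auto simp: divide_right_mono)
    qed simp
    also have "\<dots> = \<mu> / sqrt (2 * pi)"
      using assms by simp
    finally show ?thesis .
  qed
  finally show ?thesis by (simp add: ennreal_leI)
qed

section \<open>Propagation of divergence bounds through Gaussian noise\<close>

definition heat :: "real \<Rightarrow> (real ^ 'd \<Rightarrow> real) \<Rightarrow> real ^ 'd \<Rightarrow> real" where
  "heat t F x = (LINT z|gauss. F (x + sqrt t *\<^sub>R z))"

text \<open>The induction hypothesis along the chain. Level 1 alone would already give the Lipschitz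
  estimate, but \<open>hockey_bound_heat\<close> uses the hypothesis at the random level
  \<open>l * tilt w z\<close>.\<close>

definition hockey_bound :: "real \<Rightarrow> (real ^ 'd \<Rightarrow> real) \<Rightarrow> bool" where
  "hockey_bound c g \<longleftrightarrow> (\<forall>x y l. 0 \<le> l \<longrightarrow> ennreal (l * g x - g y) \<le> hockey l (c * norm (x - y)))"

lemma hockey_bound_imp_lipschitz:
  assumes "hockey_bound c g" "0 \<le> c"
  shows "\<bar>g x - g y\<bar> \<le> c / sqrt (2 * pi) * norm (x - y)"
proof -
  have "g x - g y \<le> c * norm (x - y) / sqrt (2 * pi)" for x y
  proof -
    have "ennreal (1 * g x - g y) \<le> hockey 1 (c * norm (x - y))"
      using assms(1) unfolding hockey_bound_def by (meson zero_le_one)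
    also have "\<dots> \<le> ennreal (c * norm (x - y) / sqrt (2 * pi))"
      using assms(2) by (intro hockey_one_le) auto
    finally show ?thesis
      using assms(2) by (subst (asm) ennreal_le_iff) auto
  qed
  from this[of x y] this[of y x] show ?thesis
    by (simp add: norm_minus_commute abs_le_iff)
qed

lemma hockey_bound_comp:
  assumes "hockey_bound c g" "0 \<le> c" "\<And>x y. norm (T x - T y) \<le> \<rho> * norm (x - y)"
  shows "hockey_bound (c * \<rho>) (\<lambda>x. g (T x))"
  unfolding hockey_bound_def
proof (intro allI impI)
  fix x y and l :: real assume "0 \<le> l"
  then have "ennreal (l * g (T x) - g (T y)) \<le> hockey l (c * norm (T x - T y))"
    using assms(1) by (auto simp: hockey_bound_def)
  also have "\<dots> \<le> hockey l (c * \<rho> * norm (x - y))"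
    using assms(2,3) by (intro hockey_mono) (auto simp: mult.assoc mult_left_mono)
  finally show "ennreal (l * g (T x) - g (T y)) \<le> hockey l (c * \<rho> * norm (x - y))" .
qed

text \<open>Cameron-Martin: a fraction of the displacement \<open>x - y\<close> is absorbed by a shift of the noise.\<close>

lemma ennreal_heat_diff_le:
  fixes g :: "real ^ 'd \<Rightarrow> real"
  assumes [measurable]: "g \<in> borel_measurable borel" and bd: "\<And>x. \<bar>g x\<bar> \<le> B"
  shows "ennreal (l * heat t g (y + v + sqrt t *\<^sub>R w) - heat t g y)
    \<le> (\<integral>\<^sup>+z. ennreal (l * tilt w z * g (y + sqrt t *\<^sub>R z + v)
        - g (y + sqrt t *\<^sub>R z)) \<partial>gauss)"
proof -
  have "heat t g (y + v + sqrt t *\<^sub>R w) = (LINT z|gauss. g (y + v + sqrt t *\<^sub>R (z + w)))"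
    by (simp add: heat_def algebra_simps)
  also have "\<dots> = (LINT z|gauss. tilt w z * g (y + v + sqrt t *\<^sub>R z))"
    by (rule integral_gauss_translate) measurable
  finally have 1: "heat t g (y + v + sqrt t *\<^sub>R w)
      = (LINT z|gauss. tilt w z * g (y + sqrt t *\<^sub>R z + v))"
    by (simp add: algebra_simps)
  have I1: "integrable gauss (\<lambda>z. tilt w z * g (y + sqrt t *\<^sub>R z + v))"
  proof (rule Bochner_Integration.integrable_bound)
    show "integrable gauss (\<lambda>z. tilt w z * B)"
      by (intro integrable_mult_left integrable_gauss_exp_inner)
    have "\<bar>g x\<bar> \<le> \<bar>B\<bar>" for x using bd[of x] by linarith
    then show "AE z in gauss. norm (tilt w z * g (y + sqrt t *\<^sub>R z + v))
        \<le> norm (tilt w z * B)"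
      by (auto simp: abs_mult intro!: mult_left_mono)
  qed measurable
  have I2: "integrable gauss (\<lambda>z. g (y + sqrt t *\<^sub>R z))"
    using bd by (intro gauss.integrable_const_bound[where B=B]) auto
  have "l * heat t g (y + v + sqrt t *\<^sub>R w) - heat t g y
      = (LINT z|gauss. l * tilt w z * g (y + sqrt t *\<^sub>R z + v)
        - g (y + sqrt t *\<^sub>R z))"
    using I1 I2 by (simp add: 1 mult.assoc) (simp add: heat_def)
  then show ?thesis
    using I1 I2 by (simp only:) (intro ennreal_integral_le_nn_integral, simp add: mult.assoc)
qed

text \<open>Base of the induction, for an observable that is only measurable with values in [0, 1].
  The whole displacement is moved into the noise, and the positive part of
  \<open>(l * tilt w z - 1) * g\<close> is at most that of \<open>l * tilt w z - 1\<close>.\<close>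

lemma hockey_bound_heat_indicator:
  fixes g :: "real ^ 'd \<Rightarrow> real"
  assumes [measurable]: "g \<in> borel_measurable borel" and bd: "\<And>x. 0 \<le> g x" "\<And>x. g x \<le> 1"
    and t: "0 < t"
  shows "hockey_bound (1 / sqrt t) (heat t g)"
  unfolding hockey_bound_def
proof (intro allI impI)
  fix x y :: "real ^ 'd" and l :: real assume l: "0 \<le> l"
  define w where "w = (1 / sqrt t) *\<^sub>R (x - y)"
  have x: "x = y + 0 + sqrt t *\<^sub>R w" using t by (simp add: w_def)
  have w: "norm w = 1 / sqrt t * norm (x - y)" using t by (simp add: w_def)
  have "ennreal (l * heat t g x - heat t g y)
    \<le> (\<integral>\<^sup>+z. ennreal (l * tilt w z * g (y + sqrt t *\<^sub>R z + 0)
        - g (y + sqrt t *\<^sub>R z)) \<partial>gauss)"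
    using bd by (subst x, intro ennreal_heat_diff_le[where B=1]) (auto simp: abs_le_iff intro: order_trans[of _ 0])
  also have "\<dots> \<le> (\<integral>\<^sup>+z. ennreal (l * tilt w z - 1) \<partial>gauss)"
  proof (intro nn_integral_mono)
    fix z
    let ?L = "l * tilt w z" and ?g = "g (y + sqrt t *\<^sub>R z)"
    have "?L * ?g - ?g \<le> max 0 (?L - 1)"
    proof -
      have "(?L - 1) * ?g \<le> max 0 (?L - 1) * ?g" using bd by (intro mult_right_mono) auto
      also have "\<dots> \<le> max 0 (?L - 1) * 1" using bd by (intro mult_left_mono) auto
      finally show ?thesis by (simp add: algebra_simps)
    qed
    then have "ennreal (?L * ?g - ?g) \<le> ennreal (max 0 (?L - 1))" by (rule ennreal_leI)
    then show "ennreal (?L * g (y + sqrt t *\<^sub>R z + 0) - ?g) \<le> ennreal (?L - 1)"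
      by (simp add: max_def ennreal_neg split: if_splits)
  qed
  also have "\<dots> = hockey l (norm w)"
    unfolding hockey_def
    by (subst nn_integral_gauss_inner[where h="\<lambda>y. ennreal (l * exp (y - (norm w)\<^sup>2 / 2) - 1)"]) auto
  finally show "ennreal (l * heat t g x - heat t g y) \<le> hockey l (1 / sqrt t * norm (x - y))"
    by (simp only: w)
qed

text \<open>For \<open>c > 0\<close> the inverse square of the constant grows by exactly the noise
  variance \<open>t\<close>.\<close>

lemma hockey_bound_heat:
  fixes g :: "real ^ 'd \<Rightarrow> real"
  assumes [measurable]: "g \<in> borel_measurable borel" and bd: "\<And>x. \<bar>g x\<bar> \<le> B"
    and t: "0 < t" and c: "0 \<le> c" and g: "hockey_bound c g"
  shows "hockey_bound (c / sqrt (1 + t * c\<^sup>2)) (heat t g)"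
  unfolding hockey_bound_def
proof (intro allI impI)
  fix x y :: "real ^ 'd" and l :: real assume l: "0 \<le> l"
  \<comment> \<open>\<open>\<theta>\<close> is the fraction of the displacement left to
    \<open>g\<close>. It minimises
    \<open>(1 - \<theta>)\<^sup>2 / t + c\<^sup>2 * \<theta>\<^sup>2\<close>, the squared divergence
    argument per unit of displacement.\<close>
  define \<theta> where "\<theta> = 1 / (1 + t * c\<^sup>2)"
  have pos: "1 + t * c\<^sup>2 > 0" using t by (simp add: add_pos_nonneg)
  define w where "w = ((1 - \<theta>) / sqrt t) *\<^sub>R (x - y)"
  define v where "v = \<theta> *\<^sub>R (x - y)"
  have "sqrt t *\<^sub>R w = (1 - \<theta>) *\<^sub>R (x - y)" using t by (simp add: w_def)
  then have x: "x = y + v + sqrt t *\<^sub>R w" by (simp add: v_def algebra_simps)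
  have "(norm w)\<^sup>2 + (c * norm v)\<^sup>2 = ((1 - \<theta>)\<^sup>2 / t + c\<^sup>2 * \<theta>\<^sup>2) * (norm (x - y))\<^sup>2"
    using t by (simp add: w_def v_def power_mult_distrib power_divide) (simp add: field_simps)
  also have "(1 - \<theta>)\<^sup>2 / t + c\<^sup>2 * \<theta>\<^sup>2 = c\<^sup>2 / (1 + t * c\<^sup>2)"
  proof -
    have *: "1 - \<theta> = t * c\<^sup>2 * \<theta>" using pos by (simp add: \<theta>_def field_simps)
    have "(1 - \<theta>)\<^sup>2 / t + c\<^sup>2 * \<theta>\<^sup>2 = c\<^sup>2 * \<theta> * ((1 + t * c\<^sup>2) * \<theta>)"
      unfolding * using t by (simp add: power2_eq_square field_simps)
    also have "(1 + t * c\<^sup>2) * \<theta> = 1" using pos by (simp add: \<theta>_def)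
    finally show ?thesis by (simp add: \<theta>_def)
  qed
  finally have sq: "sqrt ((norm w)\<^sup>2 + (c * norm v)\<^sup>2) = c / sqrt (1 + t * c\<^sup>2) * norm (x - y)"
    using c by (simp add: real_sqrt_mult real_sqrt_divide)
  have "ennreal (l * heat t g x - heat t g y)
    \<le> (\<integral>\<^sup>+z. ennreal (l * tilt w z * g (y + sqrt t *\<^sub>R z + v)
        - g (y + sqrt t *\<^sub>R z)) \<partial>gauss)"
    by (subst x, intro ennreal_heat_diff_le[where B=B]) (auto simp: bd)
  also have "\<dots> \<le> (\<integral>\<^sup>+z. hockey (l * tilt w z) (c * norm v) \<partial>gauss)"
  proof (intro nn_integral_mono)
    fix z
    have "0 \<le> l * tilt w z" using l by simp
    with g have "ennreal (l * tilt w z * g (y + sqrt t *\<^sub>R z + v)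
        - g (y + sqrt t *\<^sub>R z)) \<le> hockey (l * tilt w z)
          (c * norm (y + sqrt t *\<^sub>R z + v - (y + sqrt t *\<^sub>R z)))"
      unfolding hockey_bound_def by blast
    then show "ennreal (l * tilt w z * g (y + sqrt t *\<^sub>R z + v)
        - g (y + sqrt t *\<^sub>R z)) \<le> hockey (l * tilt w z) (c * norm v)"
      by simp
  qed
  also have "\<dots> = hockey l (sqrt ((norm w)\<^sup>2 + (c * norm v)\<^sup>2))"
    by (rule hockey_compose)
  finally show "ennreal (l * heat t g x - heat t g y)
      \<le> hockey l (c / sqrt (1 + t * c\<^sup>2) * norm (x - y))"
    by (simp only: sq)
qed

section \<open>The Gaussian semigroup\<close>

lemma nn_integral_lborel_affine:
  fixes t :: "'a :: euclidean_space"
  assumes [measurable]: "f \<in> borel_measurable borel" and c: "c \<noteq> 0"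
  shows "(\<integral>\<^sup>+x. f x \<partial>lborel) = ennreal (\<bar>c\<bar> ^ DIM('a)) * (\<integral>\<^sup>+x. f (t + c *\<^sub>R x) \<partial>lborel)"
  by (subst lborel_affine[OF c, of t])
     (simp add: nn_integral_density nn_integral_distr nn_integral_cmult)

text \<open>Expressed in one summand \<open>z\<close> and the normalised weighted sum
  \<open>u\<close>, the joint exponent of two independent Gaussians is a quadratic form symmetric in
  \<open>z\<close> and \<open>u\<close>. Exchanging them splits off the density of
  \<open>u\<close>.\<close>

lemma std_gaussian_density_rotate:
  fixes u z :: "real ^ 'd"
  assumes s: "0 < s" and t: "0 < t"
  shows "std_gaussian_density ((- (sqrt t / sqrt s)) *\<^sub>R z + (sqrt (s + t) / sqrt s) *\<^sub>R u)
      * std_gaussian_density z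
    = std_gaussian_density u
      * std_gaussian_density ((- (sqrt t / sqrt s)) *\<^sub>R u + (sqrt (s + t) / sqrt s) *\<^sub>R z)"
proof -
  have N: "(norm ((- (sqrt t / sqrt s)) *\<^sub>R a + (sqrt (s + t) / sqrt s) *\<^sub>R b))\<^sup>2
     = t / s * (a \<bullet> a) - 2 * (sqrt t * sqrt (s + t) / s) * (a \<bullet> b) + (s + t) / s * (b \<bullet> b)"
    for a b :: "real ^ 'd"
  proof -
    have gen: "(norm (\<alpha> *\<^sub>R a + \<beta> *\<^sub>R b))\<^sup>2
        = \<alpha>\<^sup>2 * (a \<bullet> a) + 2 * (\<alpha> * \<beta>) * (a \<bullet> b) + \<beta>\<^sup>2 * (b \<bullet> b)" for \<alpha> \<beta>
      unfolding power2_norm_eq_inner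
      by (simp add: inner_add_left inner_add_right inner_commute power2_eq_square algebra_simps)
    have "(- (sqrt t / sqrt s)) * (sqrt (s + t) / sqrt s) = - (sqrt t * sqrt (s + t) / s)"
      using s by simp
    moreover have "(- (sqrt t / sqrt s))\<^sup>2 = t / s" "(sqrt (s + t) / sqrt s)\<^sup>2 = (s + t) / s"
      using s t by (simp_all add: power_divide)
    ultimately show ?thesis unfolding gen by (simp only:)
  qed
  have "(norm ((- (sqrt t / sqrt s)) *\<^sub>R z + (sqrt (s + t) / sqrt s) *\<^sub>R u))\<^sup>2 + (norm z)\<^sup>2
    = (norm u)\<^sup>2 + (norm ((- (sqrt t / sqrt s)) *\<^sub>R u + (sqrt (s + t) / sqrt s) *\<^sub>R z))\<^sup>2"
    unfolding N using s t by (simp add: power2_norm_eq_inner inner_commute field_simps)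
  then show ?thesis
    unfolding std_gaussian_density_def
    by (simp add: field_simps flip: exp_add)
qed

text \<open>The inner variable is replaced by the normalised sum \<open>u\<close>. Once the density
  of \<open>u\<close> is factored out, the remaining integral over \<open>z2\<close> is the same
  affine substitution read backwards, so the Jacobian \<open>K\<close> cancels.\<close>

lemma nn_integral_gauss_pair:
  fixes h :: "real ^ 'd \<Rightarrow> ennreal"
  assumes [measurable]: "h \<in> borel_measurable borel" and s: "0 < s" and t: "0 < t"
  shows "(\<integral>\<^sup>+z2. \<integral>\<^sup>+z1. h (sqrt s *\<^sub>R z1 + sqrt t *\<^sub>R z2) \<partial>gauss \<partial>gauss)
    = (\<integral>\<^sup>+z. h (sqrt (s + t) *\<^sub>R z) \<partial>gauss)"
proof -
  let ?p = "\<lambda>z::real^'d. ennreal (std_gaussian_density z)"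
  define r where "r = sqrt (s + t)"
  define K where "K = ennreal (\<bar>r / sqrt s\<bar> ^ DIM(real ^ 'd))"
  define q where "q z u = (- (sqrt t / sqrt s)) *\<^sub>R z + (r / sqrt s) *\<^sub>R u" for z u :: "real ^ 'd"
  have [measurable]: "(\<lambda>x. q (f x) (g x)) \<in> borel_measurable M"
    if [measurable]: "f \<in> borel_measurable M" "g \<in> borel_measurable M" for f g and M :: "'b measure"
    unfolding q_def by measurable
  have r: "r > 0" using s t by (simp add: r_def)
  have q: "sqrt s *\<^sub>R q z u + sqrt t *\<^sub>R z = r *\<^sub>R u" for z u
    using s by (simp add: q_def algebra_simps)
  have "(\<integral>\<^sup>+z2. \<integral>\<^sup>+z1. h (sqrt s *\<^sub>R z1 + sqrt t *\<^sub>R z2) \<partial>gauss \<partial>gauss)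
      = (\<integral>\<^sup>+z2. ?p z2 * (\<integral>\<^sup>+z1. ?p z1 * h (sqrt s *\<^sub>R z1 + sqrt t *\<^sub>R z2) \<partial>lborel) \<partial>lborel)"
    unfolding gauss_def by (simp add: nn_integral_density)
  also have "\<dots> = (\<integral>\<^sup>+z2. ?p z2 * (K * (\<integral>\<^sup>+u. ?p (q z2 u) * h (r *\<^sub>R u) \<partial>lborel)) \<partial>lborel)"
  proof (intro nn_integral_cong)
    fix z2
    have "(\<integral>\<^sup>+z1. ?p z1 * h (sqrt s *\<^sub>R z1 + sqrt t *\<^sub>R z2) \<partial>lborel)
      = K * (\<integral>\<^sup>+u. ?p (q z2 u) * h (sqrt s *\<^sub>R q z2 u + sqrt t *\<^sub>R z2) \<partial>lborel)"
      unfolding K_def q_def using r s by (intro nn_integral_lborel_affine) auto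
    then show "?p z2 * (\<integral>\<^sup>+z1. ?p z1 * h (sqrt s *\<^sub>R z1 + sqrt t *\<^sub>R z2) \<partial>lborel)
      = ?p z2 * (K * (\<integral>\<^sup>+u. ?p (q z2 u) * h (r *\<^sub>R u) \<partial>lborel))"
      by (simp only: q)
  qed
  also have "\<dots> = (\<integral>\<^sup>+z2. \<integral>\<^sup>+u. K * (?p (q z2 u) * ?p z2) * h (r *\<^sub>R u) \<partial>lborel \<partial>lborel)"
    by (simp add: nn_integral_cmult[symmetric] mult_ac)
  also have "\<dots> = (\<integral>\<^sup>+u. \<integral>\<^sup>+z2. K * (?p (q z2 u) * ?p z2) * h (r *\<^sub>R u) \<partial>lborel \<partial>lborel)"
    by (rule lborel_pair.Fubini') measurable
  also have "\<dots> = (\<integral>\<^sup>+u. \<integral>\<^sup>+z2. (?p u * h (r *\<^sub>R u)) * (K * ?p (q u z2)) \<partial>lborel \<partial>lborel)"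
  proof (intro nn_integral_cong)
    fix u z
    have "?p (q z u) * ?p z = ?p u * ?p (q u z)"
      using std_gaussian_density_rotate[OF s t, of z u]
      by (simp add: q_def r_def std_gaussian_density_nonneg del: scaleR_minus_left flip: ennreal_mult)
    then show "K * (?p (q z u) * ?p z) * h (r *\<^sub>R u) = (?p u * h (r *\<^sub>R u)) * (K * ?p (q u z))"
      by (simp add: mult_ac)
  qed
  also have "\<dots> = (\<integral>\<^sup>+u. (?p u * h (r *\<^sub>R u)) * (K * (\<integral>\<^sup>+z2. ?p (q u z2) \<partial>lborel)) \<partial>lborel)"
    by (simp add: nn_integral_cmult)
  also have "\<dots> = (\<integral>\<^sup>+u. (?p u * h (r *\<^sub>R u)) * (\<integral>\<^sup>+z2. ?p z2 \<partial>lborel) \<partial>lborel)"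
  proof -
    have "K * (\<integral>\<^sup>+z2. ?p (q u z2) \<partial>lborel) = (\<integral>\<^sup>+z2. ?p z2 \<partial>lborel)" for u
      unfolding K_def q_def using r s by (intro nn_integral_lborel_affine[symmetric]) auto
    then show ?thesis by simp
  qed
  also have "(\<integral>\<^sup>+z2. ?p z2 \<partial>lborel) = 1"
    using gauss.emeasure_space_1 by (simp add: gauss_def emeasure_density)
  also have "(\<integral>\<^sup>+u. (?p u * h (r *\<^sub>R u)) * 1 \<partial>lborel) = (\<integral>\<^sup>+z. h (r *\<^sub>R z) \<partial>gauss)"
    unfolding gauss_def by (simp add: nn_integral_density)
  finally show ?thesis by (simp add: r_def)
qed

lemma borel_measurable_heat [measurable]:
  assumes [measurable]: "F \<in> borel_measurable borel"
  shows "heat t F \<in> borel_measurable borel"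
  unfolding heat_def[abs_def] by measurable

lemma integrable_gauss_bounded:
  fixes F :: "real ^ 'd \<Rightarrow> real"
  assumes [measurable]: "F \<in> borel_measurable borel" and "\<And>x. \<bar>F x\<bar> \<le> C"
  shows "integrable gauss (\<lambda>z. F (x + c *\<^sub>R z))"
  using assms(2) by (intro gauss.integrable_const_bound[where B=C]) auto

lemma abs_heat_le:
  fixes F :: "real ^ 'd \<Rightarrow> real"
  assumes "F \<in> borel_measurable borel" "\<And>x. \<bar>F x\<bar> \<le> C"
  shows "\<bar>heat t F x\<bar> \<le> C"
proof -
  have "\<bar>heat t F x\<bar> \<le> (LINT z|gauss. \<bar>F (x + sqrt t *\<^sub>R z)\<bar>)"
    unfolding heat_def by (rule integral_abs_bound)
  also have "\<dots> \<le> (LINT z|(gauss :: (real ^ 'd) measure). C)"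
    by (intro integral_mono integrable_abs integrable_gauss_bounded[OF assms]) (auto simp: assms)
  finally show ?thesis by (simp add: gauss.prob_space[simplified])
qed

lemma heat_lipschitz:
  fixes F :: "real ^ 'd \<Rightarrow> real"
  assumes F [measurable]: "F \<in> borel_measurable borel" and bd: "\<And>x. \<bar>F x\<bar> \<le> C"
    and lip: "\<And>x y. \<bar>F x - F y\<bar> \<le> K * norm (x - y)"
  shows "\<bar>heat t F x - heat t F y\<bar> \<le> K * norm (x - y)"
proof -
  have "heat t F x - heat t F y = (LINT z|gauss. F (x + sqrt t *\<^sub>R z) - F (y + sqrt t *\<^sub>R z))"
    unfolding heat_def
    by (intro Bochner_Integration.integral_diff[symmetric] integrable_gauss_bounded[OF F bd])
  also have "\<bar>\<dots>\<bar> \<le> (LINT z|gauss. \<bar>F (x + sqrt t *\<^sub>R z) - F (y + sqrt t *\<^sub>R z)\<bar>)"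
    by (rule integral_abs_bound)
  also have "\<dots> \<le> (LINT z|(gauss :: (real ^ 'd) measure). K * norm (x - y))"
  proof (intro integral_mono integrable_abs Bochner_Integration.integrable_diff integrable_gauss_bounded[OF F bd])
    show "\<bar>F (x + sqrt t *\<^sub>R z) - F (y + sqrt t *\<^sub>R z)\<bar> \<le> K * norm (x - y)" for z
      using lip[of "x + sqrt t *\<^sub>R z" "y + sqrt t *\<^sub>R z"] by simp
  qed simp
  finally show ?thesis by (simp add: gauss.prob_space[simplified])
qed

lemma heat_heat:
  fixes F :: "real ^ 'd \<Rightarrow> real"
  assumes [measurable]: "F \<in> borel_measurable borel" and bd: "\<And>x. \<bar>F x\<bar> \<le> C"
    and s: "0 < s" and t: "0 < t"
  shows "heat s (heat t F) x = heat (s + t) F x"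
proof -
  let ?G = "gauss :: (real ^ 'd) measure"
  let ?D = "distr (?G \<Otimes>\<^sub>M ?G) borel (\<lambda>p. sqrt s *\<^sub>R fst p + sqrt t *\<^sub>R snd p)"
  let ?E = "distr ?G borel (\<lambda>z. sqrt (s + t) *\<^sub>R z)"
  interpret P: pair_prob_space ?G ?G ..
  have eq: "?D
    = ?E"
  proof (rule measure_eqI)
    fix A assume "A \<in> sets (?D)"
    then have [measurable]: "A \<in> sets borel" by simp
    have "emeasure (?D) A
      = (\<integral>\<^sup>+y. indicator A y \<partial>?D)"
      by simp
    also have "\<dots> = (\<integral>\<^sup>+p. indicator A (sqrt s *\<^sub>R fst p + sqrt t *\<^sub>R snd p) \<partial>(?G \<Otimes>\<^sub>M ?G))"
      by (subst nn_integral_distr) auto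
    also have "\<dots> = (\<integral>\<^sup>+z2. \<integral>\<^sup>+z1. indicator A (sqrt s *\<^sub>R z1 + sqrt t *\<^sub>R z2) \<partial>?G \<partial>?G)"
      by (subst P.nn_integral_snd[symmetric]) (auto simp: split_beta)
    also have "\<dots> = (\<integral>\<^sup>+z. indicator A (sqrt (s + t) *\<^sub>R z) \<partial>?G)"
      by (rule nn_integral_gauss_pair[OF _ s t]) simp
    also have "\<dots> = (\<integral>\<^sup>+y. indicator A y \<partial>?E)"
      by (subst nn_integral_distr) auto
    finally show "emeasure (?D) A
      = emeasure (?E) A" by simp
  qed simp
  have "heat s (heat t F) x = (LINT z1|?G. LINT z2|?G. F (x + (sqrt s *\<^sub>R z1 + sqrt t *\<^sub>R z2)))"
    by (simp add: heat_def add.assoc)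
  also have "\<dots> = (LINT p|(?G \<Otimes>\<^sub>M ?G). F (x + (sqrt s *\<^sub>R fst p + sqrt t *\<^sub>R snd p)))"
    using bd by (subst P.integral_fst'[symmetric])
      (auto intro!: P.integrable_const_bound[where B=C])
  also have "\<dots> = (LINT y|?D. F (x + y))"
    by (subst integral_distr) auto
  also have "\<dots> = heat (s + t) F x"
    unfolding eq heat_def by (subst integral_distr) auto
  finally show ?thesis .
qed

section \<open>Gaussian moments and the second-order remainder of the tilt\<close>

lemma integrable_gauss_inner_power: "integrable gauss (\<lambda>z. (z \<bullet> w) ^ k)"
  for w :: "real ^ 'd"
proof -
  have "integrable (distr gauss borel (\<lambda>z. z \<bullet> w)) (\<lambda>y. y ^ k)"
    unfolding distr_gauss_inner
    by (subst integrable_distr_eq)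
       (auto simp: power_mult_distrib integrable_std_normal_distribution_moment)
  then show ?thesis by (subst (asm) integrable_distr_eq) auto
qed

lemma integral_gauss_inner_sq: "(LINT z|gauss. (z \<bullet> w)\<^sup>2) = (norm w)\<^sup>2"
  for w :: "real ^ 'd"
  using std_normal_distribution_even_moments(1)[of 1]
  by (subst integral_gauss_inner) (auto simp: power_mult_distrib)

lemma integral_gauss_inner_zero: "(LINT z|gauss. z \<bullet> w) = 0"
  for w :: "real ^ 'd"
  using integral_std_normal_distribution_moment_odd[of 1]
  by (subst integral_gauss_inner) auto

lemma integrable_gauss_norm_powers:
  "integrable gauss (\<lambda>z::real^'d. (norm z)\<^sup>2)" "integrable gauss (\<lambda>z::real^'d. (norm z) ^ 4)"
proof -
  have sq: "(norm z)\<^sup>2 = (\<Sum>b\<in>Basis. (z \<bullet> b)\<^sup>2)" for z :: "real^'d"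
    unfolding power2_norm_eq_inner by (subst euclidean_inner) (simp add: power2_eq_square)
  show "integrable gauss (\<lambda>z::real^'d. (norm z)\<^sup>2)"
    unfolding sq by (intro Bochner_Integration.integrable_sum integrable_gauss_inner_power)
  have qu: "(norm z) ^ 4 = (\<Sum>b\<in>Basis. \<Sum>c\<in>Basis. (z \<bullet> b)\<^sup>2 * (z \<bullet> c)\<^sup>2)" for z :: "real^'d"
  proof -
    have "(norm z) ^ 4 = (norm z)\<^sup>2 * (norm z)\<^sup>2" by (simp flip: power_add)
    then show ?thesis unfolding sq by (simp add: sum_product)
  qed
  show "integrable gauss (\<lambda>z::real^'d. (norm z) ^ 4)"
    unfolding qu
  proof (intro Bochner_Integration.integrable_sum)
    fix b c :: "real^'d"
    show "integrable gauss (\<lambda>z::real^'d. (z \<bullet> b)\<^sup>2 * (z \<bullet> c)\<^sup>2)"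
    proof (rule Bochner_Integration.integrable_bound)
      show "integrable gauss (\<lambda>z::real^'d. (z \<bullet> b) ^ 4 + (z \<bullet> c) ^ 4)"
        by (intro Bochner_Integration.integrable_add integrable_gauss_inner_power)
      have "p\<^sup>2 * q\<^sup>2 \<le> p ^ 4 + q ^ 4" for p q :: real
      proof -
        have "0 \<le> (p\<^sup>2 - q\<^sup>2)\<^sup>2" by simp
        also have "\<dots> = p ^ 4 + q ^ 4 - 2 * (p\<^sup>2 * q\<^sup>2)" by (simp add: power2_diff flip: power_mult)
        finally have "2 * (p\<^sup>2 * q\<^sup>2) \<le> p ^ 4 + q ^ 4" by simp
        moreover have "0 \<le> p\<^sup>2 * q\<^sup>2" by simp
        ultimately show ?thesis by linarith
      qed
      then show "AE z in gauss. norm ((z \<bullet> b)\<^sup>2 * (z \<bullet> c)\<^sup>2) \<le> norm ((z \<bullet> b) ^ 4 + (z \<bullet> c) ^ 4)"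
        by auto
    qed measurable
  qed
qed

text \<open>\<open>R\<close> is the second-order Taylor remainder of the tilt in \<open>w\<close>.
  With \<open>s = (norm w)\<^sup>2\<close> its second moment is exactly
  \<open>exp s - 1 - s\<close>. For \<open>s \<le> 1\<close> this is at most
  \<open>s\<^sup>2\<close>, and the AM-GM inequality passes to the first moment; for larger
  \<open>s\<close> the triangle inequality is enough.\<close>

lemma gauss_exp_remainder:
  fixes w :: "real ^ 'd"
  defines "R \<equiv> \<lambda>z. tilt w z - 1 - z \<bullet> w"
  shows "integrable gauss R" "(LINT z|gauss. \<bar>R z\<bar>) \<le> 3 * (norm w)\<^sup>2"
proof -
  define X where "X z = tilt w z" for z
  let ?s = "(norm w)\<^sup>2"
  have R: "R = (\<lambda>z. X z - 1 - z \<bullet> w)" by (simp add: R_def X_def)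
  have [measurable]: "X \<in> borel_measurable borel" unfolding X_def by measurable
  have IX: "integrable gauss X" "(LINT z|gauss. X z) = 1"
    using integrable_gauss_exp_inner[of w] integral_gauss_exp_inner[of w] by (simp_all add: X_def[abs_def])
  have I1: "integrable gauss (\<lambda>z. z \<bullet> w)"
    using integrable_gauss_inner_power[of w 1] by simp
  have I2: "integrable gauss (\<lambda>z. (z \<bullet> w)\<^sup>2)"
    by (rule integrable_gauss_inner_power)
  show IR: "integrable gauss R" unfolding R using IX I1 by auto
  have X2: "(X z)\<^sup>2 = exp ?s * tilt (2 *\<^sub>R w) z" for z
    by (simp add: X_def power2_eq_square algebra_simps flip: exp_add)
  have IX2: "integrable gauss (\<lambda>z. (X z)\<^sup>2)" "(LINT z|gauss. (X z)\<^sup>2) = exp ?s"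
    unfolding X2 using integrable_gauss_exp_inner[of "2 *\<^sub>R w"] integral_gauss_exp_inner[of "2 *\<^sub>R w"]
    by simp_all
  have IXw: "integrable gauss (\<lambda>z. X z * (z \<bullet> w))"
  proof (rule Bochner_Integration.integrable_bound)
    show "integrable gauss (\<lambda>z. (X z)\<^sup>2 + (z \<bullet> w)\<^sup>2)" using IX2 I2 by auto
    have "\<bar>p * q\<bar> \<le> p\<^sup>2 + q\<^sup>2" for p q :: real
    proof -
      have "2 * (\<bar>p\<bar> * \<bar>q\<bar>) \<le> p\<^sup>2 + q\<^sup>2"
        using sum_squares_bound[of "\<bar>p\<bar>" "\<bar>q\<bar>"] by (simp add: mult.assoc)
      moreover have "0 \<le> \<bar>p\<bar> * \<bar>q\<bar>" by simp
      ultimately show ?thesis unfolding abs_mult by linarith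
    qed
    then show "AE z in gauss. norm (X z * (z \<bullet> w)) \<le> norm ((X z)\<^sup>2 + (z \<bullet> w)\<^sup>2)"
      by auto
  qed measurable
  have EXw: "(LINT z|gauss. X z * (z \<bullet> w)) = ?s"
  proof -
    have "(LINT z|gauss. X z * (z \<bullet> w)) = (LINT z|gauss. (z + w) \<bullet> w)"
      unfolding X_def by (rule integral_gauss_translate[symmetric]) measurable
    also have "\<dots> = ?s"
      using I1 by (simp add: inner_add_left integral_gauss_inner_zero power2_norm_eq_inner
          gauss.prob_space[simplified])
    finally show ?thesis .
  qed
  have R2: "(R z)\<^sup>2 = (X z)\<^sup>2 + 1 + (z \<bullet> w)\<^sup>2 - 2 * X z - 2 * (X z * (z \<bullet> w)) + 2 * (z \<bullet> w)" for z
    unfolding R by (simp add: power2_eq_square algebra_simps)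
  have IR2: "integrable gauss (\<lambda>z. (R z)\<^sup>2)"
    unfolding R2 using IX IX2 I1 I2 IXw by simp
  have ER2: "(LINT z|gauss. (R z)\<^sup>2) = exp ?s - 1 - ?s"
    unfolding R2 using IX IX2 I1 I2 IXw
    by (simp add: EXw integral_gauss_inner_sq integral_gauss_inner_zero gauss.prob_space[simplified])
  show "(LINT z|gauss. \<bar>R z\<bar>) \<le> 3 * ?s"
  proof (cases "w = 0")
    case True
    then show ?thesis by (simp add: R_def)
  next
    case False
    then have s: "?s > 0" by simp
    show ?thesis
    proof (cases "?s \<le> 1")
      case True
      have "(LINT z|gauss. \<bar>R z\<bar>) \<le> (LINT z|gauss. ((R z)\<^sup>2 / ?s + ?s) / 2)"
      proof (intro integral_mono)
        fix z
        have "0 \<le> (\<bar>R z\<bar> - ?s)\<^sup>2 / ?s" using s by simp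
        also have "\<dots> = (R z)\<^sup>2 / ?s + ?s - 2 * \<bar>R z\<bar>"
          using s by (simp add: power2_diff field_simps)
        finally show "\<bar>R z\<bar> \<le> ((R z)\<^sup>2 / ?s + ?s) / 2" by simp
      qed (use IR IR2 in auto)
      also have "\<dots> = ((exp ?s - 1 - ?s) / ?s + ?s) / 2"
        using IR2 by (simp add: ER2 gauss.prob_space[simplified])
      also have "\<dots> \<le> 3 * ?s"
      proof -
        have "exp ?s - 1 - ?s \<le> ?s * ?s"
          using exp_bound[of ?s] True by (simp add: power2_eq_square)
        then have "(exp ?s - 1 - ?s) / ?s \<le> ?s"
          using s by (simp only: divide_le_eq) simp
        moreover have "(q + p) / 2 \<le> 3 * p" if "q \<le> p" "0 < p" for p q :: real
          using that by simp
        ultimately show ?thesis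
          using s by blast
      qed
      finally show ?thesis .
    next
      case False
      have "(LINT z|gauss. \<bar>R z\<bar>) \<le> (LINT z|gauss. X z + 1 + (1 + (z \<bullet> w)\<^sup>2) / 2)"
      proof (intro integral_mono)
        fix z
        have "2 * \<bar>z \<bullet> w\<bar> \<le> 1 + (z \<bullet> w)\<^sup>2"
          using sum_squares_bound[of 1 "\<bar>z \<bullet> w\<bar>"] by simp
        moreover have "0 \<le> X z" by (simp add: X_def)
        moreover have "\<bar>p - 1 - q\<bar> \<le> p + 1 + r / 2" if "2 * \<bar>q\<bar> \<le> r" "0 \<le> p" for p q r :: real
          using that by (auto simp: abs_if split: if_splits)
        ultimately show "\<bar>R z\<bar> \<le> X z + 1 + (1 + (z \<bullet> w)\<^sup>2) / 2"
          unfolding R by blast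
      qed (use IR IX I2 in auto)
      also have "\<dots> = 2 + (1 + ?s) / 2"
        using IX I2 by (simp add: integral_gauss_inner_sq gauss.prob_space[simplified])
      finally have "(LINT z|gauss. \<bar>R z\<bar>) \<le> 2 + (1 + ?s) / 2" .
      moreover have "q \<le> 3 * p" if "q \<le> 2 + (1 + p) / 2" "\<not> p \<le> 1" for p q :: real
      proof -
        have "2 * q \<le> 5 + p" using that(1) by (simp add: field_simps)
        then show ?thesis using that(2) by linarith
      qed
      ultimately show ?thesis using False by blast
    qed
  qed
qed

section \<open>The Gaussian Poincare inequality\<close>

text \<open>By Cameron-Martin, an increment of \<open>heat t F\<close> integrates \<open>F\<close>
  against an increment of the tilt. The linear part of the tilt produces the gradient, and its
  remainder produces a quadratic error controlled by the supremum of \<open>F\<close>.\<close>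

lemma heat_linear_approx:
  fixes F :: "real ^ 'd \<Rightarrow> real"
  assumes F [measurable]: "F \<in> borel_measurable borel" and bd: "\<And>x. \<bar>F x\<bar> \<le> C"
    and lip: "\<And>x y. \<bar>F x - F y\<bar> \<le> K * norm (x - y)"
    and K: "0 \<le> K" and t: "0 < t"
  obtains v where "norm v \<le> K"
    and "\<And>u. \<bar>heat t F (x + u) - heat t F x - v \<bullet> u\<bar> \<le> 3 * C / t * (norm u)\<^sup>2"
proof -
  let ?F = "\<lambda>z. F (x + sqrt t *\<^sub>R z)"
  \<comment> \<open>Gaussian integration by parts: \<open>A u\<close> is the derivative of
    \<open>heat t F\<close> at \<open>x\<close> in direction \<open>u\<close>, written without
    differentiating \<open>F\<close>.\<close>
  define A where "A u = (LINT z|gauss. (z \<bullet> u) * ?F z) / sqrt t" for u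
  have C: "0 \<le> C" using bd[of 0] by linarith
  have I: "integrable gauss (\<lambda>z. (z \<bullet> u) * ?F z)" for u
  proof (rule Bochner_Integration.integrable_bound)
    show "integrable gauss (\<lambda>z. (z \<bullet> u) * C)"
      using integrable_gauss_inner_power[of u 1] by simp
    show "AE z in gauss. norm ((z \<bullet> u) * ?F z) \<le> norm ((z \<bullet> u) * C)"
      using C bd by (auto simp: abs_mult intro!: mult_left_mono)
  qed measurable
  have "linear A"
    using t I by (intro linearI)
      (simp_all add: A_def inner_add_right distrib_right add_divide_distrib mult.assoc)
  then obtain v where v: "A u = v \<bullet> u" for u
  proof -
    assume *: "\<And>v. (\<And>u. A u = v \<bullet> u) \<Longrightarrow> thesis"
    have "A u = adjoint A 1 \<bullet> u" for u
      using adjoint_works[OF \<open>linear A\<close>, of u 1] by (simp add: inner_commute)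
    then show thesis by (rule *)
  qed
  have approx: "\<bar>heat t F (x + u) - heat t F x - v \<bullet> u\<bar> \<le> 3 * C / t * (norm u)\<^sup>2" for u
  proof -
    define w where "w = (1 / sqrt t) *\<^sub>R u"
    let ?R = "\<lambda>z. tilt w z - 1 - z \<bullet> w"
    have u: "u = sqrt t *\<^sub>R w" and w: "(norm w)\<^sup>2 = (norm u)\<^sup>2 / t"
      using t by (simp_all add: w_def power_divide)
    have IF: "integrable gauss ?F" by (rule integrable_gauss_bounded[OF F bd])
    have IX: "integrable gauss (\<lambda>z. tilt w z * ?F z)"
    proof (rule Bochner_Integration.integrable_bound)
      show "integrable gauss (\<lambda>z. tilt w z * C)"
        by (intro integrable_mult_left integrable_gauss_exp_inner)
      show "AE z in gauss. norm (tilt w z * ?F z)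
          \<le> norm (tilt w z * C)"
        using C bd by (auto simp: abs_mult intro!: mult_left_mono)
    qed measurable
    have "heat t F (x + u) = (LINT z|gauss. ?F (z + w))"
      by (simp add: heat_def u algebra_simps)
    also have "\<dots> = (LINT z|gauss. tilt w z * ?F z)"
      by (rule integral_gauss_translate) measurable
    finally have 1: "heat t F (x + u) = (LINT z|gauss. tilt w z * ?F z)" .
    have 2: "v \<bullet> u = (LINT z|gauss. (z \<bullet> w) * ?F z)"
      using t by (simp add: u v[symmetric] A_def mult.assoc)
    have 3: "(\<lambda>z. ?R z * ?F z) = (\<lambda>z. tilt w z * ?F z - ?F z - (z \<bullet> w) * ?F z)"
      by (simp add: algebra_simps)
    have IR: "integrable gauss (\<lambda>z. ?R z * ?F z)"
      unfolding 3 using IF IX I[of w] by auto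
    have "heat t F (x + u) - heat t F x - v \<bullet> u = (LINT z|gauss. ?R z * ?F z)"
      unfolding 3 1 2 heat_def[of t F x] using IF IX I[of w] by simp
    also have "\<bar>\<dots>\<bar> \<le> (LINT z|gauss. \<bar>?R z * ?F z\<bar>)"
      by (rule integral_abs_bound)
    also have "\<dots> \<le> (LINT z|gauss. \<bar>?R z\<bar> * C)"
    proof (intro integral_mono integrable_abs integrable_mult_left)
      show "integrable gauss ?R" by (rule gauss_exp_remainder)
      show "\<bar>?R z * ?F z\<bar> \<le> \<bar>?R z\<bar> * C" for z
        unfolding abs_mult using bd by (intro mult_left_mono) auto
    qed (rule IR)
    also have "\<dots> \<le> 3 * (norm w)\<^sup>2 * C"
      using gauss_exp_remainder(2)[of w] C by (simp add: mult_right_mono)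
    also have "\<dots> = 3 * C / t * (norm u)\<^sup>2" by (simp add: w)
    finally show ?thesis .
  qed
  have "norm v \<le> K"
  proof (rule field_le_epsilon)
    fix e :: real assume e: "0 < e"
    define M where "M = 3 * C / t"
    have M: "0 \<le> M" using C t by (simp add: M_def)
    \<comment> \<open>The test displacement \<open>\<delta> *\<^sub>R v\<close> is so short that,
      after division by \<open>\<delta> * norm v\<close>, the quadratic error contributes at most
      \<open>e\<close>.\<close>
    define \<delta> where "\<delta> = e / (M * norm v + 1)"
    have den: "M * norm v + 1 > 0" using M by (simp add: add_nonneg_pos)
    then have \<delta>: "\<delta> > 0" using e by (simp add: \<delta>_def)
    have "\<bar>heat t F (x + \<delta> *\<^sub>R v) - heat t F x\<bar> \<le> K * norm (\<delta> *\<^sub>R v)"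
      using heat_lipschitz[OF F bd lip, of t "x + \<delta> *\<^sub>R v" x] by simp
    with approx[of "\<delta> *\<^sub>R v"]
    have "\<bar>v \<bullet> (\<delta> *\<^sub>R v)\<bar> \<le> K * norm (\<delta> *\<^sub>R v) + M * (norm (\<delta> *\<^sub>R v))\<^sup>2"
      unfolding M_def by linarith
    then have "\<delta> * (norm v * norm v) \<le> \<delta> * (norm v * (K + M * \<delta> * norm v))"
      using \<delta> by (simp add: power2_norm_eq_inner[symmetric] power2_eq_square algebra_simps)
    then have *: "norm v * norm v \<le> norm v * (K + M * \<delta> * norm v)"
      using \<delta> by simp
    show "norm v \<le> K + e"
    proof (cases "norm v = 0")
      case True
      then show ?thesis using K e by simp
    next
      case False
      then have "norm v \<le> K + M * \<delta> * norm v" using * by simp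
      also have "M * \<delta> * norm v = e * (M * norm v / (M * norm v + 1))"
        by (simp add: \<delta>_def)
      also have "\<dots> \<le> e * 1"
        using e den by (intro mult_left_mono) auto
      finally show ?thesis by simp
    qed
  qed
  with approx that show thesis by blast
qed

definition heat_var :: "real \<Rightarrow> (real ^ 'd \<Rightarrow> real) \<Rightarrow> real ^ 'd \<Rightarrow> real" where
  "heat_var t F x = heat t (\<lambda>y. (F y)\<^sup>2) x - (heat t F x)\<^sup>2"

lemma heat_diff:
  fixes F G :: "real ^ 'd \<Rightarrow> real"
  assumes "F \<in> borel_measurable borel" "\<And>x. \<bar>F x\<bar> \<le> C"
    and "G \<in> borel_measurable borel" "\<And>x. \<bar>G x\<bar> \<le> D"
  shows "heat t (\<lambda>x. F x - G x) x = heat t F x - heat t G x"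
  unfolding heat_def
  by (intro Bochner_Integration.integral_diff integrable_gauss_bounded[OF assms(1,2)]
      integrable_gauss_bounded[OF assms(3,4)])

lemma abs_square_le: "\<bar>a\<bar> \<le> C \<Longrightarrow> \<bar>a\<^sup>2\<bar> \<le> C\<^sup>2" for a :: real
  by (simp add: abs_le_square_iff[symmetric])

lemma heat_var_eq:
  fixes F :: "real ^ 'd \<Rightarrow> real"
  assumes F [measurable]: "F \<in> borel_measurable borel" and bd: "\<And>x. \<bar>F x\<bar> \<le> C"
  shows "heat_var t F x = (LINT z|gauss. (F (x + sqrt t *\<^sub>R z) - a)\<^sup>2) - (heat t F x - a)\<^sup>2"
proof -
  let ?F = "\<lambda>z. F (x + sqrt t *\<^sub>R z)"
  have I: "integrable gauss ?F" "integrable gauss (\<lambda>z. (?F z)\<^sup>2)"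
    using integrable_gauss_bounded[OF F bd] integrable_gauss_bounded[of "\<lambda>y. (F y)\<^sup>2" "C\<^sup>2"]
      abs_square_le[OF bd] by auto
  have "(LINT z|gauss. (?F z - a)\<^sup>2) = (LINT z|gauss. (?F z)\<^sup>2 - 2 * a * ?F z + a\<^sup>2)"
    by (simp add: power2_diff algebra_simps)
  also have "\<dots> = heat t (\<lambda>y. (F y)\<^sup>2) x - 2 * a * heat t F x + a\<^sup>2"
    using I by (simp add: heat_def gauss.prob_space[simplified])
  finally show ?thesis
    by (simp add: heat_var_def power2_diff algebra_simps)
qed

lemma heat_var_le:
  fixes F :: "real ^ 'd \<Rightarrow> real"
  assumes F: "F \<in> borel_measurable borel" and bd: "\<And>x. \<bar>F x\<bar> \<le> C"
  shows "heat_var t F x \<le> (LINT z|gauss. (F (x + sqrt t *\<^sub>R z) - a)\<^sup>2)"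
  unfolding heat_var_eq[OF F bd, of t x a] by simp

text \<open>Law of total variance for noise of variance \<open>s + t\<close> drawn in two stages:
  mean conditional variance plus variance of the conditional mean.\<close>

lemma heat_var_split:
  fixes F :: "real ^ 'd \<Rightarrow> real"
  assumes F [measurable]: "F \<in> borel_measurable borel" and bd: "\<And>x. \<bar>F x\<bar> \<le> C"
    and s: "0 < s" and t: "0 < t" and B: "\<And>y. heat_var t F y \<le> B"
  shows "heat_var (s + t) F x \<le> B + heat_var s (heat t F) x"
proof -
  have F2: "(\<lambda>y. (F y)\<^sup>2) \<in> borel_measurable borel" "\<And>y. \<bar>(F y)\<^sup>2\<bar> \<le> C\<^sup>2"
    using abs_square_le[OF bd] by auto
  have H: "heat t F \<in> borel_measurable borel" "\<And>y. \<bar>heat t F y\<bar> \<le> C"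
    using abs_heat_le[OF F bd] by auto
  have H2: "heat t (\<lambda>y. (F y)\<^sup>2) \<in> borel_measurable borel" "\<And>y. \<bar>heat t (\<lambda>y. (F y)\<^sup>2) y\<bar> \<le> C\<^sup>2"
    using abs_heat_le[OF F2] by auto
  have HS: "(\<lambda>y. (heat t F y)\<^sup>2) \<in> borel_measurable borel" "\<And>y. \<bar>(heat t F y)\<^sup>2\<bar> \<le> C\<^sup>2"
    using abs_square_le[OF H(2)] by auto
  have "heat_var (s + t) F x = heat s (heat t (\<lambda>y. (F y)\<^sup>2)) x - (heat s (heat t F) x)\<^sup>2"
    unfolding heat_var_def heat_heat[OF F bd s t] heat_heat[OF F2 s t] ..
  also have "\<dots> = heat s (\<lambda>y. heat t (\<lambda>y. (F y)\<^sup>2) y - (heat t F y)\<^sup>2) x + heat_var s (heat t F) x"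
    unfolding heat_diff[OF H2 HS] by (simp add: heat_var_def)
  also have "heat s (\<lambda>y. heat t (\<lambda>y. (F y)\<^sup>2) y - (heat t F y)\<^sup>2) x \<le> B"
  proof -
    let ?D = "\<lambda>y. heat t (\<lambda>y. (F y)\<^sup>2) y - (heat t F y)\<^sup>2"
    have bdD: "\<bar>?D y\<bar> \<le> 2 * C\<^sup>2" for y
      using H2(2)[of y] HS(2)[of y] by linarith
    have "heat s ?D x \<le> (LINT z|(gauss :: (real ^ 'd) measure). B)"
      unfolding heat_def[of s]
    proof (intro integral_mono)
      show "integrable gauss (\<lambda>z. ?D (x + sqrt s *\<^sub>R z))"
        by (rule integrable_gauss_bounded[OF _ bdD]) measurable
    qed (use B in \<open>auto simp: heat_var_def\<close>)
    then show ?thesis by (simp add: gauss.prob_space[simplified])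
  qed
  finally show ?thesis by simp
qed

text \<open>Over a short time the smoothed function is affine up to a quadratic error. Young's
  inequality with parameter \<open>\<eta>\<close> keeps the bound \<open>h * K\<^sup>2\<close> for
  the linear part nearly sharp and leaves an error of order \<open>h\<^sup>2\<close>.\<close>

lemma heat_var_smooth_le:
  fixes F :: "real ^ 'd \<Rightarrow> real"
  assumes F [measurable]: "F \<in> borel_measurable borel" and bd: "\<And>x. \<bar>F x\<bar> \<le> C"
    and lip: "\<And>x y. \<bar>F x - F y\<bar> \<le> K * norm (x - y)"
    and K: "0 \<le> K" and \<epsilon>: "0 < \<epsilon>" and h: "0 < h" and \<eta>: "0 < \<eta>"
  shows "heat_var h (heat \<epsilon> F) x \<le> (1 + \<eta>) * h * K\<^sup>2
    + (1 + 1 / \<eta>) * (3 * C / \<epsilon>)\<^sup>2 * h\<^sup>2 * (LINT z|(gauss :: (real ^ 'd) measure). norm z ^ 4)"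
proof -
  let ?G = "heat \<epsilon> F" and ?M = "3 * C / \<epsilon>"
  obtain v where v: "norm v \<le> K"
    and app: "\<And>u. \<bar>?G (x + u) - ?G x - v \<bullet> u\<bar> \<le> ?M * (norm u)\<^sup>2"
    using heat_linear_approx[OF F bd lip K \<epsilon>, of x] by blast
  have M: "0 \<le> ?M" using bd[of 0] \<epsilon> by simp
  have young: "(p + q)\<^sup>2 \<le> (1 + \<eta>) * p\<^sup>2 + (1 + 1 / \<eta>) * q\<^sup>2" for p q :: real
  proof -
    have "0 \<le> (\<eta> * p - q)\<^sup>2 / \<eta>" using \<eta> by simp
    also have "\<dots> = \<eta> * p\<^sup>2 + q\<^sup>2 / \<eta> - 2 * p * q"
      using \<eta> by (simp add: power2_eq_square field_simps)
    finally show ?thesis by (simp add: power2_sum algebra_simps)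
  qed
  have pt: "(?G (x + sqrt h *\<^sub>R z) - ?G x)\<^sup>2
      \<le> (1 + \<eta>) * h * (z \<bullet> v)\<^sup>2 + (1 + 1 / \<eta>) * ?M\<^sup>2 * h\<^sup>2 * norm z ^ 4" for z
  proof -
    let ?u = "sqrt h *\<^sub>R z"
    have "(?G (x + ?u) - ?G x)\<^sup>2 = (v \<bullet> ?u + (?G (x + ?u) - ?G x - v \<bullet> ?u))\<^sup>2" by simp
    also have "\<dots> \<le> (1 + \<eta>) * (v \<bullet> ?u)\<^sup>2 + (1 + 1 / \<eta>) * (?G (x + ?u) - ?G x - v \<bullet> ?u)\<^sup>2"
      by (rule young)
    also have "\<dots> \<le> (1 + \<eta>) * (v \<bullet> ?u)\<^sup>2 + (1 + 1 / \<eta>) * (?M * (norm ?u)\<^sup>2)\<^sup>2"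
    proof (intro add_left_mono mult_left_mono)
      show "(?G (x + ?u) - ?G x - v \<bullet> ?u)\<^sup>2 \<le> (?M * (norm ?u)\<^sup>2)\<^sup>2"
        using app[of ?u] M by (subst power2_le_iff_abs_le) (auto simp del: norm_scaleR)
    qed (use \<eta> in auto)
    also have "\<dots> = (1 + \<eta>) * h * (z \<bullet> v)\<^sup>2 + (1 + 1 / \<eta>) * ?M\<^sup>2 * h\<^sup>2 * norm z ^ 4"
      using h by (simp add: inner_commute power_mult_distrib power_divide mult_ac flip: power_mult)
    finally show ?thesis .
  qed
  have G: "?G \<in> borel_measurable borel" "\<And>y. \<bar>?G y\<bar> \<le> C"
    using abs_heat_le[OF F bd] by auto
  have I: "integrable gauss (\<lambda>z. (?G (x + sqrt h *\<^sub>R z) - ?G x)\<^sup>2)"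
  proof -
    have "\<bar>(?G y - ?G x)\<^sup>2\<bar> \<le> (2 * C)\<^sup>2" for y
      using G(2)[of x] G(2)[of y] by (intro abs_square_le) linarith
    then show ?thesis
      by (intro integrable_gauss_bounded[where F="\<lambda>y. (?G y - ?G x)\<^sup>2"]) auto
  qed
  have "heat_var h ?G x \<le> (LINT z|gauss. (?G (x + sqrt h *\<^sub>R z) - ?G x)\<^sup>2)"
    by (rule heat_var_le[OF G])
  also have "\<dots> \<le> (LINT z|gauss. (1 + \<eta>) * h * (z \<bullet> v)\<^sup>2 + (1 + 1 / \<eta>) * ?M\<^sup>2 * h\<^sup>2 * norm z ^ 4)"
    using integrable_gauss_inner_power[of v 2] integrable_gauss_norm_powers(2)[where 'd='d]
    by (intro integral_mono I pt) auto
  also have "\<dots> = (1 + \<eta>) * h * (norm v)\<^sup>2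
      + (1 + 1 / \<eta>) * ?M\<^sup>2 * h\<^sup>2 * (LINT z|(gauss :: (real ^ 'd) measure). norm z ^ 4)"
    using integrable_gauss_inner_power[of v 2] integrable_gauss_norm_powers(2)[where 'd='d]
    by (simp add: integral_gauss_inner_sq)
  also have "(1 + \<eta>) * h * (norm v)\<^sup>2 \<le> (1 + \<eta>) * h * K\<^sup>2"
    using v \<eta> h by (intro mult_left_mono power_mono) auto
  finally show ?thesis by simp
qed

text \<open>Total variance over \<open>Suc n\<close> short steps. The errors add up to order
  \<open>n * h\<^sup>2\<close>, which vanishes as \<open>h\<close> tends to 0 at a fixed total
  time.\<close>

lemma heat_var_smooth_iterate:
  fixes F :: "real ^ 'd \<Rightarrow> real"
  assumes "F \<in> borel_measurable borel" and "\<And>x. \<bar>F x\<bar> \<le> C"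
    and "\<And>x y. \<bar>F x - F y\<bar> \<le> K * norm (x - y)"
    and K: "0 \<le> K" and \<epsilon>: "0 < \<epsilon>" and h: "0 < h" and \<eta>: "0 < \<eta>"
  shows "heat_var (real (Suc n) * h) (heat \<epsilon> F) x \<le> real (Suc n) * ((1 + \<eta>) * h * K\<^sup>2
    + (1 + 1 / \<eta>) * (3 * C / \<epsilon>)\<^sup>2 * h\<^sup>2 * (LINT z|(gauss :: (real ^ 'd) measure). norm z ^ 4))"
    (is "_ \<le> _ * ?b")
  using assms(1-3)
proof (induction n arbitrary: x)
  case 0
  then show ?case
    using heat_var_smooth_le[of F C K \<epsilon> h \<eta>] K \<epsilon> h \<eta> by simp
next
  case (Suc n)
  note F = Suc.prems
  let ?t = "real (Suc n) * h"
  have t: "0 < ?t" using h by simp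
  have H: "heat \<epsilon> F \<in> borel_measurable borel" "\<And>y. \<bar>heat \<epsilon> F y\<bar> \<le> C"
    using abs_heat_le[OF F(1,2)] F(1) by auto
  have Ht: "heat ?t F \<in> borel_measurable borel" "\<And>y. \<bar>heat ?t F y\<bar> \<le> C"
    using abs_heat_le[OF F(1,2)] F(1) by auto
  \<comment> \<open>Commuting the semigroup puts the smoothing outermost, so the one-step bound
    applies to \<open>heat ?t F\<close>, which still has Lipschitz constant
    \<open>K\<close>.\<close>
  have comm: "heat ?t (heat \<epsilon> F) = heat \<epsilon> (heat ?t F)"
    using heat_heat[OF F(1,2) t \<epsilon>] heat_heat[OF F(1,2) \<epsilon> t] by (auto simp: add.commute)
  have "heat_var (real (Suc (Suc n)) * h) (heat \<epsilon> F) x = heat_var (h + ?t) (heat \<epsilon> F) x"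
    by (simp add: algebra_simps)
  also have "\<dots> \<le> real (Suc n) * ?b + heat_var h (heat ?t (heat \<epsilon> F)) x"
    by (rule heat_var_split[OF H h t]) (rule Suc.IH[OF F])
  also have "heat_var h (heat ?t (heat \<epsilon> F)) x \<le> ?b"
    unfolding comm using heat_lipschitz[OF F] K \<epsilon> h \<eta>
    by (intro heat_var_smooth_le[OF Ht]) auto
  also have "real (Suc n) * ?b + ?b = real (Suc (Suc n)) * ?b"
    by (simp only: of_nat_Suc distrib_right) simp
  finally show ?case by simp
qed

text \<open>Infinitesimal variances are summed along the heat flow. Three limits remove the
  auxiliary parameters: the step length, the Young parameter \<open>\<eta>\<close>, and the
  smoothing time \<open>\<epsilon>\<close>, which is there because \<open>F\<close> itself is only
  Lipschitz.\<close>

theorem gaussian_poincare: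
  fixes F :: "real ^ 'd \<Rightarrow> real"
  assumes F [measurable]: "F \<in> borel_measurable borel" and bd: "\<And>x. \<bar>F x\<bar> \<le> C"
    and lip: "\<And>x y. \<bar>F x - F y\<bar> \<le> K * norm (x - y)"
    and K: "0 \<le> K" and t: "0 < t"
  shows "heat_var t F x \<le> t * K\<^sup>2"
proof -
  define m4 where "m4 = (LINT z|(gauss :: (real ^ 'd) measure). norm z ^ 4)"
  define m2 where "m2 = (LINT z|(gauss :: (real ^ 'd) measure). (norm z)\<^sup>2)"
  have smooth: "heat_var s (heat \<epsilon> F) y \<le> s * K\<^sup>2" if s: "0 < s" and \<epsilon>: "0 < \<epsilon>" for s \<epsilon> y
  proof -
    have "heat_var s (heat \<epsilon> F) y \<le> (1 + \<eta>) * (s * K\<^sup>2)" if \<eta>: "0 < \<eta>" for \<eta>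
    proof (rule LIMSEQ_le_const)
      let ?c = "(1 + 1 / \<eta>) * (3 * C / \<epsilon>)\<^sup>2 * s\<^sup>2 * m4"
      have "(\<lambda>n. inverse (real (Suc n))) \<longlonglongrightarrow> 0" by (rule LIMSEQ_inverse_real_of_nat)
      then have "(\<lambda>n. (1 + \<eta>) * (s * K\<^sup>2) + ?c * inverse (real (Suc n)))
          \<longlonglongrightarrow> (1 + \<eta>) * (s * K\<^sup>2) + ?c * 0"
        by (intro tendsto_intros)
      then show "(\<lambda>n. (1 + \<eta>) * (s * K\<^sup>2) + ?c * inverse (real (Suc n))) \<longlonglongrightarrow> (1 + \<eta>) * (s * K\<^sup>2)"
        by simp
      have "heat_var s (heat \<epsilon> F) y \<le> (1 + \<eta>) * (s * K\<^sup>2) + ?c * inverse (real (Suc n))" for n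
      proof -
        let ?h = "s / real (Suc n)"
        have "heat_var (real (Suc n) * ?h) (heat \<epsilon> F) y \<le> real (Suc n) * ((1 + \<eta>) * ?h * K\<^sup>2
          + (1 + 1 / \<eta>) * (3 * C / \<epsilon>)\<^sup>2 * ?h\<^sup>2 * m4)"
          unfolding m4_def using s by (intro heat_var_smooth_iterate[OF F bd lip K \<epsilon> _ \<eta>]) simp
        also have "\<dots> = (1 + \<eta>) * (s * K\<^sup>2) + ?c * inverse (real (Suc n))"
        proof -
          have "r * (a * (s / r) * k + b * (s / r)\<^sup>2 * m4) = a * (s * k) + b * s\<^sup>2 * m4 * inverse r"
            if "r \<noteq> 0" for r a b k :: real
            using that by (simp add: power2_eq_square field_simps)
          then show ?thesis by simp
        qed
        finally show ?thesis by simp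
      qed
      then show "\<exists>N. \<forall>n\<ge>N. heat_var s (heat \<epsilon> F) y \<le> (1 + \<eta>) * (s * K\<^sup>2) + ?c * inverse (real (Suc n))"
        by blast
    qed
    note * = this
    show ?thesis
    proof (rule field_le_epsilon)
      fix e :: real assume e: "0 < e"
      have p: "s * K\<^sup>2 + 1 > 0" using s by (simp add: add_nonneg_pos)
      have "heat_var s (heat \<epsilon> F) y \<le> (1 + e / (s * K\<^sup>2 + 1)) * (s * K\<^sup>2)"
        using e p by (intro *) auto
      also have "\<dots> = s * K\<^sup>2 + e * (s * K\<^sup>2 / (s * K\<^sup>2 + 1))"
        by (simp add: algebra_simps)
      also have "\<dots> \<le> s * K\<^sup>2 + e * 1"
        using e p by (intro add_left_mono mult_left_mono) auto
      finally show "heat_var s (heat \<epsilon> F) y \<le> s * K\<^sup>2 + e" by simp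
    qed
  qed
  \<comment> \<open>The last stretch of noise acts on the unsmoothed \<open>F\<close>. The crude
    bound with the second moment \<open>m2\<close> depends on the dimension but tends to 0 with
    \<open>\<epsilon>\<close>.\<close>
  have small: "heat_var \<epsilon> F y \<le> \<epsilon> * K\<^sup>2 * m2" if \<epsilon>: "0 < \<epsilon>" for \<epsilon> y
  proof -
    have "heat_var \<epsilon> F y \<le> (LINT z|gauss. (F (y + sqrt \<epsilon> *\<^sub>R z) - F y)\<^sup>2)"
      by (rule heat_var_le[OF F bd])
    also have "\<dots> \<le> (LINT z|(gauss :: (real ^ 'd) measure). \<epsilon> * K\<^sup>2 * (norm z)\<^sup>2)"
    proof (intro integral_mono)
      have "\<bar>(F z - F y)\<^sup>2\<bar> \<le> (2 * C)\<^sup>2" for z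
        using bd[of y] bd[of z] by (intro abs_square_le) linarith
      then show "integrable gauss (\<lambda>z. (F (y + sqrt \<epsilon> *\<^sub>R z) - F y)\<^sup>2)"
        by (intro integrable_gauss_bounded[where F="\<lambda>z. (F z - F y)\<^sup>2"]) auto
      show "integrable gauss (\<lambda>z::real^'d. \<epsilon> * K\<^sup>2 * (norm z)\<^sup>2)"
        by (intro integrable_mult_right integrable_gauss_norm_powers)
      show "(F (y + sqrt \<epsilon> *\<^sub>R z) - F y)\<^sup>2 \<le> \<epsilon> * K\<^sup>2 * (norm z)\<^sup>2" for z
      proof -
        have "\<bar>F (y + sqrt \<epsilon> *\<^sub>R z) - F y\<bar> \<le> K * (sqrt \<epsilon> * norm z)"
          using lip[of "y + sqrt \<epsilon> *\<^sub>R z" y] \<epsilon> by simp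
        then have "(F (y + sqrt \<epsilon> *\<^sub>R z) - F y)\<^sup>2 \<le> (K * (sqrt \<epsilon> * norm z))\<^sup>2"
          using K \<epsilon> by (auto simp: abs_le_square_iff[symmetric])
        then show ?thesis using \<epsilon> by (simp add: power_mult_distrib mult_ac)
      qed
    qed
    finally show ?thesis by (simp add: m2_def)
  qed
  show ?thesis
  proof (rule field_le_epsilon)
    fix e :: real assume e: "0 < e"
    have m2: "0 \<le> m2" unfolding m2_def by (intro Bochner_Integration.integral_nonneg) simp
    have p: "K\<^sup>2 * m2 + 1 > 0" using m2 by (simp add: add_nonneg_pos)
    define \<epsilon> where "\<epsilon> = min (t / 2) (e / (K\<^sup>2 * m2 + 1))"
    have \<epsilon>: "0 < \<epsilon>" "\<epsilon> < t" "\<epsilon> \<le> e / (K\<^sup>2 * m2 + 1)"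
      using t e p by (auto simp: \<epsilon>_def)
    have "heat_var t F x \<le> \<epsilon> * K\<^sup>2 * m2 + heat_var (t - \<epsilon>) (heat \<epsilon> F) x"
      using heat_var_split[OF F bd, of "t - \<epsilon>" \<epsilon> "\<epsilon> * K\<^sup>2 * m2" x] small \<epsilon> by simp
    also have "\<dots> \<le> \<epsilon> * K\<^sup>2 * m2 + t * K\<^sup>2"
      using smooth[of "t - \<epsilon>" \<epsilon> x] \<epsilon> mult_right_mono[of "t - \<epsilon>" t "K\<^sup>2"] by simp
    also have "\<epsilon> * K\<^sup>2 * m2 \<le> e / (K\<^sup>2 * m2 + 1) * (K\<^sup>2 * m2 + 1)"
      unfolding mult.assoc using \<epsilon> e m2 p by (intro mult_mono) auto
    also have "\<dots> = e" using p by simp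
    finally show "heat_var t F x \<le> t * K\<^sup>2 + e" by simp
  qed
qed

section \<open>The Langevin kernels\<close>

definition ula_kernel ::
  "(real ^ 'd \<Rightarrow> real ^ 'd) \<Rightarrow> (nat \<Rightarrow> real) \<Rightarrow> nat \<Rightarrow> (real ^ 'd \<Rightarrow> real) \<Rightarrow> real ^ 'd \<Rightarrow> real" where
  "ula_kernel G \<gamma> k F x = heat (2 * \<gamma> k) F (x - \<gamma> k *\<^sub>R G x)"

text \<open>The conditional expectation of \<open>f\<close> at time \<open>j - 1 + m\<close> given
  the state at time \<open>j - 1\<close>: \<open>j\<close> is the index of the next step size to be
  used, not of the current state.\<close>

primrec ula_cond ::
  "(real ^ 'd \<Rightarrow> real ^ 'd) \<Rightarrow> (nat \<Rightarrow> real) \<Rightarrow> nat \<Rightarrow> (real ^ 'd \<Rightarrow> real) \<Rightarrow> nat \<Rightarrow> real ^ 'd \<Rightarrow> real" where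
  "ula_cond G \<gamma> 0 f j = f"
| "ula_cond G \<gamma> (Suc m) f j = ula_kernel G \<gamma> j (ula_cond G \<gamma> m f (Suc j))"

lemma heat_cmult: "heat t (\<lambda>x. c * F x) x = c * heat t F x"
  by (simp add: heat_def)

lemma heat_sum:
  fixes F :: "'i \<Rightarrow> real ^ 'd \<Rightarrow> real"
  assumes "\<And>i. i \<in> I \<Longrightarrow> F i \<in> borel_measurable borel" "\<And>i x. i \<in> I \<Longrightarrow> \<bar>F i x\<bar> \<le> C i"
  shows "heat t (\<lambda>x. \<Sum>i\<in>I. F i x) x = (\<Sum>i\<in>I. heat t (F i) x)"
  unfolding heat_def
  by (intro Bochner_Integration.integral_sum integrable_gauss_bounded[OF assms])

lemma heat_unit_interval:
  fixes F :: "real ^ 'd \<Rightarrow> real"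
  assumes F: "F \<in> borel_measurable borel" and bd: "\<And>x. 0 \<le> F x" "\<And>x. F x \<le> 1"
  shows "0 \<le> heat t F x" "heat t F x \<le> 1"
proof -
  show "0 \<le> heat t F x" unfolding heat_def using bd by (intro Bochner_Integration.integral_nonneg) auto
  have "\<bar>F x\<bar> \<le> 1" for x using bd[of x] by simp
  then have "\<bar>heat t F x\<bar> \<le> 1" by (rule abs_heat_le[OF F])
  then show "heat t F x \<le> 1" by simp
qed

context
  fixes G :: "real ^ 'd \<Rightarrow> real ^ 'd" and \<gamma> :: "nat \<Rightarrow> real" and f :: "real ^ 'd \<Rightarrow> real"
  assumes G [measurable]: "G \<in> borel_measurable borel"
    and f [measurable]: "f \<in> borel_measurable borel"
    and f01: "\<And>x. 0 \<le> f x" "\<And>x. f x \<le> 1"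
begin

lemma ula_kernel_measurable [measurable]:
  assumes [measurable]: "F \<in> borel_measurable borel"
  shows "ula_kernel G \<gamma> k F \<in> borel_measurable borel"
  unfolding ula_kernel_def[abs_def] by measurable

lemma ula_cond_measurable [measurable]: "ula_cond G \<gamma> m f j \<in> borel_measurable borel"
  by (induction m arbitrary: j) simp_all

lemma ula_cond_unit_interval: "0 \<le> ula_cond G \<gamma> m f j x" "ula_cond G \<gamma> m f j x \<le> 1"
proof -
  have "(\<forall>x. 0 \<le> ula_cond G \<gamma> m f j x \<and> ula_cond G \<gamma> m f j x \<le> 1)"
  proof (induction m arbitrary: j)
    case (Suc m)
    then show ?case
      by (auto simp: ula_kernel_def intro!: heat_unit_interval ula_cond_measurable)
  qed (simp add: f01)
  then show "0 \<le> ula_cond G \<gamma> m f j x" "ula_cond G \<gamma> m f j x \<le> 1" by auto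
qed

lemma ula_cond_abs_le: "\<bar>ula_cond G \<gamma> m f j x\<bar> \<le> 1"
  using ula_cond_unit_interval[of m j x] by simp

text \<open>Where no factor of the product vanishes, the constant is
  \<open>1 / sqrt (2 * \<Lambda>)\<close>, with \<Lambda> for the indices \<open>j\<close> to
  \<open>j + m\<close>. It solves the recursion in which the inverse square grows by
  \<open>2 * \<gamma> j\<close> and is then divided by the squared contraction factor
  \<open>1 - \<kappa> * \<gamma> j\<close>. Written with the product, the formula also covers a
  vanishing factor, where the constant is 0.\<close>

lemma ula_cond_hockey_bound:
  assumes \<kappa>: "0 < \<kappa>" and \<gamma>: "\<And>k. 1 \<le> k \<Longrightarrow> 0 < \<gamma> k" "\<And>k. 1 \<le> k \<Longrightarrow> \<kappa> * \<gamma> k \<le> 1"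
    and contr: "\<And>k x y. 1 \<le> k \<Longrightarrow> norm ((x - \<gamma> k *\<^sub>R G x) - (y - \<gamma> k *\<^sub>R G y))
      \<le> sqrt (1 - \<kappa> * \<gamma> k) * norm (x - y)"
    and j: "1 \<le> j"
  defines "P \<equiv> \<lambda>j i. \<Prod>l=j..i. 1 - \<kappa> * \<gamma> l"
  shows "hockey_bound (sqrt (\<kappa> * P j (j + m) / (2 * (1 - P j (j + m))))) (ula_cond G \<gamma> (Suc m) f j)"
  using j
proof (induction m arbitrary: j)
  case 0
  have "hockey_bound (1 / sqrt (2 * \<gamma> j)) (heat (2 * \<gamma> j) f)"
    using f01 \<gamma> 0 by (intro hockey_bound_heat_indicator) auto
  then have "hockey_bound (1 / sqrt (2 * \<gamma> j) * sqrt (1 - \<kappa> * \<gamma> j)) (\<lambda>x. heat (2 * \<gamma> j) f (x - \<gamma> j *\<^sub>R G x))"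
    using contr[OF 0] \<gamma> 0 by (intro hockey_bound_comp) (auto simp: less_imp_le)
  moreover have "1 / sqrt (2 * \<gamma> j) * sqrt (1 - \<kappa> * \<gamma> j) = sqrt (\<kappa> * P j (j + 0) / (2 * (1 - P j (j + 0))))"
    using \<kappa> \<gamma>(1)[OF 0] by (simp add: P_def real_sqrt_divide real_sqrt_mult)
  ultimately show ?case by (simp add: ula_kernel_def[abs_def])
next
  case (Suc m)
  let ?g = "ula_cond G \<gamma> (Suc m) f (Suc j)" and ?P' = "P (Suc j) (Suc j + m)"
  let ?c = "sqrt (\<kappa> * ?P' / (2 * (1 - ?P')))"
  have g: "0 < \<gamma> j" "\<kappa> * \<gamma> j \<le> 1" "0 < \<kappa> * \<gamma> j" using \<gamma> Suc.prems \<kappa> by auto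
  have P: "P j (j + Suc m) = (1 - \<kappa> * \<gamma> j) * ?P'"
    unfolding P_def using prod.atLeast_Suc_atMost[of j "j + Suc m" "\<lambda>l. 1 - \<kappa> * \<gamma> l"] by simp
  have P0: "0 \<le> ?P'" unfolding P_def using \<gamma> Suc.prems by (intro prod_nonneg) auto
  have P1: "?P' < 1"
  proof -
    have "?P' = (1 - \<kappa> * \<gamma> (Suc j)) * (\<Prod>l=Suc (Suc j)..Suc j + m. 1 - \<kappa> * \<gamma> l)"
      unfolding P_def using prod.atLeast_Suc_atMost[of "Suc j" "Suc j + m" "\<lambda>l. 1 - \<kappa> * \<gamma> l"] by simp
    also have "\<dots> \<le> (1 - \<kappa> * \<gamma> (Suc j)) * 1"
      using \<gamma> Suc.prems \<kappa>
      by (intro mult_left_mono prod_le_1) (auto simp: less_imp_le)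
    also have "\<dots> < 1" using \<gamma>(1)[of "Suc j"] \<kappa> by simp
    finally show ?thesis .
  qed
  have c0: "0 \<le> ?c" using P0 P1 \<kappa> by simp
  have "hockey_bound (?c / sqrt (1 + 2 * \<gamma> j * ?c\<^sup>2)) (heat (2 * \<gamma> j) ?g)"
  proof (rule hockey_bound_heat[where B=1, OF ula_cond_measurable ula_cond_abs_le _ c0])
    show "hockey_bound ?c ?g" by (rule Suc.IH) simp
  qed (use g in simp)
  moreover have "0 \<le> ?c / sqrt (1 + 2 * \<gamma> j * ?c\<^sup>2)"
    by (intro divide_nonneg_nonneg c0 real_sqrt_ge_zero) (use g in simp)
  ultimately have "hockey_bound (?c / sqrt (1 + 2 * \<gamma> j * ?c\<^sup>2) * sqrt (1 - \<kappa> * \<gamma> j))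
      (\<lambda>x. heat (2 * \<gamma> j) ?g (x - \<gamma> j *\<^sub>R G x))"
    by (rule hockey_bound_comp) (rule contr[OF Suc.prems])
  moreover have "?c / sqrt (1 + 2 * \<gamma> j * ?c\<^sup>2) * sqrt (1 - \<kappa> * \<gamma> j)
      = sqrt (\<kappa> * P j (j + Suc m) / (2 * (1 - P j (j + Suc m))))"
  proof -
    have "\<kappa> * p / (2 * (1 - p)) / (1 + 2 * \<gamma> j * (\<kappa> * p / (2 * (1 - p)))) * (1 - \<kappa> * \<gamma> j)
        = \<kappa> * ((1 - \<kappa> * \<gamma> j) * p) / (2 * (1 - (1 - \<kappa> * \<gamma> j) * p))" if p: "0 \<le> p" "p < 1" for p
    proof -
      have d: "0 < 1 - p" using p by simp
      have e: "1 + 2 * \<gamma> j * (\<kappa> * p / (2 * (1 - p))) = (1 - (1 - \<kappa> * \<gamma> j) * p) / (1 - p)"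
        using d by (simp add: field_simps)
      have "0 \<le> \<kappa> * \<gamma> j * p" using p g by simp
      then have E: "0 < 1 - (1 - \<kappa> * \<gamma> j) * p" using d by (simp add: algebra_simps)
      have aux: "\<kappa> * p / (2 * D) / (E / D) * r = \<kappa> * (r * p) / (2 * E)" if "D \<noteq> 0" "E \<noteq> 0" for D E r
        using that by (simp add: field_simps)
      show ?thesis unfolding e by (rule aux) (use d E in auto)
    qed
    from this[OF P0 P1] have "sqrt (\<kappa> * ?P' / (2 * (1 - ?P')) / (1 + 2 * \<gamma> j * (\<kappa> * ?P' / (2 * (1 - ?P')))) * (1 - \<kappa> * \<gamma> j))
        = sqrt (\<kappa> * P j (j + Suc m) / (2 * (1 - P j (j + Suc m))))"
      by (simp only: P)
    moreover have "?c\<^sup>2 = \<kappa> * ?P' / (2 * (1 - ?P'))"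
      using P0 P1 \<kappa> by simp
    ultimately show ?thesis by (simp only: real_sqrt_mult real_sqrt_divide)
  qed
  ultimately show ?case by (simp add: ula_kernel_def[abs_def])
qed

text \<open>The conditional expectation, given state \<open>x\<close> at time \<open>k\<close>, of
  the part of the weighted sum after time \<open>k\<close> and up to the horizon
  \<open>H\<close>.\<close>

definition future :: "(nat \<Rightarrow> real) \<Rightarrow> nat \<Rightarrow> nat \<Rightarrow> real ^ 'd \<Rightarrow> real" where
  "future \<omega> H k x = (\<Sum>i=k+1..H. \<omega> i * ula_cond G \<gamma> (i - k) f (k + 1) x)"

lemma future_measurable [measurable]: "future \<omega> H k \<in> borel_measurable borel"
  unfolding future_def[abs_def] by measurable

lemma future_abs_le:
  assumes "\<And>i. 0 \<le> \<omega> i"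
  shows "\<bar>future \<omega> H k x\<bar> \<le> (\<Sum>i=k+1..H. \<omega> i)"
proof -
  have "\<bar>future \<omega> H k x\<bar> \<le> (\<Sum>i=k+1..H. \<bar>\<omega> i * ula_cond G \<gamma> (i - k) f (k + 1) x\<bar>)"
    unfolding future_def by (rule sum_abs)
  also have "\<dots> \<le> (\<Sum>i=k+1..H. \<omega> i)"
  proof (intro sum_mono)
    fix i
    show "\<bar>\<omega> i * ula_cond G \<gamma> (i - k) f (k + 1) x\<bar> \<le> \<omega> i"
      using mult_left_mono[OF ula_cond_abs_le[of "i - k" "k + 1" x] assms[of i]] assms[of i]
      by (simp add: abs_mult)
  qed
  finally show ?thesis .
qed

text \<open>The same part of the sum, conditioned instead on the state \<open>y\<close> at time
  \<open>k + 1\<close>. Its variance over the next noise is the conditional variance of the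
  martingale increment from \<open>k\<close> to \<open>k + 1\<close>.\<close>

definition innov :: "(nat \<Rightarrow> real) \<Rightarrow> nat \<Rightarrow> nat \<Rightarrow> real ^ 'd \<Rightarrow> real" where
  "innov \<omega> H k y = \<omega> (k + 1) * f y + future \<omega> H (k + 1) y"

lemma innov_measurable [measurable]: "innov \<omega> H k \<in> borel_measurable borel"
  unfolding innov_def[abs_def] by measurable

lemma innov_abs_le:
  assumes "\<And>i. 0 \<le> \<omega> i"
  shows "\<bar>innov \<omega> H k y\<bar> \<le> \<omega> (k + 1) + (\<Sum>i=k+2..H. \<omega> i)"
proof -
  have "\<bar>\<omega> (k + 1) * f y\<bar> \<le> \<omega> (k + 1)"
    using mult_left_mono[OF f01(2)[of y] assms[of "k + 1"]] assms[of "k + 1"] f01(1)[of y]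
    by (simp add: abs_mult)
  moreover have "\<bar>future \<omega> H (k + 1) y\<bar> \<le> (\<Sum>i=k+2..H. \<omega> i)"
    using future_abs_le[of \<omega> H "k + 1" y] assms by simp
  ultimately show ?thesis unfolding innov_def by linarith
qed

text \<open>Tower property over one step of the chain.\<close>

lemma future_eq_kernel_innov:
  assumes \<omega>: "\<And>i. 0 \<le> \<omega> i" and k: "k < H"
  shows "future \<omega> H k x = ula_kernel G \<gamma> (k + 1) (innov \<omega> H k) x"
proof -
  let ?y = "x - \<gamma> (k + 1) *\<^sub>R G x" and ?t = "2 * \<gamma> (k + 1)"
  have inn: "innov \<omega> H k = (\<lambda>y. \<Sum>i=k+1..H. \<omega> i * ula_cond G \<gamma> (i - (k + 1)) f (k + 2) y)"
  proof
    fix y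
    have "(\<Sum>i=k+1..H. \<omega> i * ula_cond G \<gamma> (i - (k + 1)) f (k + 2) y)
        = \<omega> (k + 1) * f y + (\<Sum>i=Suc (k+1)..H. \<omega> i * ula_cond G \<gamma> (i - (k + 1)) f (k + 2) y)"
      using k by (subst sum.atLeast_Suc_atMost) auto
    then show "innov \<omega> H k y = (\<Sum>i=k+1..H. \<omega> i * ula_cond G \<gamma> (i - (k + 1)) f (k + 2) y)"
      by (simp add: innov_def future_def)
  qed
  have "ula_kernel G \<gamma> (k + 1) (innov \<omega> H k) x
      = (\<Sum>i=k+1..H. heat ?t (\<lambda>y. \<omega> i * ula_cond G \<gamma> (i - (k + 1)) f (k + 2) y) ?y)"
    unfolding ula_kernel_def inn
  proof (rule heat_sum)
    show "\<bar>\<omega> i * ula_cond G \<gamma> (i - (k + 1)) f (k + 2) y\<bar> \<le> \<omega> i" for i y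
      using mult_left_mono[OF ula_cond_abs_le[of "i - (k + 1)" "k + 2" y] \<omega>[of i]] \<omega>[of i]
      by (simp add: abs_mult)
  qed measurable
  also have "\<dots> = future \<omega> H k x"
    unfolding future_def
  proof (intro sum.cong refl)
    fix i assume i: "i \<in> {k+1..H}"
    then have "i - k = Suc (i - (k + 1))" by auto
    then show "heat ?t (\<lambda>y. \<omega> i * ula_cond G \<gamma> (i - (k + 1)) f (k + 2) y) ?y
        = \<omega> i * ula_cond G \<gamma> (i - k) f (k + 1) x"
      by (simp add: heat_cmult ula_kernel_def)
  qed
  finally show ?thesis ..
qed

end

section \<open>The chain as a function of finitely many innovations\<close>

lemma ula_chain_measurable_PiM:
  fixes G :: "real ^ 'd \<Rightarrow> real ^ 'd"
  assumes [measurable]: "G \<in> borel_measurable borel" and "i \<le> k"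
  shows "ula_chain G \<gamma> (\<lambda>i \<omega>. \<omega> i) x i \<in> borel_measurable (PiM {1..k} (\<lambda>_. borel))"
  using assms(2)
proof (induction i)
  case (Suc i)
  then have [measurable]: "ula_chain G \<gamma> (\<lambda>i \<omega>. \<omega> i) x i \<in> borel_measurable (PiM {1..k} (\<lambda>_. borel))"
    by simp
  have [measurable]: "(\<lambda>\<omega>. \<omega> (Suc i)) \<in> borel_measurable (PiM {1..k} (\<lambda>_. borel))"
    using Suc.prems by (intro measurable_component_singleton) auto
  have "(\<lambda>w. ula_chain G \<gamma> (\<lambda>i \<omega>. \<omega> i) x (Suc i) w) \<in> borel_measurable (PiM {1..k} (\<lambda>_. borel))"
    unfolding ula_chain.simps Suc_eq_plus1[symmetric] by measurable
  then show ?case by simp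
next
  case 0
  have "(\<lambda>w. ula_chain G \<gamma> (\<lambda>i \<omega>. \<omega> i) x 0 w) \<in> borel_measurable (PiM {1..k} (\<lambda>_. borel))"
    by simp
  then show ?case by simp
qed

lemma ula_chain_restrict:
  "i \<le> k \<Longrightarrow> ula_chain G \<gamma> (\<lambda>i \<omega>. \<omega> i) x i (\<lambda>j\<in>{1..k}. Z j w) = ula_chain G \<gamma> Z x i w"
  by (induction i) auto

context prob_space
begin

text \<open>Freezing lemma: by independence, the innovation \<open>Z (k + 1)\<close> may be
  integrated out while the past is held fixed. Integrals against \<open>gauss\<close> thereby take
  the place of conditional expectations given the past.\<close>

lemma expectation_fresh_gaussian:
  fixes Z :: "nat \<Rightarrow> 'a \<Rightarrow> real ^ 'd" and \<Phi> :: "(nat \<Rightarrow> real ^ 'd) \<Rightarrow> real ^ 'd \<Rightarrow> real"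
  assumes indep: "indep_vars (\<lambda>_. borel) Z {1..}"
    and Z: "distributed M lborel (Z (k + 1)) (\<lambda>z. ennreal (std_gaussian_density z))"
    and \<Phi> [measurable]: "case_prod \<Phi> \<in> borel_measurable (PiM {1..k} (\<lambda>_. borel) \<Otimes>\<^sub>M borel)"
    and bd: "\<And>u z. \<bar>\<Phi> u z\<bar> \<le> C"
  shows "expectation (\<lambda>w. \<Phi> (\<lambda>j\<in>{1..k}. Z j w) (Z (k + 1) w))
    = expectation (\<lambda>w. LINT z|gauss. \<Phi> (\<lambda>j\<in>{1..k}. Z j w) z)"
proof -
  let ?S = "PiM {1..k} (\<lambda>_. borel :: (real ^ 'd) measure)"
  let ?X = "\<lambda>w. \<lambda>j\<in>{1..k}. Z j w" and ?Y = "Z (k + 1)"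
  let ?T = "PiM {k + 1} (\<lambda>_. borel :: (real ^ 'd) measure)" and ?V = "\<lambda>w. \<lambda>j\<in>{k + 1}. Z j w"
  \<comment> \<open>Independence of blocks concerns tuples, so the single variable
    \<open>Z (k + 1)\<close> is treated as a tuple indexed by \<open>{k + 1}\<close>.\<close>
  have ind: "indep_var ?S ?X ?T ?V"
    by (rule indep_var_restrict[OF indep]) auto
  have [measurable]: "?X \<in> measurable M ?S" "?V \<in> measurable M ?T"
    using indep_var_rv1[OF ind] indep_var_rv2[OF ind] by auto
  have [measurable]: "?Y \<in> borel_measurable M"
    using Z by (simp add: distributed_def)
  have [measurable]: "(\<lambda>v. v (k + 1)) \<in> borel_measurable ?T"
    by (intro measurable_component_singleton) simp
  have dY: "distr M borel ?Y = gauss"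
  proof -
    have "distr M borel ?Y = distr M lborel ?Y" by (intro distr_cong) auto
    then show ?thesis using Z by (simp add: distributed_def gauss_def)
  qed
  interpret X: prob_space "distr M ?S ?X" by (rule prob_space_distr) measurable
  interpret V: prob_space "distr M ?T ?V" by (rule prob_space_distr) measurable
  interpret P: pair_prob_space "distr M ?S ?X" "distr M ?T ?V" ..
  have [measurable]: "(\<lambda>p. \<Phi> (fst p) (snd p (k + 1))) \<in> borel_measurable (?S \<Otimes>\<^sub>M ?T)"
    by measurable
  have "expectation (\<lambda>w. \<Phi> (?X w) (?Y w))
      = (LINT p|distr M (?S \<Otimes>\<^sub>M ?T) (\<lambda>w. (?X w, ?V w)). \<Phi> (fst p) (snd p (k + 1)))"
  proof (subst integral_distr)
    show "(\<lambda>w. (?X w, ?V w)) \<in> measurable M (?S \<Otimes>\<^sub>M ?T)"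
      by (rule measurable_Pair) fact+
    show "(\<lambda>p. \<Phi> (fst p) (snd p (k + 1))) \<in> borel_measurable (?S \<Otimes>\<^sub>M ?T)" by fact
  qed simp
  also have "distr M (?S \<Otimes>\<^sub>M ?T) (\<lambda>w. (?X w, ?V w)) = distr M ?S ?X \<Otimes>\<^sub>M distr M ?T ?V"
    using ind unfolding indep_var_distribution_eq by simp
  also have "(LINT p|(distr M ?S ?X \<Otimes>\<^sub>M distr M ?T ?V). \<Phi> (fst p) (snd p (k + 1)))
      = (LINT u|distr M ?S ?X. LINT v|distr M ?T ?V. \<Phi> u (v (k + 1)))"
  proof (subst P.integral_fst'[symmetric])
    show "integrable (distr M ?S ?X \<Otimes>\<^sub>M distr M ?T ?V) (\<lambda>p. \<Phi> (fst p) (snd p (k + 1)))"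
    proof (rule P.integrable_const_bound[where B=C])
      show "(\<lambda>p. \<Phi> (fst p) (snd p (k + 1))) \<in> borel_measurable (distr M ?S ?X \<Otimes>\<^sub>M distr M ?T ?V)"
        by measurable
    qed (use bd in simp)
  qed simp
  also have "\<dots> = (LINT u|distr M ?S ?X. LINT z|gauss. \<Phi> u z)"
  proof (intro Bochner_Integration.integral_cong refl)
    fix u assume "u \<in> space (distr M ?S ?X)"
    then have u: "u \<in> space ?S" by simp
    have [measurable]: "\<Phi> u \<in> borel_measurable borel"
      using measurable_Pair2[OF \<Phi> u] by simp
    have "(LINT v|distr M ?T ?V. \<Phi> u (v (k + 1))) = (LINT w|M. \<Phi> u (?Y w))"
    proof (subst integral_distr)
      show "?V \<in> measurable M ?T" by fact
      show "(\<lambda>v. \<Phi> u (v (k + 1))) \<in> borel_measurable ?T"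
        by (rule measurable_compose[of "\<lambda>v. v (k + 1)"]) fact+
    qed simp
    also have "\<dots> = (LINT z|distr M borel ?Y. \<Phi> u z)"
      by (rule integral_distr[symmetric]) fact+
    finally show "(LINT v|distr M ?T ?V. \<Phi> u (v (k + 1))) = (LINT z|gauss. \<Phi> u z)"
      by (simp only: dY)
  qed
  also have "\<dots> = expectation (\<lambda>w. LINT z|gauss. \<Phi> (?X w) z)"
  proof (rule integral_distr)
    show "(\<lambda>u. LINT z|gauss. \<Phi> u z) \<in> borel_measurable ?S"
      by (rule gauss.borel_measurable_lebesgue_integral) measurable
  qed fact
  finally show ?thesis .
qed

end

section \<open>Contraction of gradient steps\<close>

lemma has_real_derivative_along_line:
  fixes U :: "'a :: euclidean_space \<Rightarrow> real"
  assumes "\<And>y. GDERIV U y :> G y"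
  shows "((\<lambda>s. U (x + s *\<^sub>R v)) has_real_derivative G (x + s *\<^sub>R v) \<bullet> v) (at s)"
proof -
  have "(U has_derivative (\<lambda>h. h \<bullet> G (x + s *\<^sub>R v))) (at (x + s *\<^sub>R v))"
    using assms[of "x + s *\<^sub>R v"] by (simp add: gderiv_def)
  moreover have "((\<lambda>s. x + s *\<^sub>R v) has_derivative (\<lambda>h. h *\<^sub>R v)) (at s)"
    by (auto intro!: derivative_eq_intros)
  ultimately have "(U \<circ> (\<lambda>s. x + s *\<^sub>R v) has_derivative
      (\<lambda>h. h \<bullet> G (x + s *\<^sub>R v)) \<circ> (\<lambda>h. h *\<^sub>R v)) (at s)"
    by (intro diff_chain_at)
  then show ?thesis
    by (simp add: has_field_derivative_def o_def inner_commute mult.commute[of _ "v \<bullet> _"] 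
        mult_commute_abs)
qed

text \<open>Along the segment, \<open>U\<close> minus the affine part and the quadratic has
  nonpositive derivative, by Cauchy-Schwarz and the Lipschitz bound.\<close>

lemma descent_lemma:
  fixes U :: "'a :: euclidean_space \<Rightarrow> real"
  assumes U: "\<And>y. GDERIV U y :> G y"
    and lip: "\<And>y z. norm (G y - G z) \<le> L * norm (y - z)"
  shows "U (x + v) \<le> U x + G x \<bullet> v + L / 2 * (norm v)\<^sup>2"
proof -
  define f where "f s = U (x + s *\<^sub>R v) - s * (G x \<bullet> v) - L * (norm v)\<^sup>2 * (s\<^sup>2 / 2)" for s
  define f' where "f' s = G (x + s *\<^sub>R v) \<bullet> v - G x \<bullet> v - L * (norm v)\<^sup>2 * s" for s
  have D: "(f has_real_derivative f' s) (at s)" for s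
    unfolding f_def f'_def
    by (auto intro!: derivative_eq_intros has_real_derivative_along_line[OF U])
  have "f 1 \<le> f 0"
  proof (rule DERIV_nonpos_imp_nonincreasing[of 0 1 f])
    fix s :: real assume s: "0 \<le> s" "s \<le> 1"
    have "(G (x + s *\<^sub>R v) - G x) \<bullet> v \<le> norm (G (x + s *\<^sub>R v) - G x) * norm v"
      by (rule norm_cauchy_schwarz)
    also have "\<dots> \<le> L * norm (s *\<^sub>R v) * norm v"
      using lip[of "x + s *\<^sub>R v" x] by (intro mult_right_mono) auto
    also have "\<dots> = L * (norm v)\<^sup>2 * s" using s by (simp add: power2_eq_square)
    finally have "f' s \<le> 0" by (simp add: f'_def inner_diff_left)
    then show "\<exists>y. (f has_real_derivative y) (at s) \<and> y \<le> 0" using D by blast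
  qed simp
  then show ?thesis by (simp add: f_def)
qed

text \<open>Co-coercivity of the gradient of the convex function \<open>U - m/2 \<parallel>\<cdot>\<parallel>\<^sup>2\<close>, whose gradient is
  \<open>(L - m)\<close>-Lipschitz.\<close>

lemma cocoercive_half:
  fixes U :: "'a :: euclidean_space \<Rightarrow> real"
  assumes U: "\<And>y. GDERIV U y :> G y"
    and lip: "\<And>y z. norm (G y - G z) \<le> L * norm (y - z)"
    and conv: "\<And>y z. U z \<ge> U y + G y \<bullet> (z - y) + (m / 2) * (norm (y - z))\<^sup>2"
    and mL: "m < L"
  defines "D \<equiv> \<lambda>x y. G x - G y - m *\<^sub>R (x - y)"
  shows "(norm (D x y))\<^sup>2 / (2 * (L - m))
    \<le> U x - U y - G y \<bullet> (x - y) - m / 2 * (norm (x - y))\<^sup>2"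
proof -
  let ?d = "D x y" and ?k = "1 / (L - m)"
  \<comment> \<open>After subtracting from the convex function its tangent at \<open>y\<close>,
    \<open>x + ?v\<close> minimises the quadratic upper bound at \<open>x\<close>. The strong
    convexity bound at \<open>y\<close> limits the decrease reached there.\<close>
  let ?v = "- ?k *\<^sub>R ?d"
  have k: "?k > 0" using mL by simp
  have 1: "U (x + ?v) \<le> U x + G x \<bullet> ?v + L / 2 * (norm ?v)\<^sup>2"
    by (rule descent_lemma[OF U lip])
  have 2: "U y + G y \<bullet> (x + ?v - y) + m / 2 * (norm (y - (x + ?v)))\<^sup>2 \<le> U (x + ?v)"
    by (rule conv)
  have 3: "(norm (y - (x + ?v)))\<^sup>2 = (norm (x - y))\<^sup>2 + 2 * ((x - y) \<bullet> ?v) + (norm ?v)\<^sup>2"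
    unfolding power2_norm_eq_inner by (simp add: inner_diff_left inner_diff_right inner_add_left
        inner_add_right inner_commute algebra_simps)
  have "G x \<bullet> w - G y \<bullet> w - m * ((x - y) \<bullet> w) = ?d \<bullet> w" for w
    by (simp add: D_def inner_diff_left)
  note 4 = this[of ?v]
  have 5: "?d \<bullet> ?v = - ?k * (norm ?d)\<^sup>2" by (simp add: power2_norm_eq_inner)
  have 6: "(L - m) / 2 * (norm ?v)\<^sup>2 = ?k / 2 * (norm ?d)\<^sup>2"
    using mL by (simp add: power_mult_distrib power2_eq_square)
  have 7: "G y \<bullet> (x + ?v - y) = G y \<bullet> (x - y) + G y \<bullet> ?v"
    by (simp add: inner_diff_right inner_add_right)
  have "L / 2 * p = m / 2 * p + (L - m) / 2 * p" for p by (simp add: field_simps)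
  note 8 = this[of "(norm ?v)\<^sup>2"]
  have 9: "m / 2 * (norm (y - (x + ?v)))\<^sup>2
      = m / 2 * (norm (x - y))\<^sup>2 + m * ((x - y) \<bullet> ?v) + m / 2 * (norm ?v)\<^sup>2"
    unfolding 3 by (simp add: field_simps)
  have "U y + G y \<bullet> (x - y) + m / 2 * (norm (x - y))\<^sup>2
      \<le> U x + ?d \<bullet> ?v + (L - m) / 2 * (norm ?v)\<^sup>2"
    using 1 2 unfolding 7 8 9 4[symmetric] by linarith
  then have "?k / 2 * (norm ?d)\<^sup>2 \<le> U x - U y - G y \<bullet> (x - y) - m / 2 * (norm (x - y))\<^sup>2"
    unfolding 5 6 by linarith
  moreover have "?k / 2 * (norm ?d)\<^sup>2 = (norm ?d)\<^sup>2 / (2 * (L - m))" by simp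
  ultimately show ?thesis by (simp only:)
qed

text \<open>Adding the two co-coercivity estimates with \<open>x\<close> and \<open>y\<close>
  exchanged eliminates the values of \<open>U\<close>; the rest is expansion of the square.\<close>

lemma strongly_convex_gradient_inner_strict:
  fixes U :: "'a :: euclidean_space \<Rightarrow> real"
  assumes U: "\<And>y. GDERIV U y :> G y"
    and lip: "\<And>y z. norm (G y - G z) \<le> L * norm (y - z)"
    and conv: "\<And>y z. U z \<ge> U y + G y \<bullet> (z - y) + (m / 2) * (norm (y - z))\<^sup>2"
    and mL: "m < L"
  shows "m * L * (norm (x - y))\<^sup>2 + (norm (G x - G y))\<^sup>2 \<le> (m + L) * ((G x - G y) \<bullet> (x - y))"
proof -
  let ?d = "G x - G y - m *\<^sub>R (x - y)" and ?i = "(G x - G y) \<bullet> (x - y)"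
  have "G y - G x - m *\<^sub>R (y - x) = - ?d" by (simp add: algebra_simps)
  then have n: "norm (G y - G x - m *\<^sub>R (y - x)) = norm ?d" by (metis norm_minus_cancel)
  have i: "G y \<bullet> (x - y) + G x \<bullet> (y - x) = - ?i"
    by (simp add: inner_diff_left inner_diff_right)
  have "(norm ?d)\<^sup>2 / (2 * (L - m)) + (norm ?d)\<^sup>2 / (2 * (L - m)) \<le> ?i - m * (norm (x - y))\<^sup>2"
    using cocoercive_half[OF U lip conv mL, of x y] cocoercive_half[OF U lip conv mL, of y x] i
    unfolding n norm_minus_commute[of y x] by linarith
  moreover have "p / (2 * k) + p / (2 * k) = p / k" for p k :: real by (simp add: field_simps)
  note this[of "(norm ?d)\<^sup>2" "L - m"]
  ultimately have "(norm ?d)\<^sup>2 / (L - m) \<le> ?i - m * (norm (x - y))\<^sup>2" by (simp only:)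
  then have "(norm ?d)\<^sup>2 \<le> (L - m) * (?i - m * (norm (x - y))\<^sup>2)"
    using mL by (simp add: pos_divide_le_eq mult.commute)
  moreover have "(norm ?d)\<^sup>2 = (norm (G x - G y))\<^sup>2 - 2 * m * ?i + m\<^sup>2 * (norm (x - y))\<^sup>2"
  proof -
    have "(norm (a - m *\<^sub>R b))\<^sup>2 = (norm a)\<^sup>2 - 2 * m * (a \<bullet> b) + m\<^sup>2 * (norm b)\<^sup>2" for a b :: 'a
      unfolding power2_norm_eq_inner
      by (simp add: inner_diff_left inner_diff_right inner_commute power2_eq_square algebra_simps)
    then show ?thesis .
  qed
  ultimately show ?thesis by (simp add: power2_eq_square algebra_simps)
qed

text \<open>The strict case divides by \<open>L - m\<close>. Every \<open>K > L\<close> is also a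
  Lipschitz constant, so \<open>m = L\<close> is covered by letting \<open>K\<close> tend to
  \<open>L\<close>.\<close>

lemma strongly_convex_gradient_inner:
  fixes U :: "'a :: euclidean_space \<Rightarrow> real"
  assumes U: "\<And>y. GDERIV U y :> G y"
    and lip: "\<And>y z. norm (G y - G z) \<le> L * norm (y - z)"
    and conv: "\<And>y z. U z \<ge> U y + G y \<bullet> (z - y) + (m / 2) * (norm (y - z))\<^sup>2"
    and mL: "m \<le> L"
  shows "m * L * (norm (x - y))\<^sup>2 + (norm (G x - G y))\<^sup>2 \<le> (m + L) * ((G x - G y) \<bullet> (x - y))"
proof (rule tendsto_le[OF trivial_limit_at_right_real])
  let ?l = "\<lambda>K. m * K * (norm (x - y))\<^sup>2 + (norm (G x - G y))\<^sup>2"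
  let ?r = "\<lambda>K. (m + K) * ((G x - G y) \<bullet> (x - y))"
  show "(?l \<longlongrightarrow> ?l L) (at_right L)" "(?r \<longlongrightarrow> ?r L) (at_right L)"
    by (auto intro!: tendsto_intros)
  have "?l K \<le> ?r K" if "L < K" for K
  proof (rule strongly_convex_gradient_inner_strict[OF U _ conv])
    show "norm (G y - G z) \<le> K * norm (y - z)" for y z
      using lip[of y z] that mult_right_mono[of L K "norm (y - z)"] by simp
  qed (use that mL in auto)
  then show "\<forall>\<^sub>F K in at_right L. ?l K \<le> ?r K"
    by (simp add: eventually_at_filter)
qed

lemma strong_convexity_le_lipschitz:
  fixes U :: "real ^ 'd \<Rightarrow> real"
  assumes lip: "\<And>y z. norm (G y - G z) \<le> L * norm (y - z)"
    and conv: "\<And>y z. U z \<ge> U y + G y \<bullet> (z - y) + (m / 2) * (norm (y - z))\<^sup>2"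
  shows "m \<le> L"
proof -
  obtain e :: "real ^ 'd" where e: "norm e = 1"
    using vector_choose_size[of 1] by auto
  have "m * (norm e)\<^sup>2 \<le> (G e - G 0) \<bullet> e"
    using conv[of e 0] conv[of 0 e] by (simp add: inner_diff_left)
  also have "\<dots> \<le> norm (G e - G 0) * norm e" by (rule norm_cauchy_schwarz)
  also have "\<dots> \<le> L" using lip[of e 0] e by simp
  finally show ?thesis using e by simp
qed

lemma gradient_step_contraction:
  fixes U :: "real ^ 'd \<Rightarrow> real"
  assumes U: "\<And>y. GDERIV U y :> G y"
    and lip: "\<And>y z. norm (G y - G z) \<le> L * norm (y - z)"
    and conv: "\<And>y z. U z \<ge> U y + G y \<bullet> (z - y) + (m / 2) * (norm (y - z))\<^sup>2"
    and m: "0 < m" and g: "0 < g" "g \<le> 2 / (m + L)"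
  shows "(norm ((x - g *\<^sub>R G x) - (y - g *\<^sub>R G y)))\<^sup>2
    \<le> (1 - 2 * m * L / (m + L) * g) * (norm (x - y))\<^sup>2"
proof -
  have mL: "m \<le> L" by (rule strong_convexity_le_lipschitz[OF lip conv])
  let ?i = "(G x - G y) \<bullet> (x - y)" and ?D = "(norm (x - y))\<^sup>2" and ?N = "(norm (G x - G y))\<^sup>2"
  have s: "0 < m + L" using m mL by simp
  have "m * L * ?D + ?N \<le> (m + L) * ?i"
    by (rule strongly_convex_gradient_inner[OF U lip conv mL])
  then have i: "(m * L * ?D + ?N) / (m + L) \<le> ?i"
    using s by (simp add: pos_divide_le_eq mult.commute)
  have "(norm ((x - g *\<^sub>R G x) - (y - g *\<^sub>R G y)))\<^sup>2 = (norm ((x - y) - g *\<^sub>R (G x - G y)))\<^sup>2"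
    by (simp add: algebra_simps)
  also have "\<dots> = ?D - 2 * g * ?i + g\<^sup>2 * ?N"
  proof -
    have "(norm (b - g *\<^sub>R a))\<^sup>2 = (norm b)\<^sup>2 - 2 * g * (a \<bullet> b) + g\<^sup>2 * (norm a)\<^sup>2" for a b :: "real ^ 'd"
      unfolding power2_norm_eq_inner
      by (simp add: inner_diff_left inner_diff_right inner_commute power2_eq_square algebra_simps)
    then show ?thesis .
  qed
  also have "\<dots> \<le> ?D - 2 * g * ((m * L * ?D + ?N) / (m + L)) + g * (2 / (m + L)) * ?N"
  proof -
    have "2 * g * ((m * L * ?D + ?N) / (m + L)) \<le> 2 * g * ?i"
      using i g by (intro mult_left_mono) auto
    moreover have "g\<^sup>2 * ?N \<le> g * (2 / (m + L)) * ?N"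
      using g unfolding power2_eq_square by (intro mult_right_mono mult_left_mono) auto
    ultimately show ?thesis by (intro add_mono diff_mono order_refl)
  qed
  also have "\<dots> = (1 - 2 * m * L / (m + L) * g) * ?D"
    by (simp add: add_divide_distrib algebra_simps)
  finally show ?thesis .
qed

section \<open>Comparison of the weighted sums\<close>

text \<open>A minorant of the arcsine whose derivative stays below \<open>1 / sqrt (1 - u\<^sup>2)\<close> and for which
  \<open>arcsin_poly (sqrt q)\<close> is concave in \<open>q\<close> on all of \<open>[0, 1]\<close>; the arcsine itself is not concave there.\<close>

definition arcsin_poly :: "real \<Rightarrow> real" where
  "arcsin_poly u = u + u ^ 3 / 6 + u ^ 5 / 30"

text \<open>The right-hand side is the left-endpoint rectangle for the integral of
  \<open>1 / sqrt (q * (1 - q))\<close>, whose primitive is \<open>2 * arcsin (sqrt q)\<close>.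
  Concavity of the minorant puts its increment below the tangent at the left endpoint.\<close>

lemma arcsin_poly_step:
  assumes x: "0 < x" "x < 1" and y: "x \<le> y" "y \<le> 1"
  shows "2 * (arcsin_poly (sqrt y) - arcsin_poly (sqrt x)) \<le> (y - x) / sqrt (x * (1 - x))"
proof -
  define u v where "u = sqrt x" and "v = sqrt y"
  have u: "0 < u" "u < 1" "u\<^sup>2 = x" and v: "u \<le> v" "v \<le> 1" "v\<^sup>2 = y"
    using assms by (auto simp: u_def v_def)
  have "u * (u + 2 * v) \<le> 1 * (1 + 2 * 1)"
    using u v by (intro mult_mono add_mono) auto
  moreover have "u * (2 * v ^ 3 + 4 * (v\<^sup>2 * u) + 6 * (v * u\<^sup>2) + 3 * u ^ 3)
      \<le> 1 * (2 * 1 + 4 * (1 * 1) + 6 * (1 * 1) + 3 * 1)"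
    using u v by (intro mult_mono add_mono power_le_one) (auto intro!: power_le_one)
  \<comment> \<open>The concavity defect in factored form. The maximal values 3 and 15 of the two
    products give \<open>1 - 3/6 - 15/30 = 0\<close>, so \<open>1/30\<close> is the largest
    coefficient of \<open>u ^ 5\<close> that keeps the bracket nonnegative up to
    \<open>u = v = 1\<close>.\<close>
  ultimately have "0 \<le> (v - u)\<^sup>2 * (1 - u * (u + 2 * v) / 6
      - u * (2 * v ^ 3 + 4 * (v\<^sup>2 * u) + 6 * (v * u\<^sup>2) + 3 * u ^ 3) / 30)"
    by (intro mult_nonneg_nonneg) auto
  also have "\<dots> = (v\<^sup>2 - u\<^sup>2) * (1 + u\<^sup>2 / 2 + u ^ 4 / 6) - u * (2 * (arcsin_poly v - arcsin_poly u))"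
    unfolding arcsin_poly_def by (simp add: field_simps power2_eq_square power3_eq_cube power4_eq_xxxx
      numeral_eq_Suc)
  finally have 1: "u * (2 * (arcsin_poly v - arcsin_poly u)) \<le> (v\<^sup>2 - u\<^sup>2) * (1 + u\<^sup>2 / 2 + u ^ 4 / 6)"
    by simp
  \<comment> \<open>The polynomial is the derivative of \<open>arcsin_poly\<close> at
    \<open>u = sqrt x\<close>; the claim places it below \<open>1 / sqrt (1 - x)\<close>, the
    derivative of the arcsine.\<close>
  have "((1 + x / 2 + x\<^sup>2 / 6) * sqrt (1 - x))\<^sup>2 \<le> 1\<^sup>2"
  proof -
    have "((1 + x / 2 + x\<^sup>2 / 6) * sqrt (1 - x))\<^sup>2 = (1 + x / 2 + x\<^sup>2 / 6)\<^sup>2 * (1 - x)"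
      using x by (simp add: power_mult_distrib)
    also have "\<dots> = 1 - (5 / 12 * x\<^sup>2 + 5 / 12 * x ^ 3 + 5 / 36 * x ^ 4 + 1 / 36 * x ^ 5)"
      by (simp add: field_simps power2_eq_square numeral_eq_Suc)
    finally have "((1 + x / 2 + x\<^sup>2 / 6) * sqrt (1 - x))\<^sup>2
      = 1 - (5 / 12 * x\<^sup>2 + 5 / 12 * x ^ 3 + 5 / 36 * x ^ 4 + 1 / 36 * x ^ 5)" .
    moreover have "0 \<le> 5 / 12 * x\<^sup>2 + 5 / 12 * x ^ 3 + 5 / 36 * x ^ 4 + 1 / 36 * x ^ 5"
      using x by (intro add_nonneg_nonneg) auto
    ultimately show ?thesis unfolding one_power2 by linarith
  qed
  then have "(1 + x / 2 + x\<^sup>2 / 6) * sqrt (1 - x) \<le> 1"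
    by (rule power2_le_imp_le) simp
  then have 2: "1 + u\<^sup>2 / 2 + u ^ 4 / 6 \<le> 1 / sqrt (1 - x)"
  proof -
    assume "(1 + x / 2 + x\<^sup>2 / 6) * sqrt (1 - x) \<le> 1"
    moreover have "u ^ 4 = x\<^sup>2" using u(3) by (metis numeral_Bit0 power_add power2_eq_square)
    ultimately show ?thesis using x u(3) by (simp add: pos_le_divide_eq)
  qed
  have "u * (2 * (arcsin_poly v - arcsin_poly u)) \<le> (y - x) * (1 / sqrt (1 - x))"
    using 1 2 u v y by (intro order_trans[OF 1] mult_mono) auto
  then have "2 * (arcsin_poly v - arcsin_poly u) \<le> (y - x) / (u * sqrt (1 - x))"
    using u x by (simp add: field_simps)
  then show ?thesis
    using x by (simp add: u_def v_def real_sqrt_mult)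
qed

lemma arcsin_poly_sq_ge:
  assumes "0 \<le> q"
  shows "q + q\<^sup>2 / 3 + 17 / 180 * q ^ 3 \<le> (arcsin_poly (sqrt q))\<^sup>2"
proof -
  define u where "u = sqrt q"
  have q: "q = u\<^sup>2" using assms by (simp add: u_def)
  have "(arcsin_poly u)\<^sup>2 = q + q\<^sup>2 / 3 + 17 / 180 * q ^ 3 + (q ^ 4 / 90 + q ^ 5 / 900)"
    unfolding arcsin_poly_def q by (simp add: field_simps power2_eq_square numeral_eq_Suc)
  moreover have "0 \<le> q ^ 4 / 90 + q ^ 5 / 900" using assms by simp
  ultimately show ?thesis by (simp add: u_def)
qed

lemma arcsin_poly_sq_le:
  assumes "0 \<le> a" "a \<le> b"
  shows "(arcsin_poly (sqrt a))\<^sup>2 \<le> (1 + b / 6 + b\<^sup>2 / 30)\<^sup>2 * a"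
proof -
  define u where "u = sqrt a"
  have a: "a = u\<^sup>2" using assms by (simp add: u_def)
  have "(arcsin_poly u)\<^sup>2 = (1 + a / 6 + a\<^sup>2 / 30)\<^sup>2 * a"
    unfolding arcsin_poly_def a by (simp add: field_simps power2_eq_square numeral_eq_Suc)
  also have "\<dots> \<le> (1 + b / 6 + b\<^sup>2 / 30)\<^sup>2 * a"
    using assms by (intro mult_right_mono power_mono add_mono divide_right_mono) auto
  finally show ?thesis by (simp add: u_def)
qed

lemma arcsin_poly_nonneg: "0 \<le> u \<Longrightarrow> 0 \<le> arcsin_poly u"
  by (simp add: arcsin_poly_def)

section \<open>Explicit bounds in rescaled time\<close>

definition growth :: "real \<Rightarrow> real" where
  "growth r = (let q = 1 - exp (- r) in q + q\<^sup>2 / 3 + 17 / 180 * q ^ 3)"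

text \<open>The primitive of \<open>growth\<close> that vanishes at 0, from the expansion
  \<open>growth_eq\<close> in powers of \<open>exp (- r)\<close>. In the limit of small steps,
  \<open>4 * growth r\<close> is a lower bound for the squared rate sum over a remaining time
  \<open>r\<close>, and \<open>growth_int\<close> accumulates these bounds over all starting
  points.\<close>

definition growth_int :: "real \<Rightarrow> real" where
  "growth_int r = (257 / 180) * r - (39 / 20) * (1 - exp (- r)) + (37 / 60) * (1 - (exp (- r))\<^sup>2) / 2
     - (17 / 180) * (1 - exp (- r) ^ 3) / 3"

lemma growth_int_0 [simp]: "growth_int 0 = 0"
  by (simp add: growth_int_def)

lemma growth_eq: "growth r = 257 / 180 - 39 / 20 * exp (- r) + 37 / 60 * (exp (- r))\<^sup>2 - 17 / 180 * exp (- r) ^ 3"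
  unfolding growth_def Let_def by (simp add: field_simps power2_eq_square power3_eq_cube)

lemma DERIV_growth_int: "(growth_int has_real_derivative growth r) (at r)"
  unfolding growth_int_def growth_eq
  by (auto intro!: derivative_eq_intros simp: power2_eq_square power3_eq_cube)

lemma growth_mono: "0 \<le> r \<Longrightarrow> r \<le> s \<Longrightarrow> growth r \<le> growth s"
  unfolding growth_def Let_def by (intro add_mono divide_right_mono mult_left_mono power_mono) auto

text \<open>\<open>growth\<close> is increasing, so the right-endpoint rectangle dominates the
  integral.\<close>

lemma growth_int_step:
  assumes "0 \<le> r" "0 \<le> a"
  shows "growth_int (r + a) - growth_int r \<le> a * growth (r + a)"
proof (cases "a = 0")
  case False
  then obtain z where z: "r < z" "z < r + a" "growth_int (r + a) - growth_int r = (r + a - r) * growth z"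
    using MVT2[of r "r + a" growth_int growth] DERIV_growth_int assms by auto
  then show ?thesis using assms by (auto intro!: mult_left_mono growth_mono)
qed simp

lemma growth_int_ge:
  assumes "s \<le> t"  "0 \<le> s"
  shows "growth_int s + growth s * (t - s) \<le> growth_int t"
proof (cases "s = t")
  case False
  then obtain z where z: "s < z" "z < t" "growth_int t - growth_int s = (t - s) * growth z"
    using MVT2[of s t growth_int growth] DERIV_growth_int assms by auto
  have "(t - s) * growth s \<le> (t - s) * growth z"
    using z assms by (auto intro!: mult_left_mono growth_mono)
  then show ?thesis using z by (simp add: algebra_simps)
qed simp

lemma ln_10_bounds: "2.2985 \<le> ln (10::real)" "ln (10::real) \<le> 2.34"
proof -
  \<comment> \<open>\<open>2.2985 = 2 + 20 * 0.014925\<close>: the fractional part is handled by a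
    twentieth power and \<open>exp y \<ge> 1 + y\<close>.\<close>
  have "exp (2.2985::real) = (exp 1)\<^sup>2 / exp (- 0.014925) ^ 20"
    by (simp flip: exp_of_nat_mult exp_diff exp_double)
  also have "\<dots> \<le> 2.72\<^sup>2 / 0.985075 ^ 20"
    using e_less_272 exp_ge_add_one_self[of "- 0.014925"]
    by (intro frac_le power_mono) auto
  also have "\<dots> \<le> 10" by (simp add: power_divide field_simps)
  finally show "2.2985 \<le> ln (10::real)" by (subst ln_ge_iff) auto
  have "(10::real) \<le> (1 + 0.234 + 0.234\<^sup>2 / 2) ^ 10" by (simp add: power_divide field_simps)
  also have "\<dots> \<le> exp 0.234 ^ 10"
    using exp_lower_Taylor_quadratic[of "0.234"] by (intro power_mono) auto
  also have "\<dots> = exp 2.34" by (simp flip: exp_of_nat_mult)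
  finally show "ln (10::real) \<le> 2.34" by (metis exp_gt_zero ln_exp ln_le_cancel_iff zero_less_numeral)
qed

lemma exp_minus_ln_10 [simp]: "exp (- ln (10::real)) = 1 / 10"
  by (simp add: exp_minus inverse_eq_divide)

lemma growth_int_ln_10: "1.8 \<le> growth_int (ln 10)"
  using ln_10_bounds(1) unfolding growth_int_def exp_minus_ln_10 by (simp add: power2_eq_square power3_eq_cube)

text \<open>The second derivative of the difference is antitone, so the difference, which vanishes to
  second order at 0, is first nonnegative and convex and then concave.\<close>

lemma growth_int_ge_sq:
  assumes t: "0 \<le> t" "t \<le> ln 10"
  shows "0.3348 * t\<^sup>2 \<le> growth_int t"
proof (rule ccontr)
  \<comment> \<open>The coefficient is just large enough for \<open>numeric_dichotomy\<close>, which
    needs \<open>4 * 0.3348 / 1.705 \<ge> pi / 4\<close>.\<close>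
  define f where "f t = growth_int t - 0.3348 * t\<^sup>2" for t :: real
  define f' where "f' t = growth t - 0.6696 * t" for t :: real
  define f'' where "f'' t = 39 / 20 * exp (- t) - 37 / 30 * (exp (- t))\<^sup>2 + 17 / 60 * exp (- t) ^ 3 - 0.6696" for t :: real
  have D: "(f has_real_derivative f' t) (at t)" for t
    unfolding f_def f'_def by (auto intro!: derivative_eq_intros DERIV_growth_int)
  have D': "(f' has_real_derivative f'' t) (at t)" for t
    unfolding f'_def f''_def growth_eq
    by (auto intro!: derivative_eq_intros simp: power2_eq_square power3_eq_cube)
  have anti: "f'' y \<le> f'' x" if "0 \<le> x" "x \<le> y" for x y
  proof -
    define u v where "u = exp (- y)" and "v = exp (- x)"
    have uv: "0 \<le> u" "u \<le> v" "v \<le> 1" using that by (auto simp: u_def v_def)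
    have diff: "f'' x - f'' y = (v - u) * (39 / 20 - 37 / 30 * (u + v) + 17 / 60 * (u\<^sup>2 + u * v + v\<^sup>2))"
      unfolding f''_def u_def[symmetric] v_def[symmetric]
      by (simp add: field_simps power2_eq_square power3_eq_cube)
    have "0 \<le> 39 / 20 - 37 / 30 * (u + v) + 17 / 60 * (u\<^sup>2 + u * v + v\<^sup>2)"
    proof -
      \<comment> \<open>Replacing \<open>u\<^sup>2 + u * v + v\<^sup>2\<close> by
        \<open>3 / 4 * (u + v)\<^sup>2\<close> leaves a quadratic in \<open>u + v\<close>, a number
        in [0, 2], which is a nonnegative product plus \<open>1 / 3\<close>.\<close>
      have "0 \<le> (u - v)\<^sup>2" by simp
      then have "3 / 4 * (u + v)\<^sup>2 \<le> u\<^sup>2 + u * v + v\<^sup>2" by (simp add: power2_eq_square algebra_simps)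
      moreover have "0 \<le> (2 - (u + v)) * (17 / 80 * (2 - (u + v)) + 23 / 60)"
        using uv by (intro mult_nonneg_nonneg) auto
      moreover have "(2 - w) * (17 / 80 * (2 - w) + 23 / 60) + 1 / 3
          = 39 / 20 - 37 / 30 * w + 17 / 60 * (3 / 4 * w\<^sup>2)" for w :: real
        by (simp add: field_simps power2_eq_square)
      note this[of "u + v"]
      ultimately have "0 \<le> 39 / 20 - 37 / 30 * (u + v) + 17 / 60 * (3 / 4 * (u + v)\<^sup>2)"
        by linarith
      also have "\<dots> \<le> 39 / 20 - 37 / 30 * (u + v) + 17 / 60 * (u\<^sup>2 + u * v + v\<^sup>2)"
        by (intro add_left_mono mult_left_mono) (fact, simp)
      finally show ?thesis .
    qed
    then have "0 \<le> f'' x - f'' y" unfolding diff using uv by (intro mult_nonneg_nonneg) auto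
    then show ?thesis by simp
  qed
  have f0: "f 0 = 0" "f' 0 = 0" by (simp_all add: f_def f'_def growth_def)
  have fT: "0 \<le> f (ln 10)"
  proof -
    have "(ln 10)\<^sup>2 \<le> (2.34::real)\<^sup>2"
      using ln_10_bounds by (intro power_mono) auto
    have *: "0 \<le> 257 / 180 * T - 39 / 20 * (9 / 10) + 37 / 60 * (99 / 100) / 2 - 17 / 180 * (999 / 1000) / 3 - 0.3348 * T\<^sup>2"
      if "2.2985 \<le> T" "T \<le> 2.34" for T :: real
    proof -
      \<comment> \<open>Between the two bounds for \<open>ln 10\<close> the square lies below its
        chord, which makes the claim affine in \<open>T\<close>.\<close>
      have "0 \<le> (T - 2.2985) * (2.34 - T)" using that by simp
      also have "\<dots> = 4.6385 * T - 5.37849 - T\<^sup>2" by (simp add: power2_eq_square field_simps)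
      finally have "T\<^sup>2 \<le> 4.6385 * T - 5.37849" by simp
      then show ?thesis using that by simp
    qed
    show ?thesis
      using *[OF ln_10_bounds] unfolding f_def growth_int_def exp_minus_ln_10
      by (simp add: power2_eq_square power3_eq_cube)
  qed
  assume "\<not> 0.3348 * t\<^sup>2 \<le> growth_int t"
  then have neg: "f t < 0" by (simp add: f_def)
  with f0 have "t \<noteq> 0" by auto
  with t have t0: "0 < t" by simp
  from neg fT have "t \<noteq> ln 10" by auto
  with t have tT: "t < ln 10" by simp
  \<comment> \<open>A negative value between the endpoints forces \<open>f'\<close> to be negative
    at \<open>x1\<close> and positive at the later point \<open>x2\<close>. Since
    \<open>f' 0 = 0\<close>, \<open>f''\<close> is then negative at \<open>y1\<close> and positive
    at the later point \<open>y2\<close>, against its antitonicity.\<close>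
  obtain x1 where x1: "0 < x1" "x1 < t" "f t - f 0 = (t - 0) * f' x1"
    using MVT2[OF t0, of f f'] D by auto
  obtain x2 where x2: "t < x2" "x2 < ln 10" "f (ln 10) - f t = (ln 10 - t) * f' x2"
    using MVT2[OF tT, of f f'] D by auto
  have fx1: "f' x1 < 0" using x1 neg f0 t0 by (simp add: mult_less_0_iff)
  have "0 < (ln 10 - t) * f' x2" using x2 neg fT by linarith
  then have fx2: "0 < f' x2" using tT by (simp add: zero_less_mult_iff)
  obtain y1 where y1: "0 < y1" "y1 < x1" "f' x1 - f' 0 = (x1 - 0) * f'' y1"
    using MVT2[OF x1(1), of f' f''] D' by auto
  have x12: "x1 < x2" using x1 x2 by linarith
  obtain y2 where y2: "x1 < y2" "y2 < x2" "f' x2 - f' x1 = (x2 - x1) * f'' y2"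
    using MVT2[OF x12, of f' f''] D' by auto
  have "f'' y1 < 0" using y1 fx1 f0 by (simp add: mult_less_0_iff)
  moreover have "0 < (x2 - x1) * f'' y2" using y2 fx1 fx2 by linarith
  then have "0 < f'' y2" using x12 by (simp add: zero_less_mult_iff)
  moreover have "f'' y2 \<le> f'' y1" using y1 y2 by (intro anti) auto
  ultimately show False by linarith
qed

text \<open>A primitive of \<open>1 / (2 * sqrt (exp r - 1))\<close>.\<close>

definition theta :: "real \<Rightarrow> real" where
  "theta r = arctan (sqrt (exp r - 1))"

lemma theta_0 [simp]: "theta 0 = 0" by (simp add: theta_def)

text \<open>The derivative blows up at 0, so the mean value theorem is applied with continuity on
  the closed interval and derivatives in its interior only.\<close>

lemma theta_mvt:
  assumes "0 \<le> r" "r < s"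
  obtains z where "r < z" "z < s" "theta s - theta r = (s - r) * (1 / (2 * sqrt (exp z - 1)))"
proof -
  have der: "(theta has_real_derivative 1 / (2 * sqrt (exp z - 1))) (at z)" if "0 < z" for z
  proof -
    have e: "0 < exp z - 1" using that by simp
    have "(theta has_real_derivative (exp z * (inverse (sqrt (exp z - 1)) / 2)) * inverse (1 + (sqrt (exp z - 1))\<^sup>2)) (at z)"
      unfolding theta_def using e
      by (auto intro!: derivative_eq_intros simp: field_simps)
    also have "(exp z * (inverse (sqrt (exp z - 1)) / 2)) * inverse (1 + (sqrt (exp z - 1))\<^sup>2)
        = 1 / (2 * sqrt (exp z - 1))"
      using e by (simp add: field_simps)
    finally show ?thesis .
  qed
  have "continuous_on {r..s} theta"
    unfolding theta_def by (intro continuous_intros)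
  moreover have "(theta has_derivative (\<lambda>h. h * (1 / (2 * sqrt (exp z - 1))))) (at z)" if "r < z" "z < s" for z
    using that assms
    by (intro has_derivative_eq_rhs[OF der[unfolded has_field_derivative_def]]) (auto simp: mult.commute)
  ultimately obtain z where "z \<in> {r<..<s}" "theta s - theta r = (\<lambda>h. h * (1 / (2 * sqrt (exp z - 1)))) (s - r)"
    using mvt[of r s theta "\<lambda>z h. h * (1 / (2 * sqrt (exp z - 1)))"] assms by auto
  then show thesis by (intro that[of z]) auto
qed

text \<open>The integrand is decreasing, so the right-endpoint rectangle lies below the
  integral.\<close>

lemma theta_step:
  assumes "0 \<le> r" "0 < a"
  shows "a / sqrt (exp (r + a) - 1) \<le> 2 * (theta (r + a) - theta r)"
proof -
  obtain z where z: "r < z" "z < r + a" "theta (r + a) - theta r = (r + a - r) * (1 / (2 * sqrt (exp z - 1)))"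
    using theta_mvt[of r "r + a"] assms by auto
  have "a / sqrt (exp (r + a) - 1) \<le> a / sqrt (exp z - 1)"
    using z assms by (intro divide_left_mono) auto
  then show ?thesis using z by simp
qed

text \<open>At \<open>ln 10\<close> the argument of the arctangent is exactly 3;
  \<open>arctan 3 = pi / 2 - arctan (1/3)\<close>, and the mean value theorem gives
  \<open>arctan (1/3) \<ge> 0.3\<close>.\<close>

lemma theta_ln_10: "theta (ln 10) \<le> 1.271"
proof -
  obtain z where z: "0 < z" "z < 1/3" "arctan (1/3) - arctan 0 = (1/3 - 0) * inverse (1 + z\<^sup>2)"
    using MVT2[of 0 "1/3" arctan "\<lambda>z. inverse (1 + z\<^sup>2)"] DERIV_arctan by auto
  have "z\<^sup>2 \<le> (1/3)\<^sup>2" using z by (intro power_mono) auto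
  then have "inverse (1 + (1/3)\<^sup>2) \<le> inverse (1 + z\<^sup>2)"
    by (intro le_imp_inverse_le) (auto simp: add_pos_nonneg)
  then have "0.3 \<le> arctan (1/3)" using z by (simp add: power2_eq_square)
  moreover have "arctan 3 = pi / 2 - arctan (1/3)"
    using arctan_inverse[of "1/3"] by simp
  moreover have "sqrt 9 = (3::real)" by (rule real_sqrt_unique) auto
  ultimately show ?thesis using pi_approx by (simp add: theta_def)
qed

text \<open>\<open>1.6155\<close> bounds \<open>1.271\<^sup>2\<close>. Beyond \<open>ln 10\<close>
  the slope of \<open>theta\<close> is at most \<open>1 / 6\<close> and its values are at most
  \<open>1.571\<close>, so its square has slope at most \<open>3.142 / 6 < 0.53\<close>.\<close>

lemma theta_sq_le:
  assumes "ln 10 \<le> T"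
  shows "(theta T)\<^sup>2 \<le> 1.6155 + 0.53 * (T - ln 10)"
proof -
  have le: "0 \<le> theta t" "theta t \<le> 1.571" if "0 \<le> t" for t
    using arctan_ubound[of "sqrt (exp t - 1)"] pi_approx that by (auto simp: theta_def)
  have l10: "(0::real) < ln 10" by simp
  have "theta T - theta (ln 10) \<le> (T - ln 10) / 6 \<and> 0 \<le> theta T - theta (ln 10)"
  proof (cases "T = ln 10")
    case False
    then obtain z where z: "ln 10 < z" "z < T" "theta T - theta (ln 10) = (T - ln 10) * (1 / (2 * sqrt (exp z - 1)))"
      using theta_mvt[of "ln 10" T] assms by auto
    have "0 < z" using z l10 by linarith
    have "exp (ln 10) \<le> exp z" using z by (subst exp_le_cancel_iff) simp
    then have "9 \<le> exp z - 1" by simp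
    then have "sqrt 9 \<le> sqrt (exp z - 1)" by (rule real_sqrt_le_mono)
    then have s: "3 \<le> sqrt (exp z - 1)" by (simp add: real_sqrt_unique)
    then have "1 / (2 * sqrt (exp z - 1)) \<le> 1 / (2 * 3)" using \<open>0 < z\<close> by (intro divide_left_mono) auto
    then have "(T - ln 10) * (1 / (2 * sqrt (exp z - 1))) \<le> (T - ln 10) * (1 / (2 * 3))"
      using assms by (intro mult_left_mono) auto
    with z s assms \<open>0 < z\<close> show ?thesis by auto
  qed simp
  then have 1: "(theta T - theta (ln 10)) * (theta T + theta (ln 10)) \<le> (T - ln 10) / 6 * (1.571 + 1.571)"
    using le[of T] le[of "ln 10"] assms l10 by (intro mult_mono) auto
  have 2: "(theta (ln 10))\<^sup>2 \<le> 1.271\<^sup>2"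
    using theta_ln_10 le(1)[of "ln 10"] by (intro power_mono) auto
  have 3: "(theta T)\<^sup>2 = (theta (ln 10))\<^sup>2 + (theta T - theta (ln 10)) * (theta T + theta (ln 10))"
    by (simp add: power2_eq_square algebra_simps)
  have "C \<le> 1.6155 + 0.53 * x"
    if "A \<le> x / 6 * (1.571 + 1.571)" "B \<le> 1.271\<^sup>2" "C = B + A" "0 \<le> x" for A B C x :: real
    using that by (simp add: power2_eq_square)
  from this[OF 1 2 3] show ?thesis using assms by simp
qed

text \<open>Young's inequality for \<open>h \<le> y + g\<close>, solved for the square of
  \<open>y\<close>; \<open>\<tau>\<close> trades the loss in the main term against the size of the
  error term.\<close>

lemma dominated_square:
  fixes y :: real
  assumes "0 \<le> y" "0 \<le> g" "0 \<le> h" "h - g \<le> y" and \<tau>: "0 < \<tau>"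
  shows "h\<^sup>2 / (1 + \<tau>) - g\<^sup>2 / \<tau> \<le> y\<^sup>2"
proof -
  have "h\<^sup>2 \<le> (y + g)\<^sup>2" using assms by (intro power_mono) auto
  also have "\<dots> \<le> (1 + \<tau>) * (y\<^sup>2 + g\<^sup>2 / \<tau>)"
  proof -
    have "0 \<le> (\<tau> * y - g)\<^sup>2 / \<tau>" using \<tau> by simp
    also have "\<dots> = (1 + \<tau>) * (y\<^sup>2 + g\<^sup>2 / \<tau>) - (y + g)\<^sup>2"
      using \<tau> by (simp add: power2_eq_square field_simps)
    finally show ?thesis by simp
  qed
  finally have "h\<^sup>2 / (1 + \<tau>) \<le> y\<^sup>2 + g\<^sup>2 / \<tau>"
    using \<tau> by (simp add: pos_divide_le_eq mult.commute)
  then show ?thesis by simp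
qed

section \<open>Rescaled sums for a decreasing sequence of steps\<close>

definition survival :: "(nat \<Rightarrow> real) \<Rightarrow> nat \<Rightarrow> nat \<Rightarrow> real" where
  "survival a j i = (\<Prod>l=j..i. 1 - a l)"

text \<open>With \<open>a l = \<kappa> * \<gamma> l\<close> and \<open>j \<le> i\<close> this is
  \<open>1 / sqrt (\<kappa> * \<Lambda>)\<close>; a vanishing factor gives 0, in accordance with
  \<open>1 / \<infinity> = 0\<close>.\<close>

definition lip_rate :: "(nat \<Rightarrow> real) \<Rightarrow> nat \<Rightarrow> nat \<Rightarrow> real" where
  "lip_rate a j i = sqrt (survival a j i / (1 - survival a j i))"

definition lip_sum :: "(nat \<Rightarrow> real) \<Rightarrow> nat \<Rightarrow> nat \<Rightarrow> real" where
  "lip_sum a n j = (\<Sum>i=j..n. a (i + 1) * lip_rate a j i)"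

text \<open>Meant for \<open>a j = \<kappa> * \<gamma> (j + N)\<close> and
  \<open>\<alpha> = \<kappa> * \<gamma> 1\<close>. After a burn-in all \<open>a j\<close> may be
  smaller than \<open>\<alpha>\<close>, hence the separate parameter.\<close>

locale decreasing_steps =
  fixes a :: "nat \<Rightarrow> real" and n :: nat and \<alpha> :: real
  assumes pos: "\<And>j. 1 \<le> j \<Longrightarrow> 0 < a j" and dec: "\<And>j. 1 \<le> j \<Longrightarrow> a (Suc j) \<le> a j"
    and le: "\<And>j. 1 \<le> j \<Longrightarrow> a j \<le> \<alpha>" and \<alpha>: "\<alpha> \<le> 1" and n: "1 \<le> n"
begin

lemma le_one: "1 \<le> j \<Longrightarrow> a j \<le> 1"
  using le \<alpha> by (meson order_trans)

lemma survival_Suc: "j \<le> Suc i \<Longrightarrow> survival a j (Suc i) = survival a j i * (1 - a (Suc i))"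
  by (simp add: survival_def)

lemma survival_self [simp]: "survival a j j = 1 - a j"
  by (simp add: survival_def)

lemma survival_nonneg: "1 \<le> j \<Longrightarrow> 0 \<le> survival a j i"
  using le_one unfolding survival_def by (intro prod_nonneg) auto

lemma survival_le_exp:
  assumes "1 \<le> j"
  shows "survival a j i \<le> exp (- (\<Sum>l=j..i. a l))"
proof -
  have "survival a j i \<le> (\<Prod>l=j..i. exp (- a l))"
    unfolding survival_def using assms le_one exp_ge_add_one_self[of "- a _"] by (intro prod_mono) auto
  also have "\<dots> = exp (- (\<Sum>l=j..i. a l))"
    by (subst sum_negf[symmetric]) (simp only: exp_sum finite_atLeastAtMost)
  finally show ?thesis .
qed

lemma survival_less_one:
  assumes "1 \<le> j" "j \<le> i"
  shows "survival a j i < 1"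
proof -
  have "0 < (\<Sum>l=j..i. a l)" using assms pos by (intro sum_pos) auto
  then have "exp (- (\<Sum>l=j..i. a l)) < 1" by simp
  with survival_le_exp[OF assms(1), of i] show ?thesis by linarith
qed

lemma lip_sum_nonneg: "1 \<le> j \<Longrightarrow> 0 \<le> lip_sum a n j"
  unfolding lip_sum_def lip_rate_def using pos survival_nonneg survival_less_one
  by (intro sum_nonneg mult_nonneg_nonneg real_sqrt_ge_zero divide_nonneg_nonneg)
     (auto simp: less_imp_le)

text \<open>\<open>a (i + 1) * survival a j i\<close> is the increment of
  \<open>1 - survival\<close>, so each term is a rectangle as in
  \<open>arcsin_poly_step\<close>.\<close>

lemma lip_term_ge:
  assumes j: "1 \<le> j" "j \<le> i"
  shows "2 * (arcsin_poly (sqrt (1 - survival a j (i + 1))) - arcsin_poly (sqrt (1 - survival a j i)))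
    \<le> a (i + 1) * lip_rate a j i"
proof (cases "survival a j i = 0")
  case True
  then show ?thesis using j by (simp add: lip_rate_def survival_Suc)
next
  case False
  let ?P = "survival a j i" and ?P' = "survival a j (i + 1)"
  have P: "0 < ?P" "?P < 1" using False survival_nonneg[of j i] survival_less_one j by (auto simp: less_le)
  have P': "?P - ?P' = ?P * a (i + 1)" using j by (simp add: survival_Suc algebra_simps)
  have "0 \<le> ?P'" using survival_nonneg j by simp
  moreover have "0 \<le> ?P * a (i + 1)" using P pos[of "i + 1"] by simp
  ultimately have "2 * (arcsin_poly (sqrt (1 - ?P')) - arcsin_poly (sqrt (1 - ?P)))
      \<le> ((1 - ?P') - (1 - ?P)) / sqrt ((1 - ?P) * (1 - (1 - ?P)))"
    using P P' by (intro arcsin_poly_step) auto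
  also have "\<dots> = a (i + 1) * lip_rate a j i"
    using P P' by (simp add: lip_rate_def real_sqrt_mult real_sqrt_divide) (simp add: field_simps)
  finally show ?thesis .
qed

text \<open>Telescoping. The first survival value is \<open>1 - a j\<close> rather than 1, which
  costs the boundary term at \<open>a j\<close>.\<close>

lemma lip_partial_sum_ge:
  assumes j: "1 \<le> j"
  shows "j \<le> Suc k \<Longrightarrow> 2 * (arcsin_poly (sqrt (1 - survival a j (Suc k))) - arcsin_poly (sqrt (a j)))
    \<le> (\<Sum>i=j..k. a (i + 1) * lip_rate a j i)"
proof (induction k)
  case 0
  then show ?case using j by (cases "j = 1") (simp_all add: survival_def)
next
  case (Suc k)
  show ?case
  proof (cases "j = Suc (Suc k)")
    case True
    then show ?thesis by simp
  next
    case False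
    then have jk: "j \<le> Suc k" using Suc.prems by simp
    show ?thesis
      using Suc.IH[OF jk] lip_term_ge[OF j jk] jk by simp
  qed
qed

definition remaining :: "nat \<Rightarrow> real" where
  "remaining j = (\<Sum>l=j..Suc n. a l)"

lemma remaining_nonneg: "1 \<le> j \<Longrightarrow> 0 \<le> remaining j"
  unfolding remaining_def using pos by (intro sum_nonneg) (auto simp: less_imp_le)

text \<open>For \<open>\<alpha> > 0\<close>, the squared ratio of
  \<open>arcsin_poly (sqrt \<alpha>)\<close> to \<open>sqrt \<alpha>\<close>: the square of the
  boundary term is at most \<open>loss * \<alpha>\<close>.\<close>

abbreviation "loss \<equiv> (1 + \<alpha> / 6 + \<alpha>\<^sup>2 / 30)\<^sup>2"

lemma lip_sum_sq_ge:
  assumes j: "1 \<le> j" "j \<le> Suc n" and \<tau>: "0 < \<tau>"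
  shows "4 * (growth (remaining j) / (1 + \<tau>) - loss * \<alpha> / \<tau>) \<le> (lip_sum a n j)\<^sup>2"
proof -
  define q where "q = 1 - survival a j (Suc n)"
  define e where "e = 1 - exp (- remaining j)"
  have eq: "e \<le> q" using survival_le_exp[OF j(1), of "Suc n"] by (simp add: e_def q_def remaining_def)
  have e: "0 \<le> e" using remaining_nonneg j by (simp add: e_def)
  let ?h = "arcsin_poly (sqrt q)" and ?g = "arcsin_poly (sqrt (a j))"
  have aj: "0 \<le> a j" "a j \<le> \<alpha>" using pos le j by (auto simp: less_imp_le)
  have "growth (remaining j) \<le> q + q\<^sup>2 / 3 + 17 / 180 * q ^ 3"
    unfolding growth_def Let_def e_def[symmetric] using e eq
    by (intro add_mono divide_right_mono mult_left_mono power_mono) auto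
  also have "\<dots> \<le> ?h\<^sup>2" using e eq by (intro arcsin_poly_sq_ge) auto
  finally have 1: "growth (remaining j) \<le> ?h\<^sup>2" .
  have "?g\<^sup>2 \<le> loss * a j" by (rule arcsin_poly_sq_le[OF aj])
  also have "\<dots> \<le> loss * \<alpha>" using aj by (intro mult_left_mono) auto
  finally have 2: "?g\<^sup>2 \<le> loss * \<alpha>" .
  have "?h\<^sup>2 / (1 + \<tau>) - ?g\<^sup>2 / \<tau> \<le> (lip_sum a n j / 2)\<^sup>2"
    using lip_partial_sum_ge[OF j] lip_sum_nonneg[OF j(1)] aj e eq \<tau>
    by (intro dominated_square) (auto simp: lip_sum_def q_def intro!: arcsin_poly_nonneg)
  moreover have "growth (remaining j) / (1 + \<tau>) \<le> ?h\<^sup>2 / (1 + \<tau>)"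
    using 1 \<tau> by (intro divide_right_mono) auto
  moreover have "?g\<^sup>2 / \<tau> \<le> loss * \<alpha> / \<tau>"
    using 2 \<tau> by (intro divide_right_mono) auto
  ultimately have "growth (remaining j) / (1 + \<tau>) - loss * \<alpha> / \<tau> \<le> (lip_sum a n j / 2)\<^sup>2"
    by linarith
  moreover have "(lip_sum a n j / 2)\<^sup>2 = (lip_sum a n j)\<^sup>2 / 4" by (simp add: power_divide)
  moreover have "4 * p \<le> r" if "p \<le> q" "q = r / 4" for p q r :: real
    using that by simp
  ultimately show ?thesis by blast
qed

text \<open>A right-endpoint Riemann sum of \<open>growth\<close> in the remaining time. The
  induction runs backwards from the last step, where that time is shortest.\<close>

lemma growth_sum_ge:
  "k \<le> Suc n \<Longrightarrow> 1 \<le> k \<Longrightarrow> growth_int (remaining (Suc n - k + 1)) \<le> (\<Sum>j=Suc n - k + 1..Suc n. a j * growth (remaining j))"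
proof (induction k)
  case (Suc k)
  let ?j = "Suc n - Suc k + 1"
  have j: "?j = n - k + 1" "1 \<le> ?j" "?j \<le> Suc n" using Suc.prems by auto
  have rem: "remaining ?j = remaining (Suc ?j) + a ?j"
    unfolding remaining_def using j by (subst sum.atLeast_Suc_atMost) auto
  have step: "growth_int (remaining ?j) - growth_int (remaining (Suc ?j)) \<le> a ?j * growth (remaining ?j)"
    unfolding rem using j pos[of ?j] by (intro growth_int_step remaining_nonneg) auto
  have split: "(\<Sum>j=?j..Suc n. a j * growth (remaining j))
      = a ?j * growth (remaining ?j) + (\<Sum>j=Suc ?j..Suc n. a j * growth (remaining j))"
    using j by (subst sum.atLeast_Suc_atMost) auto
  show ?case
  proof (cases "k = 0")
    case True
    then have "remaining (Suc ?j) = 0" using j by (simp add: remaining_def)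
    then show ?thesis using step True j unfolding split by simp
  next
    case False
    then have "Suc ?j = Suc n - k + 1" using Suc.prems by auto
    then show ?thesis using Suc.IH Suc.prems False step unfolding split by simp
  qed
qed simp

lemma lip_energy_ge:
  assumes \<tau>: "0 < \<tau>"
  defines "T \<equiv> remaining 2"
  shows "4 * (growth_int T / (1 + \<tau>) - loss * \<alpha> * T / \<tau>)
    \<le> (\<Sum>j=1..n. a j * (lip_sum a n (j + 1))\<^sup>2)"
proof -
  let ?c = "loss * \<alpha> / \<tau>"
  have "growth_int T \<le> (\<Sum>j=2..Suc n. a j * growth (remaining j))"
    using growth_sum_ge[of n] n by (simp add: T_def numeral_2_eq_2)
  then have "4 * (growth_int T / (1 + \<tau>) - ?c * T)
      \<le> 4 * ((\<Sum>j=2..Suc n. a j * growth (remaining j)) / (1 + \<tau>) - ?c * T)"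
    using \<tau> by (intro mult_left_mono diff_right_mono divide_right_mono) auto
  also have "\<dots> = (\<Sum>j=2..Suc n. a j * (4 * (growth (remaining j) / (1 + \<tau>) - ?c)))"
  proof -
    have "4 * ((\<Sum>j\<in>S. a j * g j) / d - c * (\<Sum>j\<in>S. a j)) = (\<Sum>j\<in>S. a j * (4 * (g j / d - c)))"
      for S :: "nat set" and g c d
      by (simp add: sum_distrib_left sum_divide_distrib right_diff_distrib sum_subtractf mult_ac)
    then show ?thesis unfolding T_def remaining_def .
  qed
  also have "\<dots> \<le> (\<Sum>j=2..Suc n. a j * (lip_sum a n j)\<^sup>2)"
    using lip_sum_sq_ge[OF _ _ \<tau>] pos by (intro sum_mono mult_left_mono) (auto simp: less_imp_le)
  also have "\<dots> = (\<Sum>j=1..n. a (Suc j) * (lip_sum a n (Suc j))\<^sup>2)"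
    using sum.shift_bounds_cl_Suc_ivl[of "\<lambda>j. a j * (lip_sum a n j)\<^sup>2" 1 n] by (simp add: numeral_2_eq_2)
  \<comment> \<open>Monotonicity of the steps changes the pairing to the one in the claimed bound,
    where a step multiplies the rate sum that starts one index later.\<close>
  also have "\<dots> \<le> (\<Sum>j=1..n. a j * (lip_sum a n (j + 1))\<^sup>2)"
    using dec by (intro sum_mono) (auto intro!: mult_right_mono)
  finally show ?thesis by simp
qed

lemma lip_partial_sum_le:
  "(\<Sum>i=1..k. a (i + 1) * lip_rate a 1 i) \<le> 2 * theta (\<Sum>l=2..Suc k. a l)"
proof (induction k)
  case (Suc k)
  let ?r = "\<Sum>l=2..Suc k. a l" and ?x = "a (Suc (Suc k))"
  have r: "0 \<le> ?r" using pos by (intro sum_nonneg) (auto simp: less_imp_le)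
  have x: "0 < ?x" by (rule pos) simp
  \<comment> \<open>Monotonicity shifts the exponent by one index, so that it includes the current
    weight \<open>?x\<close> and the term becomes a right-endpoint rectangle for
    \<open>theta\<close>.\<close>
  have rx: "?r + ?x \<le> (\<Sum>l=1..Suc k. a l)"
  proof -
    have "?r + ?x = (\<Sum>l=Suc 1..Suc (Suc k). a l)" by (simp add: numeral_2_eq_2)
    also have "\<dots> = (\<Sum>l=1..Suc k. a (Suc l))" by (rule sum.shift_bounds_cl_Suc_ivl)
    also have "\<dots> \<le> (\<Sum>l=1..Suc k. a l)" using dec by (intro sum_mono) auto
    finally show ?thesis .
  qed
  let ?P = "survival a 1 (Suc k)"
  have P: "0 \<le> ?P" "?P < 1" using survival_nonneg survival_less_one by auto
  have "?P \<le> exp (- (\<Sum>l=1..Suc k. a l))" by (rule survival_le_exp) simp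
  also have "\<dots> \<le> exp (- (?r + ?x))" using rx by simp
  finally have Pe: "?P \<le> exp (- (?r + ?x))" .
  have e1: "0 < exp (?r + ?x) - 1" using r x by (simp add: add_nonneg_pos)
  have "?P * (exp (?r + ?x) - 1) \<le> 1 - ?P"
    using mult_right_mono[OF Pe, of "exp (?r + ?x)"] by (simp add: algebra_simps exp_minus_inverse flip: exp_add)
  then have "?P / (1 - ?P) \<le> 1 / (exp (?r + ?x) - 1)"
    using P e1 by (simp add: divide_le_eq field_simps)
  then have "lip_rate a 1 (Suc k) \<le> 1 / sqrt (exp (?r + ?x) - 1)"
    unfolding lip_rate_def by (metis real_sqrt_divide real_sqrt_le_mono real_sqrt_one)
  then have "?x * lip_rate a 1 (Suc k) \<le> ?x / sqrt (exp (?r + ?x) - 1)"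
    using mult_left_mono[of "lip_rate a 1 (Suc k)" "1 / sqrt (exp (?r + ?x) - 1)" ?x] x by simp
  also have "\<dots> \<le> 2 * (theta (?r + ?x) - theta ?r)"
    by (rule theta_step[OF r x])
  finally show ?case using Suc.IH by simp
qed simp

lemma lip_sum_one_le: "lip_sum a n 1 \<le> 2 * theta (remaining 2)"
  using lip_partial_sum_le[of n] by (simp add: lip_sum_def remaining_def)

text \<open>The parameters \<open>\<tau> = 0.705\<close> and \<open>\<tau> = 0.479\<close> of \<open>lip_energy_ge\<close> are chosen so that the loss
  term is just covered by \<open>2 \<alpha> T\<close> and by \<open>\<alpha> T\<close>, respectively.\<close>

theorem numeric_dichotomy:
  defines "T \<equiv> remaining 2" and "W \<equiv> (\<Sum>j=1..n. a j * (lip_sum a n (j + 1))\<^sup>2)"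
  shows "T\<^sup>2 / 4 \<le> 2 * \<alpha> * T + W / pi
    \<or> (lip_sum a n 1)\<^sup>2 / (4 * pi) \<le> \<alpha> * T + W / (3 * pi)"
proof -
  have T: "0 \<le> T" unfolding T_def by (rule remaining_nonneg) simp
  have W: "0 \<le> W" unfolding W_def using pos by (intro sum_nonneg) (auto simp: less_imp_le)
  have \<alpha>0: "0 \<le> \<alpha>" using pos[of 1] le[of 1] by simp
  have pi: "3.1415 \<le> pi" "pi \<le> 3.1416" using pi_approx by auto
  show ?thesis
  proof (cases "T \<le> ln 10")
    case True
    \<comment> \<open>After division by \<open>T\<^sup>2\<close> this says that the claimed bound,
      even without its last square, is at least 1/4.\<close>
    have "T\<^sup>2 / 4 \<le> 2 * \<alpha> * T + W / pi"
    proof (rule ccontr)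
      assume neg: "\<not> ?thesis"
      have "0 \<le> W / pi" using W by simp
      then have "8 * (\<alpha> * T) < T\<^sup>2" using neg by linarith
      then have "T * (8 * \<alpha>) < T * T" by (simp add: power2_eq_square mult_ac)
      then have "8 * \<alpha> < T" using T by (metis mult_less_cancel_left not_le)
      then have \<alpha>: "\<alpha> \<le> 0.2925" using True ln_10_bounds by simp
      then have "\<alpha>\<^sup>2 \<le> 0.2925\<^sup>2" using \<alpha>0 by (intro power_mono) auto
      then have "1 + \<alpha> / 6 + \<alpha>\<^sup>2 / 30 \<le> 1.0517" using \<alpha> by (simp add: power2_eq_square)
      then have "loss \<le> 1.0517\<^sup>2" using \<alpha>0 by (intro power_mono) auto
      also have "(1.0517::real)\<^sup>2 \<le> 1.107" by (simp add: power2_eq_square)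
      finally have c: "loss \<le> 1.107" .
      have "4 * (growth_int T / 1.705 - 1.107 * (\<alpha> * T) / 0.705) \<le> W"
      proof -
        have "loss * \<alpha> * T \<le> 1.107 * (\<alpha> * T)"
          unfolding mult.assoc using c \<alpha>0 T by (intro mult_right_mono) auto
        then have "4 * (growth_int T / 1.705 - 1.107 * (\<alpha> * T) / 0.705)
            \<le> 4 * (growth_int T / (1 + 0.705) - loss * \<alpha> * T / 0.705)"
          by (intro mult_left_mono diff_mono divide_right_mono) auto
        also have "\<dots> \<le> W" using lip_energy_ge[of "0.705"] unfolding T_def[symmetric] W_def[symmetric] by simp
        finally show ?thesis .
      qed
      moreover have "0.3348 * T\<^sup>2 \<le> growth_int T" by (rule growth_int_ge_sq[OF T True])
      \<comment> \<open>\<open>6.281\<close> lies between \<open>4 * 1.107 / 0.705\<close> and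
        \<open>2 * pi\<close>.\<close>
      moreover have "4 * 0.3348 / 1.705 * q - 6.281 * p \<le> w"
        if "4 * (j / 1.705 - 1.107 * p / 0.705) \<le> w" "0.3348 * q \<le> j" "0 \<le> p" for j p q w :: real
        using that by simp
      ultimately have "4 * 0.3348 / 1.705 * T\<^sup>2 - 6.281 * (\<alpha> * T) \<le> W"
        using mult_nonneg_nonneg[OF \<alpha>0 T] by blast
      moreover have "pi / 4 * T\<^sup>2 \<le> 4 * 0.3348 / 1.705 * T\<^sup>2"
        using pi by (intro mult_right_mono) auto
      moreover have "6.281 * (\<alpha> * T) \<le> 2 * pi * (\<alpha> * T)"
        using pi mult_nonneg_nonneg[OF \<alpha>0 T] by (intro mult_right_mono) auto
      ultimately have "pi / 4 * T\<^sup>2 \<le> 2 * pi * (\<alpha> * T) + W" by linarith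
      then have "T\<^sup>2 / 4 \<le> 2 * \<alpha> * T + W / pi"
        using pi by (simp add: field_simps)
      with neg show False by simp
    qed
    then show ?thesis ..
  next
    case False
    then have T10: "ln 10 \<le> T" by simp
    let ?b = "lip_sum a n 1"
    have b: "?b \<le> 2 * theta T" "0 \<le> ?b"
      using lip_sum_one_le lip_sum_nonneg[of 1] by (simp_all add: T_def)
    then have b2: "?b\<^sup>2 \<le> 4 * (theta T)\<^sup>2"
      using power_mono[of ?b "2 * theta T" 2] by (simp add: power_mult_distrib)
    \<comment> \<open>After division by \<open>T\<^sup>2\<close>: the excess of the burn-in part is
      covered by half of the first claimed term and a third of the claimed sum over the later
      increments.\<close>
    have "?b\<^sup>2 / (4 * pi) \<le> \<alpha> * T + W / (3 * pi)"
    proof (rule ccontr)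
      assume neg: "\<not> ?thesis"
      \<comment> \<open>The arctangent is below \<open>pi / 2\<close>, so the left-hand side of the
        claim is at most \<open>pi / 4\<close>, and its failure again limits the step size.\<close>
      have "?b \<le> pi" using b arctan_ubound[of "sqrt (exp T - 1)"] by (simp add: theta_def)
      then have "?b\<^sup>2 \<le> pi\<^sup>2" using b by (intro power_mono) auto
      then have "?b\<^sup>2 / (4 * pi) \<le> pi\<^sup>2 / (4 * pi)" by (intro divide_right_mono) auto
      also have "\<dots> = pi / 4" by (simp add: power2_eq_square)
      also have "\<dots> \<le> 0.7854" using pi by simp
      finally have "?b\<^sup>2 / (4 * pi) \<le> 0.7854" .
      moreover have "0 \<le> W / (3 * pi)" using W by simp
      ultimately have aT: "\<alpha> * T \<le> 0.7854" using neg by linarith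
      have "\<alpha> * 2.2985 \<le> \<alpha> * T" using T10 ln_10_bounds \<alpha>0 by (intro mult_left_mono) auto
      then have \<alpha>: "\<alpha> \<le> 0.3418" using aT by simp
      then have "\<alpha>\<^sup>2 \<le> 0.3418\<^sup>2" using \<alpha>0 by (intro power_mono) auto
      then have "1 + \<alpha> / 6 + \<alpha>\<^sup>2 / 30 \<le> 1.061" using \<alpha> by (simp add: power2_eq_square)
      then have "loss \<le> 1.061\<^sup>2" using \<alpha>0 by (intro power_mono) auto
      also have "(1.061::real)\<^sup>2 \<le> 1.126" by (simp add: power2_eq_square)
      finally have c: "loss \<le> 1.126" .
      have "4 * (growth_int T / 1.479 - 1.126 * (\<alpha> * T) / 0.479) \<le> W"
      proof -
        have "loss * \<alpha> * T \<le> 1.126 * (\<alpha> * T)"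
          unfolding mult.assoc using c \<alpha>0 T by (intro mult_right_mono) auto
        then have "4 * (growth_int T / 1.479 - 1.126 * (\<alpha> * T) / 0.479)
            \<le> 4 * (growth_int T / (1 + 0.479) - loss * \<alpha> * T / 0.479)"
          by (intro mult_left_mono diff_mono divide_right_mono) auto
        also have "\<dots> \<le> W" using lip_energy_ge[of "0.479"] unfolding T_def[symmetric] W_def[symmetric] by simp
        finally show ?thesis .
      qed
      \<comment> \<open>Tangent at \<open>ln 10\<close> of the convex function
        \<open>growth_int\<close>, with slope and value rounded down.\<close>
      moreover have "1.8 + 1.2 * (T - ln 10) \<le> growth_int T"
      proof -
        have "growth (ln 10) * (T - ln 10) \<ge> 1.2 * (T - ln 10)"
          using T10 by (intro mult_right_mono) (auto simp: growth_def power2_eq_square power3_eq_cube)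
        then show ?thesis using growth_int_ge[OF T10] growth_int_ln_10 ln_ge_zero[of 10] by linarith
      qed
      moreover have "4 * 1.8 / 1.479 + 4 * 1.2 / 1.479 * q - 9.4032 * p \<le> w"
        if "4 * (j / 1.479 - 1.126 * p / 0.479) \<le> w" "1.8 + 1.2 * q \<le> j" "0 \<le> p" for j p q w :: real
        using that by simp
      ultimately have "4 * 1.8 / 1.479 + 4 * 1.2 / 1.479 * (T - ln 10) - 9.4032 * (\<alpha> * T) \<le> W"
        using mult_nonneg_nonneg[OF \<alpha>0 T] by blast
      moreover have "9.4032 * (\<alpha> * T) \<le> 3 * pi * (\<alpha> * T)"
        using pi mult_nonneg_nonneg[OF \<alpha>0 T] by (intro mult_right_mono) auto
      moreover have "?b\<^sup>2 / 4 * 3 \<le> 3 * (1.6155 + 0.53 * (T - ln 10))"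
      proof -
        have "p / 4 * 3 \<le> 3 * r" if "p \<le> 4 * q" "q \<le> r" for p q r :: real
          using that by simp
        from this[OF b2 theta_sq_le[OF T10]] show ?thesis .
      qed
      \<comment> \<open>Two affine functions of \<open>T - ln 10\<close>: the values at 0 are 4.8465
        and about 4.868, the slopes 1.59 and about 3.245.\<close>
      moreover have "3 * (1.6155 + 0.53 * (T - ln 10)) \<le> 4 * 1.8 / 1.479 + 4 * 1.2 / 1.479 * (T - ln 10)"
        using T10 by (simp add: field_simps)
      ultimately have "?b\<^sup>2 / 4 * 3 \<le> 3 * pi * (\<alpha> * T) + W" by linarith
      then have "?b\<^sup>2 / (4 * pi) \<le> \<alpha> * T + W / (3 * pi)"
        using pi by (simp add: field_simps)
      with neg show False by simp
    qed
    then show ?thesis ..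
  qed
qed

end

section \<open>Variance of the weighted average\<close>

lemma ula_chain_measurable:
  fixes G :: "real ^ 'd \<Rightarrow> real ^ 'd"
  assumes [measurable]: "G \<in> borel_measurable borel"
    and Z: "\<And>i. 1 \<le> i \<Longrightarrow> Z i \<in> borel_measurable M"
  shows "(\<lambda>w. ula_chain G \<gamma> Z x k w) \<in> borel_measurable M"
proof (induction k)
  case (Suc k)
  note [measurable] = Suc
  have [measurable]: "Z (Suc k) \<in> borel_measurable M" by (rule Z) simp
  show ?case unfolding ula_chain.simps Suc_eq_plus1[symmetric] by measurable
qed simp

text \<open>The weights 4 and 4/3 in \<open>(p + q)\<^sup>2 \<le> 4 p\<^sup>2 + 4/3 q\<^sup>2\<close> leave room for the excess of the burn-in
  part: a function with values in \<open>[0, 1]\<close> has variance at most 1/4.\<close>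

lemma heat_var_add_le:
  fixes f g :: "real ^ 'd \<Rightarrow> real"
  assumes f [measurable]: "f \<in> borel_measurable borel" and f01: "\<And>x. 0 \<le> f x" "\<And>x. f x \<le> 1"
    and g [measurable]: "g \<in> borel_measurable borel" and bd: "\<And>x. \<bar>g x\<bar> \<le> C"
    and c: "0 \<le> c" and t: "0 < t" and K: "0 \<le> K"
    and lip: "\<And>x y. \<bar>g x - g y\<bar> \<le> K * norm (x - y)"
  shows "heat_var t (\<lambda>y. c * f y + g y) x \<le> c\<^sup>2 + 4 / 3 * (t * K\<^sup>2)"
proof -
  let ?F = "\<lambda>y. c * f y + g y" and ?a = "heat t g x"
  have bf: "\<bar>c * f y\<bar> \<le> c" for y
    using mult_left_mono[OF f01(2)[of y] c] f01(1)[of y] c by (simp add: abs_mult)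
  have bF: "\<bar>?F y\<bar> \<le> c + C" for y
    using bf[of y] bd[of y] by linarith
  have ba: "\<bar>?a\<bar> \<le> C" by (rule abs_heat_le[OF g bd])
  have "\<bar>(g y - ?a)\<^sup>2\<bar> \<le> (2 * C)\<^sup>2" for y
    using bd[of y] ba by (intro abs_square_le) linarith
  then have Ig: "integrable gauss (\<lambda>z. (g (x + sqrt t *\<^sub>R z) - ?a)\<^sup>2)"
    by (intro integrable_gauss_bounded[where F="\<lambda>y. (g y - ?a)\<^sup>2"]) auto
  \<comment> \<open>Centring at \<open>c / 2\<close> plus the mean of \<open>g\<close> instead of
    the mean of the sum: \<open>c * f\<close> deviates from \<open>c / 2\<close> by at most
    \<open>c / 2\<close>, so weight 4 yields \<open>c\<^sup>2\<close>, while \<open>g\<close>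
    contributes its own variance.\<close>
  have "heat_var t ?F x \<le> (LINT z|gauss. (?F (x + sqrt t *\<^sub>R z) - (c / 2 + ?a))\<^sup>2)"
    by (rule heat_var_le[OF _ bF]) measurable
  also have "\<dots> \<le> (LINT z|gauss. c\<^sup>2 + 4 / 3 * (g (x + sqrt t *\<^sub>R z) - ?a)\<^sup>2)"
  proof (rule integral_mono)
    have C: "0 \<le> C" using bd[of 0] by linarith
    have "\<bar>(?F y - (c / 2 + ?a))\<^sup>2\<bar> \<le> (2 * c + 2 * C)\<^sup>2" for y
      using bF[of y] ba c C by (intro abs_square_le) (auto simp: abs_le_iff)
    then show "integrable gauss (\<lambda>z. (?F (x + sqrt t *\<^sub>R z) - (c / 2 + ?a))\<^sup>2)"
      by (intro integrable_gauss_bounded[where F="\<lambda>y. (?F y - (c / 2 + ?a))\<^sup>2"]) auto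
    show "integrable gauss (\<lambda>z. c\<^sup>2 + 4 / 3 * (g (x + sqrt t *\<^sub>R z) - ?a)\<^sup>2)" using Ig by simp
    fix z
    let ?y = "x + sqrt t *\<^sub>R z"
    have young: "(p + q)\<^sup>2 \<le> 4 * p\<^sup>2 + 4 / 3 * q\<^sup>2" for p q :: real
    proof -
      have "0 \<le> (3 * p - q)\<^sup>2" by simp
      then show ?thesis by (simp add: power2_eq_square algebra_simps)
    qed
    have "\<bar>p - c / 2\<bar> \<le> c / 2" if "0 \<le> p" "p \<le> c" for p
      using that by (simp add: abs_if)
    then have "\<bar>c * f ?y - c / 2\<bar> \<le> c / 2"
      using mult_left_mono[OF f01(2)[of ?y] c] mult_nonneg_nonneg[OF c f01(1)[of ?y]] by simp
    then have "(c * f ?y - c / 2)\<^sup>2 \<le> (c / 2)\<^sup>2"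
      using c by (subst power2_le_iff_abs_le) auto
    then have "4 * (c * f ?y - c / 2)\<^sup>2 \<le> c\<^sup>2" by (simp add: power_divide)
    then show "(?F ?y - (c / 2 + ?a))\<^sup>2 \<le> c\<^sup>2 + 4 / 3 * (g ?y - ?a)\<^sup>2"
      using young[of "c * f ?y - c / 2" "g ?y - ?a"] by (simp add: algebra_simps)
  qed
  also have "\<dots> = c\<^sup>2 + 4 / 3 * (LINT z|gauss. (g (x + sqrt t *\<^sub>R z) - ?a)\<^sup>2)"
    using Ig by (simp add: gauss.prob_space[simplified])
  also have "(LINT z|gauss. (g (x + sqrt t *\<^sub>R z) - ?a)\<^sup>2) = heat_var t g x"
    by (simp add: heat_var_eq[OF g bd, of t x ?a])
  also have "\<dots> \<le> t * K\<^sup>2" by (rule gaussian_poincare[OF g bd lip K t])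
  finally show ?thesis by simp
qed

context prob_space
begin

text \<open>\<open>A k\<close> is the conditional expectation of the weighted sum given the first
  \<open>k\<close> innovations, and \<open>v j\<close> bounds the conditional variance of its
  increment from \<open>j\<close> to \<open>j + 1\<close>. Orthogonality of the increments takes the
  form of \<open>heat_var_eq\<close> after freezing the past.\<close>

lemma ula_second_moment:
  fixes Z :: "nat \<Rightarrow> 'a \<Rightarrow> real ^ 'd" and f :: "real ^ 'd \<Rightarrow> real"
    and \<gamma> :: "nat \<Rightarrow> real" and x :: "real ^ 'd"
  assumes indep: "indep_vars (\<lambda>_. borel) Z {1..}"
    and Z: "\<And>k. k \<ge> 1 \<Longrightarrow> distributed M lborel (Z k) (\<lambda>z. ennreal (std_gaussian_density z))"
    and G [measurable]: "G \<in> borel_measurable borel"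
    and f [measurable]: "f \<in> borel_measurable borel"
    and f01: "\<And>x. 0 \<le> f x" "\<And>x. f x \<le> 1"
    and \<omega>: "\<And>i. 0 \<le> \<omega> i"
    and v: "\<And>j y. j < H \<Longrightarrow> heat_var (2 * \<gamma> (j + 1)) (innov G \<gamma> f \<omega> H j) y \<le> v j"
    and k: "k \<le> H"
  defines "X \<equiv> ula_chain G \<gamma> Z x"
  defines "A \<equiv> \<lambda>k w. (\<Sum>i=1..k. \<omega> i * f (X i w)) + future G \<gamma> f \<omega> H k (X k w)"
  shows "expectation (\<lambda>w. (A k w - future G \<gamma> f \<omega> H 0 x)\<^sup>2) \<le> (\<Sum>j<k. v j)"
  using k
proof (induction k)
  case 0
  then show ?case by (simp add: A_def X_def)
next
  case (Suc k)
  let ?fut = "future G \<gamma> f \<omega> H"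
  define c where "c = ?fut 0 x"
  note m_future [measurable] = future_measurable[OF G f f01]
  note m_innov [measurable] = innov_measurable[OF G f f01]
  have k: "k < H" using Suc.prems by simp
  have Zm: "Z i \<in> borel_measurable M" if "1 \<le> i" for i
    using Z[OF that] by (simp add: distributed_def)
  have [measurable]: "X i \<in> borel_measurable M" for i
    unfolding X_def by (rule ula_chain_measurable[OF G Zm])
  let ?t = "2 * \<gamma> (k + 1)" and ?h = "innov G \<gamma> f \<omega> H k"
  let ?P = "PiM {1..k} (\<lambda>_. borel :: (real ^ 'd) measure)"
  \<comment> \<open>\<open>Y\<close> is the chain driven by coordinate functions, so that
    \<open>X i\<close> becomes \<open>Y i\<close> evaluated at the tuple \<open>R\<close> of past
    innovations, as the freezing lemma demands.\<close>
  define Y where "Y i u = ula_chain G \<gamma> (\<lambda>i \<omega>. \<omega> i) x i u" for i and u :: "nat \<Rightarrow> real ^ 'd"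
  define B where "B u = (\<Sum>i=1..k. \<omega> i * f (Y i u)) - c" for u
  define T where "T y = y - \<gamma> (k + 1) *\<^sub>R G y" for y
  define \<Phi> where "\<Phi> u z = (B u + ?h (T (Y k u) + sqrt ?t *\<^sub>R z))\<^sup>2" for u z
  define R where "R w = (\<lambda>j\<in>{1..k}. Z j w)" for w
  have YX: "Y i (R w) = X i w" if "i \<le> k" for i w
    unfolding Y_def X_def R_def by (rule ula_chain_restrict[OF that])
  have Ym: "Y i \<in> borel_measurable ?P" if "i \<le> k" for i
    unfolding Y_def[abs_def] by (rule ula_chain_measurable_PiM[OF G that])
  have [measurable]: "B \<in> borel_measurable ?P"
    unfolding B_def using Ym by (intro borel_measurable_diff borel_measurable_sum borel_measurable_times
      measurable_compose[OF _ f]) auto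
  have [measurable]: "Y k \<in> borel_measurable ?P" by (rule Ym) simp
  have [measurable]: "T \<in> borel_measurable borel" unfolding T_def by measurable
  define Ch where "Ch = \<omega> (k + 1) + (\<Sum>i=k+2..H. \<omega> i)"
  have bh: "\<bar>?h y\<bar> \<le> Ch" for y
    unfolding Ch_def by (rule innov_abs_le[OF G f f01 \<omega>])
  have bf: "\<bar>?fut k y\<bar> \<le> (\<Sum>i=k+1..H. \<omega> i)" for y
    by (rule future_abs_le[OF G f f01 \<omega>])
  define CB where "CB = (\<Sum>i=1..k. \<omega> i) + \<bar>c\<bar>"
  have bS: "\<bar>\<Sum>i=1..k. \<omega> i * f (y i)\<bar> \<le> (\<Sum>i=1..k. \<omega> i)" for y :: "nat \<Rightarrow> real ^ 'd"
  proof -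
    have "\<bar>\<Sum>i=1..k. \<omega> i * f (y i)\<bar> = (\<Sum>i=1..k. \<omega> i * f (y i))"
      using \<omega> f01 by (intro abs_of_nonneg sum_nonneg mult_nonneg_nonneg) auto
    also have "\<dots> \<le> (\<Sum>i=1..k. \<omega> i * 1)"
      using \<omega> f01 by (intro sum_mono mult_left_mono) auto
    finally show ?thesis by simp
  qed
  have bB: "\<bar>B u\<bar> \<le> CB" for u
    using bS[of "\<lambda>i. Y i u"] unfolding B_def CB_def by linarith
  have bP: "\<bar>\<Phi> u z\<bar> \<le> (CB + Ch)\<^sup>2" for u z
    unfolding \<Phi>_def using bB[of u] bh[of "T (Y k u) + sqrt ?t *\<^sub>R z"] by (intro abs_square_le) linarith
  have \<Phi>m: "case_prod \<Phi> \<in> borel_measurable (?P \<Otimes>\<^sub>M borel)"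
    unfolding \<Phi>_def[abs_def] by measurable
  \<comment> \<open>For a frozen past \<open>u\<close>, the second moment splits into the
    conditional variance and the square of the conditional mean, which is \<open>future\<close> by
    the tower property.\<close>
  have inner: "(LINT z|gauss. \<Phi> u z) = heat_var ?t ?h (T (Y k u)) + (B u + ?fut k (Y k u))\<^sup>2" for u
  proof -
    have "?fut k (Y k u) = heat ?t ?h (T (Y k u))"
      unfolding future_eq_kernel_innov[OF G f f01 \<omega> k] by (simp add: ula_kernel_def T_def)
    then show ?thesis
      using heat_var_eq[OF m_innov bh, of ?t "T (Y k u)" "- B u"] by (simp add: \<Phi>_def add.commute)
  qed
  have AB: "A k w - c = B (R w) + ?fut k (Y k (R w))" for w
    by (simp add: A_def B_def YX)
  have bA: "\<bar>A k w - c\<bar> \<le> CB + (\<Sum>i=k+1..H. \<omega> i)" for w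
    unfolding AB using bB[of "R w"] bf[of "Y k (R w)"] by linarith
  have [measurable]: "A k \<in> borel_measurable M" unfolding A_def by measurable
  have IA: "integrable M (\<lambda>w. (A k w - c)\<^sup>2)"
    using bA by (intro integrable_const_bound[where B="(CB + (\<Sum>i=k+1..H. \<omega> i))\<^sup>2"])
      (auto intro!: AE_I2 abs_square_le[simplified])
  have "A (Suc k) w - c = B (R w) + ?h (T (Y k (R w)) + sqrt ?t *\<^sub>R Z (k + 1) w)" for w
  proof -
    have "X (Suc k) w = T (X k w) + sqrt ?t *\<^sub>R Z (k + 1) w"
      by (simp add: X_def T_def)
    then show ?thesis
      by (simp add: A_def B_def YX innov_def[OF G f f01])
  qed
  then have "expectation (\<lambda>w. (A (Suc k) w - c)\<^sup>2) = expectation (\<lambda>w. \<Phi> (R w) (Z (k + 1) w))"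
    by (simp add: \<Phi>_def)
  also have "\<dots> = expectation (\<lambda>w. LINT z|gauss. \<Phi> (R w) z)"
    unfolding R_def by (rule expectation_fresh_gaussian[OF indep Z \<Phi>m bP]) simp
  also have "\<dots> \<le> expectation (\<lambda>w. v k + (A k w - c)\<^sup>2)"
  proof (rule integral_mono)
    show "integrable M (\<lambda>w. v k + (A k w - c)\<^sup>2)" using IA by simp
    have eq: "(LINT z|gauss. \<Phi> (R w) z) = heat_var ?t ?h (T (X k w)) + (A k w - c)\<^sup>2" for w
      unfolding inner AB by (simp add: YX)
    have "\<bar>heat_var ?t ?h y\<bar> \<le> 2 * Ch\<^sup>2" for y
    proof -
      have "\<bar>heat ?t (\<lambda>y. (?h y)\<^sup>2) y\<bar> \<le> Ch\<^sup>2"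
        by (rule abs_heat_le) (measurable, rule abs_square_le, rule bh)
      moreover have "\<bar>(heat ?t ?h y)\<^sup>2\<bar> \<le> Ch\<^sup>2"
        by (intro abs_square_le abs_heat_le m_innov bh)
      ultimately show ?thesis unfolding heat_var_def by linarith
    qed
    then have "integrable M (\<lambda>w. heat_var ?t ?h (T (X k w)))"
      unfolding heat_var_def by (intro integrable_const_bound[where B="2 * Ch\<^sup>2"]) auto
    then show "integrable M (\<lambda>w. LINT z|gauss. \<Phi> (R w) z)"
      unfolding eq using IA by simp
    show "(LINT z|gauss. \<Phi> (R w) z) \<le> v k + (A k w - c)\<^sup>2" for w
      unfolding eq using v[OF k] by simp
  qed
  also have "\<dots> \<le> v k + (\<Sum>j<k. v j)"
    using Suc IA by (simp add: prob_space c_def)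
  finally show ?case by (simp add: c_def add.commute)
qed

end

text \<open>The potential enters only through the contraction of its gradient steps, and
  \<open>f\<close> is normalised to values in [0, 1].\<close>

locale ula_contraction = prob_space M
  for M :: "'w measure" and Z :: "nat \<Rightarrow> 'w \<Rightarrow> real ^ 'd"
    and G :: "real ^ 'd \<Rightarrow> real ^ 'd" and \<gamma> :: "nat \<Rightarrow> real" and \<kappa> :: real
    and f :: "real ^ 'd \<Rightarrow> real" +
  assumes indep: "indep_vars (\<lambda>_. borel) Z {1..}"
    and Z: "\<And>k. k \<ge> 1 \<Longrightarrow> distributed M lborel (Z k) (\<lambda>z. ennreal (std_gaussian_density z))"
    and G: "G \<in> borel_measurable borel" and f: "f \<in> borel_measurable borel"
    and f01: "\<And>x. 0 \<le> f x" "\<And>x. f x \<le> 1"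
    and \<kappa>: "0 < \<kappa>" and \<gamma>_pos: "\<And>k. 1 \<le> k \<Longrightarrow> 0 < \<gamma> k"
    and \<gamma>_dec: "\<And>k. 1 \<le> k \<Longrightarrow> \<gamma> (k + 1) \<le> \<gamma> k" and \<gamma>_one: "\<kappa> * \<gamma> 1 \<le> 1"
    and contr: "\<And>k x y. 1 \<le> k \<Longrightarrow> norm ((x - \<gamma> k *\<^sub>R G x) - (y - \<gamma> k *\<^sub>R G y))
      \<le> sqrt (1 - \<kappa> * \<gamma> k) * norm (x - y)"
begin

lemma \<gamma>_le_one: "1 \<le> k \<Longrightarrow> \<gamma> k \<le> \<gamma> 1"
proof (induction k rule: dec_induct)
  case (step k)
  then show ?case using \<gamma>_dec[of k] by simp
qed simp

lemma \<kappa>\<gamma>_le: "1 \<le> k \<Longrightarrow> \<kappa> * \<gamma> k \<le> 1"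
  using mult_left_mono[OF \<gamma>_le_one, of k \<kappa>] \<kappa> \<gamma>_one by linarith

lemma chain_measurable: "(\<lambda>w. ula_chain G \<gamma> Z x k w) \<in> borel_measurable M"
  using Z by (intro ula_chain_measurable G) (simp add: distributed_def)

text \<open>This is \<open>1 / sqrt (4 * pi * \<Lambda>)\<close>: the constant
  \<open>1 / sqrt (2 * \<Lambda>)\<close> of the divergence bound times the
  \<open>1 / sqrt (2 * pi)\<close> of level 1.\<close>

definition rate :: "nat \<Rightarrow> nat \<Rightarrow> real" where
  "rate j i = sqrt \<kappa> * lip_rate (\<lambda>l. \<kappa> * \<gamma> l) j i / sqrt (4 * pi)"

lemma ula_cond_lipschitz:
  assumes "1 \<le> j" "j \<le> i"
  shows "\<bar>ula_cond G \<gamma> (Suc (i - j)) f j x - ula_cond G \<gamma> (Suc (i - j)) f j y\<bar> \<le> rate j i * norm (x - y)"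
proof -
  let ?P = "\<Prod>l=j..i. 1 - \<kappa> * \<gamma> l"
  let ?P' = "\<Prod>l=j..j + (i - j). 1 - \<kappa> * \<gamma> l"
  have "hockey_bound (sqrt (\<kappa> * ?P' / (2 * (1 - ?P')))) (ula_cond G \<gamma> (Suc (i - j)) f j)"
    by (rule ula_cond_hockey_bound[OF G f f01 \<kappa> \<gamma>_pos \<kappa>\<gamma>_le contr assms(1)])
  then have "hockey_bound (sqrt (\<kappa> * ?P / (2 * (1 - ?P)))) (ula_cond G \<gamma> (Suc (i - j)) f j)"
    using assms(2) by (simp only: le_add_diff_inverse)
  moreover have "0 \<le> ?P" "?P \<le> 1"
    using \<kappa>\<gamma>_le \<gamma>_pos \<kappa> assms by (auto intro!: prod_nonneg prod_le_1 simp: less_imp_le)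
  then have "0 \<le> sqrt (\<kappa> * ?P / (2 * (1 - ?P)))" using \<kappa> by simp
  ultimately have "\<bar>ula_cond G \<gamma> (Suc (i - j)) f j x - ula_cond G \<gamma> (Suc (i - j)) f j y\<bar>
    \<le> sqrt (\<kappa> * ?P / (2 * (1 - ?P))) / sqrt (2 * pi) * norm (x - y)"
    by (rule hockey_bound_imp_lipschitz)
  also have "sqrt (\<kappa> * ?P / (2 * (1 - ?P))) / sqrt (2 * pi) = rate j i"
  proof -
    have "\<kappa> * ?P / (2 * (1 - ?P)) / (2 * pi) = \<kappa> * (?P / (1 - ?P)) / (4 * pi)" by simp
    then show ?thesis
      unfolding rate_def lip_rate_def survival_def real_sqrt_divide[symmetric] real_sqrt_mult[symmetric]
      by (simp only:)
  qed
  finally show ?thesis .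
qed

lemma rate_nonneg:
  assumes "1 \<le> j"
  shows "0 \<le> rate j i"
proof -
  have "0 \<le> survival (\<lambda>l. \<kappa> * \<gamma> l) j i" "survival (\<lambda>l. \<kappa> * \<gamma> l) j i \<le> 1"
    using \<kappa>\<gamma>_le \<gamma>_pos \<kappa> assms by (auto simp: survival_def less_imp_le intro!: prod_nonneg prod_le_1)
  then show ?thesis using \<kappa> by (simp add: rate_def lip_rate_def)
qed

text \<open>A Lipschitz constant of \<open>future\<close> at time \<open>j - 1\<close>. For the
  weights of the estimator it is an inner sum of \<open>u4\<close> with
  \<open>4 * pi\<close>.\<close>

definition slope :: "(nat \<Rightarrow> real) \<Rightarrow> nat \<Rightarrow> nat \<Rightarrow> real" where
  "slope \<omega> H j = (\<Sum>i=j..H. \<omega> i * rate j i)"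

lemma slope_nonneg: "(\<And>i. 0 \<le> \<omega> i) \<Longrightarrow> 1 \<le> j \<Longrightarrow> 0 \<le> slope \<omega> H j"
  unfolding slope_def by (intro sum_nonneg mult_nonneg_nonneg rate_nonneg)

lemma future_lipschitz:
  assumes \<omega>: "\<And>i. 0 \<le> \<omega> i"
  shows "\<bar>future G \<gamma> f \<omega> H k x - future G \<gamma> f \<omega> H k y\<bar> \<le> slope \<omega> H (k + 1) * norm (x - y)"
proof -
  have "\<bar>future G \<gamma> f \<omega> H k x - future G \<gamma> f \<omega> H k y\<bar>
    = \<bar>\<Sum>i=k+1..H. \<omega> i * (ula_cond G \<gamma> (i - k) f (k + 1) x - ula_cond G \<gamma> (i - k) f (k + 1) y)\<bar>"
    by (simp add: future_def[OF G f f01] sum_subtractf right_diff_distrib)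
  also have "\<dots> \<le> (\<Sum>i=k+1..H. \<bar>\<omega> i * (ula_cond G \<gamma> (i - k) f (k + 1) x - ula_cond G \<gamma> (i - k) f (k + 1) y)\<bar>)"
    by (rule sum_abs)
  also have "\<dots> \<le> (\<Sum>i=k+1..H. \<omega> i * (rate (k + 1) i * norm (x - y)))"
  proof (rule sum_mono)
    fix i assume i: "i \<in> {k+1..H}"
    then have "i - k = Suc (i - (k + 1))" by auto
    then have "\<bar>ula_cond G \<gamma> (i - k) f (k + 1) x - ula_cond G \<gamma> (i - k) f (k + 1) y\<bar>
        \<le> rate (k + 1) i * norm (x - y)"
      using ula_cond_lipschitz[of "k + 1" i x y] i by simp
    then show "\<bar>\<omega> i * (ula_cond G \<gamma> (i - k) f (k + 1) x - ula_cond G \<gamma> (i - k) f (k + 1) y)\<bar>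
        \<le> \<omega> i * (rate (k + 1) i * norm (x - y))"
      using \<omega>[of i] by (simp add: abs_mult mult_left_mono)
  qed
  also have "\<dots> = slope \<omega> H (k + 1) * norm (x - y)"
    by (simp add: slope_def sum_distrib_right mult.assoc)
  finally show ?thesis .
qed

text \<open>Before the burn-in time \<open>N\<close> no new term enters, so only the contraction acts.\<close>

lemma future_lipschitz_burn_in:
  assumes \<omega>: "\<And>i. 0 \<le> \<omega> i" and \<omega>0: "\<And>i. i \<le> N \<Longrightarrow> \<omega> i = 0" and H: "N < H" and k: "k \<le> N"
  shows "\<bar>future G \<gamma> f \<omega> H k x - future G \<gamma> f \<omega> H k y\<bar>
    \<le> sqrt (\<Prod>l=k+1..N. 1 - \<kappa> * \<gamma> l) * slope \<omega> H (N + 1) * norm (x - y)"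
  using k
proof (induction k arbitrary: x y rule: inc_induct)
  case base
  have "\<bar>future G \<gamma> f \<omega> H N x - future G \<gamma> f \<omega> H N y\<bar> \<le> slope \<omega> H (N + 1) * norm (x - y)"
    by (rule future_lipschitz[OF \<omega>])
  then show ?case by simp
next
  case (step k)
  let ?K = "sqrt (\<Prod>l=Suc k+1..N. 1 - \<kappa> * \<gamma> l) * slope \<omega> H (N + 1)"
  have "innov G \<gamma> f \<omega> H k = future G \<gamma> f \<omega> H (Suc k)"
    using step.hyps by (simp add: innov_def[OF G f f01] fun_eq_iff \<omega>0)
  moreover have "future G \<gamma> f \<omega> H k z = ula_kernel G \<gamma> (k + 1) (innov G \<gamma> f \<omega> H k) z" for z
    by (rule future_eq_kernel_innov[OF G f f01 \<omega>]) (use step.hyps H in simp)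
  ultimately have fut: "future G \<gamma> f \<omega> H k z
      = heat (2 * \<gamma> (k + 1)) (future G \<gamma> f \<omega> H (Suc k)) (z - \<gamma> (k + 1) *\<^sub>R G z)" for z
    by (simp add: ula_kernel_def)
  have K: "0 \<le> ?K"
    using \<kappa>\<gamma>_le by (intro mult_nonneg_nonneg real_sqrt_ge_zero prod_nonneg slope_nonneg \<omega>) auto
  have "\<bar>future G \<gamma> f \<omega> H k x - future G \<gamma> f \<omega> H k y\<bar>
      \<le> ?K * norm ((x - \<gamma> (k + 1) *\<^sub>R G x) - (y - \<gamma> (k + 1) *\<^sub>R G y))"
    unfolding fut
    by (rule heat_lipschitz[OF future_measurable[OF G f f01] future_abs_le[OF G f f01 \<omega>] step.IH])
  also have "\<dots> \<le> ?K * (sqrt (1 - \<kappa> * \<gamma> (k + 1)) * norm (x - y))"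
    by (rule mult_left_mono[OF contr K]) simp
  also have "\<dots> = sqrt (\<Prod>l=k+1..N. 1 - \<kappa> * \<gamma> l) * slope \<omega> H (N + 1) * norm (x - y)"
  proof -
    have "(\<Prod>l=k+1..N. 1 - \<kappa> * \<gamma> l) = (1 - \<kappa> * \<gamma> (k + 1)) * (\<Prod>l=Suc k+1..N. 1 - \<kappa> * \<gamma> l)"
      using step.hyps by (subst prod.atLeast_Suc_atMost) auto
    then show ?thesis by (simp add: real_sqrt_mult)
  qed
  finally show ?case .
qed

text \<open>Each term is a difference of consecutive products. The squared contraction factors,
  weighted by \<open>\<kappa> * \<gamma>\<close>, thus sum to at most 1, which is the origin of the
  \<open>1 / \<kappa>\<close> in the burn-in part.\<close>

lemma burn_in_telescope:
  "m \<le> N \<Longrightarrow> (\<Sum>j<m. \<kappa> * \<gamma> (j + 1) * (\<Prod>l=j+2..N. 1 - \<kappa> * \<gamma> l))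
    = (\<Prod>l=m+1..N. 1 - \<kappa> * \<gamma> l) - (\<Prod>l=1..N. 1 - \<kappa> * \<gamma> l)"
proof (induction m)
  case (Suc m)
  have "(\<Prod>l=m+1..N. 1 - \<kappa> * \<gamma> l) = (1 - \<kappa> * \<gamma> (m + 1)) * (\<Prod>l=m+2..N. 1 - \<kappa> * \<gamma> l)"
    using Suc.prems by (subst prod.atLeast_Suc_atMost) auto
  then show ?case using Suc by (simp add: algebra_simps)
qed simp

lemma expectation_square_deviation:
  assumes X: "random_variable borel X" and bd: "\<And>w. \<bar>X w\<bar> \<le> (C::real)"
  shows "variance X \<le> expectation (\<lambda>w. (X w - c)\<^sup>2)"
proof -
  note [measurable] = X
  have I: "integrable M X" using bd by (intro integrable_const_bound[where B=C]) auto
  have I2: "integrable M (\<lambda>w. (X w)\<^sup>2)"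
    using abs_square_le[OF bd] by (intro integrable_const_bound[where B="C\<^sup>2"]) auto
  have "expectation (\<lambda>w. (X w - c)\<^sup>2) = expectation (\<lambda>w. (X w)\<^sup>2) - 2 * c * expectation X + c\<^sup>2"
  proof -
    have "expectation (\<lambda>w. (X w - c)\<^sup>2) = expectation (\<lambda>w. (X w)\<^sup>2 - 2 * c * X w + c\<^sup>2)"
      by (simp add: power2_diff algebra_simps)
    then show ?thesis using I I2 by (simp add: prob_space)
  qed
  moreover have "variance X = expectation (\<lambda>w. (X w)\<^sup>2) - (expectation X)\<^sup>2"
    by (rule variance_eq[OF I I2])
  moreover have "0 \<le> (expectation X - c)\<^sup>2" by simp
  ultimately show ?thesis by (simp add: power2_diff algebra_simps)
qed

lemma variance_weighted_sum_le:
  assumes \<omega>: "\<And>i. 0 \<le> \<omega> i" and \<omega>0: "\<And>i. i \<le> N \<Longrightarrow> \<omega> i = 0" and n: "1 \<le> n"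
  defines "H \<equiv> N + n"
  shows "variance (\<lambda>w. \<Sum>i=1..H. \<omega> i * f (ula_chain G \<gamma> Z x i w))
    \<le> 2 / \<kappa> * (slope \<omega> H (N + 1))\<^sup>2
      + (\<Sum>j\<in>{N..<H}. (\<omega> (j + 1))\<^sup>2 + 8 / 3 * \<gamma> (j + 1) * (slope \<omega> H (j + 2))\<^sup>2)"
proof -
  \<comment> \<open>Before \<open>N\<close> this is Poincare with noise variance
    \<open>2 * \<gamma> (j + 1)\<close> and the contracted slope. From \<open>N\<close> on, a new
    value of \<open>f\<close> enters and \<open>heat_var_add_le\<close> raises the factor 2 to
    \<open>8 / 3\<close>.\<close>
  define v where "v j = (if j < N then 2 * \<gamma> (j + 1) * (\<Prod>l=j+2..N. 1 - \<kappa> * \<gamma> l) * (slope \<omega> H (N + 1))\<^sup>2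
    else (\<omega> (j + 1))\<^sup>2 + 8 / 3 * \<gamma> (j + 1) * (slope \<omega> H (j + 2))\<^sup>2)" for j
  have NH: "N < H" using n by (simp add: H_def)
  have v: "heat_var (2 * \<gamma> (j + 1)) (innov G \<gamma> f \<omega> H j) y \<le> v j" if j: "j < H" for j y
  proof (cases "j < N")
    case True
    let ?Q = "\<Prod>l=j+1+1..N. 1 - \<kappa> * \<gamma> l"
    have Q: "0 \<le> ?Q" using \<kappa>\<gamma>_le by (intro prod_nonneg) auto
    have inn: "innov G \<gamma> f \<omega> H j = future G \<gamma> f \<omega> H (j + 1)"
      using True by (simp add: innov_def[OF G f f01] fun_eq_iff \<omega>0)
    have "heat_var (2 * \<gamma> (j + 1)) (innov G \<gamma> f \<omega> H j) y
        \<le> 2 * \<gamma> (j + 1) * (sqrt ?Q * slope \<omega> H (N + 1))\<^sup>2"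
      unfolding inn
    proof (rule gaussian_poincare[OF future_measurable[OF G f f01] future_abs_le[OF G f f01 \<omega>]])
      show "\<bar>future G \<gamma> f \<omega> H (j + 1) x - future G \<gamma> f \<omega> H (j + 1) y\<bar>
          \<le> sqrt ?Q * slope \<omega> H (N + 1) * norm (x - y)" for x y
        using True by (intro future_lipschitz_burn_in[OF \<omega> \<omega>0 NH]) auto
      show "0 \<le> sqrt ?Q * slope \<omega> H (N + 1)"
        using Q by (intro mult_nonneg_nonneg real_sqrt_ge_zero slope_nonneg \<omega>) auto
      show "0 < 2 * \<gamma> (j + 1)" using \<gamma>_pos[of "j + 1"] by simp
    qed
    then show ?thesis using True Q by (simp add: v_def power_mult_distrib)
  next
    case False
    have "heat_var (2 * \<gamma> (j + 1)) (innov G \<gamma> f \<omega> H j) y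
      \<le> (\<omega> (j + 1))\<^sup>2 + 4 / 3 * (2 * \<gamma> (j + 1) * (slope \<omega> H (j + 1 + 1))\<^sup>2)"
      unfolding innov_def[OF G f f01, abs_def]
    proof (rule heat_var_add_le[OF f f01 future_measurable[OF G f f01] future_abs_le[OF G f f01 \<omega>]])
      show "0 < 2 * \<gamma> (j + 1)" using \<gamma>_pos[of "j + 1"] by simp
      show "\<bar>future G \<gamma> f \<omega> H (j + 1) x - future G \<gamma> f \<omega> H (j + 1) y\<bar>
          \<le> slope \<omega> H (j + 1 + 1) * norm (x - y)" for x y
        by (rule future_lipschitz[OF \<omega>])
      show "0 \<le> slope \<omega> H (j + 1 + 1)" by (intro slope_nonneg \<omega>) simp
    qed (rule \<omega>)
    then show ?thesis using False by (simp add: v_def)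
  qed
  let ?S = "\<lambda>w. \<Sum>i=1..H. \<omega> i * f (ula_chain G \<gamma> Z x i w)"
  note [measurable] = chain_measurable f
  have "variance ?S \<le> expectation (\<lambda>w. (?S w - future G \<gamma> f \<omega> H 0 x)\<^sup>2)"
  proof (rule expectation_square_deviation)
    have "\<bar>?S w\<bar> = ?S w" for w
      using \<omega> f01 by (intro abs_of_nonneg sum_nonneg mult_nonneg_nonneg) auto
    moreover have "?S w \<le> (\<Sum>i=1..H. \<omega> i * 1)" for w
      using \<omega> f01 by (intro sum_mono mult_left_mono) auto
    ultimately show "\<bar>?S w\<bar> \<le> (\<Sum>i=1..H. \<omega> i)" for w by simp
  qed measurable
  also have "\<dots> \<le> (\<Sum>j<H. v j)"
  proof -
    \<comment> \<open>At the horizon \<open>H\<close> nothing remains to be predicted, so the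
      martingale ends in the weighted sum itself.\<close>
    have "expectation (\<lambda>w. (?S w + future G \<gamma> f \<omega> H H (ula_chain G \<gamma> Z x H w)
        - future G \<gamma> f \<omega> H 0 x)\<^sup>2) \<le> (\<Sum>j<H. v j)"
      by (rule ula_second_moment[OF indep Z G f f01 \<omega> v order_refl])
    moreover have "future G \<gamma> f \<omega> H H y = 0" for y by (simp add: future_def[OF G f f01])
    ultimately show ?thesis by simp
  qed
  also have "\<dots> = (\<Sum>j<N. v j) + (\<Sum>j\<in>{N..<H}. v j)"
    using NH by (simp add: lessThan_atLeast0 sum.atLeastLessThan_concat)
  also have "(\<Sum>j\<in>{N..<H}. v j) = (\<Sum>j\<in>{N..<H}. (\<omega> (j + 1))\<^sup>2 + 8 / 3 * \<gamma> (j + 1) * (slope \<omega> H (j + 2))\<^sup>2)"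
    by (simp add: v_def)
  also have "(\<Sum>j<N. v j) \<le> 2 / \<kappa> * (slope \<omega> H (N + 1))\<^sup>2"
  proof -
    have "(\<Sum>j<N. v j) = (\<Sum>j<N. \<kappa> * \<gamma> (j + 1) * (\<Prod>l=j+2..N. 1 - \<kappa> * \<gamma> l)) * (2 / \<kappa> * (slope \<omega> H (N + 1))\<^sup>2)"
      unfolding sum_distrib_right using \<kappa> by (intro sum.cong) (auto simp: v_def)
    also have "(\<Sum>j<N. \<kappa> * \<gamma> (j + 1) * (\<Prod>l=j+2..N. 1 - \<kappa> * \<gamma> l)) \<le> 1"
    proof -
      have "0 \<le> (\<Prod>l=1..N. 1 - \<kappa> * \<gamma> l)" using \<kappa>\<gamma>_le by (intro prod_nonneg) auto
      then show ?thesis by (subst burn_in_telescope) auto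
    qed
    then have "(\<Sum>j<N. \<kappa> * \<gamma> (j + 1) * (\<Prod>l=j+2..N. 1 - \<kappa> * \<gamma> l)) * (2 / \<kappa> * (slope \<omega> H (N + 1))\<^sup>2)
        \<le> 1 * (2 / \<kappa> * (slope \<omega> H (N + 1))\<^sup>2)"
      using \<kappa> by (intro mult_right_mono) auto
    finally show ?thesis by simp
  qed
  finally show ?thesis by simp
qed

end

lemma step_sum_pos:
  assumes "\<And>k. 1 \<le> k \<Longrightarrow> 0 < \<gamma> k" "1 \<le> n"
  shows "0 < step_sum \<gamma> (N + 2) (N + n + 1)"
  unfolding step_sum_def using assms by (intro sum_pos) auto

lemma sum_weight:
  assumes "\<And>k. 1 \<le> k \<Longrightarrow> 0 < \<gamma> k" "1 \<le> n"
  shows "(\<Sum>k=N+1..N+n. weight \<gamma> N n k) = 1"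
proof -
  have "(\<Sum>k=N+1..N+n. \<gamma> (k + 1)) = step_sum \<gamma> (N + 2) (N + n + 1)"
    using sum.shift_bounds_cl_Suc_ivl[of \<gamma> "N + 1" "N + n"] by (simp add: step_sum_def)
  moreover have "0 < step_sum \<gamma> (N + 2) (N + n + 1)" by (rule step_sum_pos[OF assms])
  ultimately show ?thesis by (simp add: weight_def flip: sum_divide_distrib)
qed

text \<open>In rescaled quantities the claim is
  \<open>2 * \<alpha> / T + 4 * W / ?K + b\<^sup>2 / ?K\<close>, whereas the martingale bound is
  \<open>\<alpha> / T + 8 / 3 * W / ?K + 2 * b\<^sup>2 / ?K\<close>. Either the difference has the
  right sign or the claim exceeds 1/4, by \<open>numeric_dichotomy\<close>.\<close>

lemma (in ula_contraction) variance_average_le: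
  fixes N n :: nat
  assumes n: "1 \<le> n"
  defines "w \<equiv> weight \<gamma> N n"
  shows "variance (ula_average G \<gamma> Z x N n f)
    \<le> 2 * \<gamma> 1 / step_sum \<gamma> (N + 2) (N + n + 1)
      + (\<Sum>k\<in>{N..<N+n}. \<gamma> (k + 1) * (2 * slope w (N + n) (k + 2))\<^sup>2)
      + inverse \<kappa> * (slope w (N + n) (N + 1))\<^sup>2"
proof -
  define \<Gamma> where "\<Gamma> = step_sum \<gamma> (N + 2) (N + n + 1)"
  define H where "H = N + n"
  have \<Gamma>_H: "step_sum \<gamma> (N + 2) (H + 1) = \<Gamma>" by (simp add: \<Gamma>_def H_def)
  have \<Gamma>: "0 < \<Gamma>" unfolding \<Gamma>_def by (rule step_sum_pos[OF \<gamma>_pos n])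
  have w: "w k = \<gamma> (k + 1) / \<Gamma>" for k by (simp add: w_def weight_def \<Gamma>_def)
  have w1: "(\<Sum>k=N+1..N+n. w k) = 1" unfolding w_def by (rule sum_weight[OF \<gamma>_pos n])
  have w0: "0 \<le> w k" for k using \<gamma>_pos[of "k + 1"] \<Gamma> by (simp add: w)
  \<comment> \<open>Extending the weights by 0 up to \<open>N\<close> lets the burn-in be part of
    one martingale started at time 0.\<close>
  define \<omega> where "\<omega> i = (if N < i then w i else 0)" for i
  have \<omega>: "0 \<le> \<omega> i" for i using w0 by (simp add: \<omega>_def)
  have \<omega>0: "\<omega> i = 0" if "i \<le> N" for i using that by (simp add: \<omega>_def)
  have slope_eq: "slope \<omega> H j = slope w H j" if "N < j" for j
    unfolding slope_def using that by (intro sum.cong) (auto simp: \<omega>_def)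
  have avg: "ula_average G \<gamma> Z x N n f = (\<lambda>v. \<Sum>i=1..H. \<omega> i * f (ula_chain G \<gamma> Z x i v))"
  proof
    fix v
    have "(\<Sum>i=1..H. \<omega> i * f (ula_chain G \<gamma> Z x i v)) = (\<Sum>i=N+1..H. \<omega> i * f (ula_chain G \<gamma> Z x i v))"
      by (rule sum.mono_neutral_right) (auto simp: \<omega>_def)
    then show "ula_average G \<gamma> Z x N n f v = (\<Sum>i=1..H. \<omega> i * f (ula_chain G \<gamma> Z x i v))"
      by (simp add: ula_average_def \<omega>_def w_def H_def)
  qed
  let ?A = "ula_average G \<gamma> Z x N n f"
  let ?V = "variance ?A"
  define a where "a j = \<kappa> * \<gamma> (j + N)" for j
  define \<alpha> where "\<alpha> = \<kappa> * \<gamma> 1"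
  interpret decreasing_steps a n \<alpha>
    using \<gamma>_pos \<gamma>_dec \<gamma>_le_one \<gamma>_one \<kappa> n
    by unfold_locales (auto simp: a_def \<alpha>_def)
  define T where "T = remaining 2"
  define W where "W = (\<Sum>j=1..n. a j * (lip_sum a n (j + 1))\<^sup>2)"
  define b where "b = lip_sum a n 1"
  have T_eq: "T = \<kappa> * \<Gamma>"
  proof -
    have "\<kappa> * \<Gamma> = (\<Sum>l=2+N..Suc n+N. \<kappa> * \<gamma> l)"
      unfolding \<Gamma>_def step_sum_def sum_distrib_left by (intro sum.cong) auto
    also have "\<dots> = (\<Sum>l=2..Suc n. \<kappa> * \<gamma> (l + N))" by (rule sum.shift_bounds_cl_nat_ivl)
    finally show ?thesis by (simp only: T_def remaining_def a_def)
  qed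
  let ?K = "4 * pi * T\<^sup>2"
  have T: "0 < T" using \<Gamma> \<kappa> by (simp add: T_eq)
  have lip_rate_shift: "lip_rate (\<lambda>l. \<kappa> * \<gamma> l) (j + N) (i + N) = lip_rate a j i" for i j
    unfolding lip_rate_def survival_def a_def by (simp only: prod.shift_bounds_cl_nat_ivl)
  have slope_lip: "slope w H (j + N) = sqrt \<kappa> / (T * sqrt (4 * pi)) * lip_sum a n j" for j
  proof -
    have "slope w H (j + N) = (\<Sum>i=j+N..n+N. w i * rate (j + N) i)"
      by (simp add: slope_def H_def add.commute)
    also have "\<dots> = (\<Sum>i=j..n. w (i + N) * rate (j + N) (i + N))"
      by (rule sum.shift_bounds_cl_nat_ivl)
    also have "\<dots> = (\<Sum>i=j..n. sqrt \<kappa> / (T * sqrt (4 * pi)) * (a (i + 1) * lip_rate a j i))"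
      using \<kappa> by (intro sum.cong refl) (simp add: w rate_def lip_rate_shift T_eq a_def)
    finally show ?thesis by (simp add: lip_sum_def sum_distrib_left)
  qed
  have slope_sq: "(slope w H (j + N))\<^sup>2 = \<kappa> * (lip_sum a n j)\<^sup>2 / ?K" for j
    unfolding slope_lip using \<kappa> by (simp add: power_mult_distrib power_divide mult_ac)
  have S1: "(slope w H (N + 1))\<^sup>2 = \<kappa> * b\<^sup>2 / ?K"
    using slope_sq[of 1] by (simp add: b_def add.commute)
  have S2: "(\<Sum>j\<in>{N..<H}. \<gamma> (j + 1) * (slope w H (j + 2))\<^sup>2) = W / ?K"
  proof -
    have "(\<Sum>j\<in>{N..<H}. \<gamma> (j + 1) * (slope w H (j + 2))\<^sup>2)
        = (\<Sum>j\<in>{0 + N..<n + N}. \<gamma> (j + 1) * (slope w H (j + 2))\<^sup>2)"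
      by (simp add: H_def add.commute)
    also have "\<dots> = (\<Sum>j\<in>{0..<n}. \<gamma> (j + N + 1) * (slope w H (j + N + 2))\<^sup>2)"
      by (rule sum.shift_bounds_nat_ivl)
    also have "\<dots> = (\<Sum>j\<in>{0..<n}. a (Suc j) * (lip_sum a n (Suc j + 1))\<^sup>2 / ?K)"
    proof (intro sum.cong refl)
      fix j
      have "j + N + 2 = (Suc j + 1) + N" by simp
      then show "\<gamma> (j + N + 1) * (slope w H (j + N + 2))\<^sup>2
          = a (Suc j) * (lip_sum a n (Suc j + 1))\<^sup>2 / ?K"
        by (simp only: slope_sq) (simp add: a_def)
    qed
    also have "\<dots> = W / ?K"
    proof -
      have "(\<Sum>j\<in>{0..<n}. a (Suc j) * (lip_sum a n (Suc j + 1))\<^sup>2) = W"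
        unfolding W_def using sum.shift_bounds_Suc_ivl[of "\<lambda>j. a j * (lip_sum a n (j + 1))\<^sup>2" 0 n]
        by (simp add: atLeastLessThanSuc_atLeastAtMost)
      then show ?thesis by (simp flip: sum_divide_distrib)
    qed
    finally show ?thesis .
  qed
  have S3: "(\<Sum>j\<in>{N..<H}. (\<omega> (j + 1))\<^sup>2) \<le> \<alpha> / T"
  proof -
    have "(\<Sum>j\<in>{N..<H}. (\<omega> (j + 1))\<^sup>2) = (\<Sum>k=N+1..N+n. (w k)\<^sup>2)"
      using sum.shift_bounds_Suc_ivl[of "\<lambda>k. (w k)\<^sup>2" N H]
      by (simp add: \<omega>_def H_def atLeastLessThanSuc_atLeastAtMost)
    also have "\<dots> \<le> (\<Sum>k=N+1..N+n. \<gamma> 1 / \<Gamma> * w k)"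
    proof (rule sum_mono)
      fix k
      have "w k \<le> \<gamma> 1 / \<Gamma>" using \<gamma>_le_one[of "k + 1"] \<Gamma> by (simp add: w divide_right_mono)
      then show "(w k)\<^sup>2 \<le> \<gamma> 1 / \<Gamma> * w k"
        unfolding power2_eq_square using w0[of k] by (rule mult_right_mono)
    qed
    also have "\<dots> = \<gamma> 1 / \<Gamma>"
      by (subst sum_distrib_left[symmetric]) (simp only: w1 mult_1_right)
    finally show ?thesis using \<kappa> by (simp add: \<alpha>_def T_eq)
  qed
  note [measurable] = chain_measurable f
  \<comment> \<open>The average has values in [0, 1] and so deviates from 1/2 by at most
    1/2.\<close>
  have V1: "?V \<le> 1 / 4"
  proof -
    have range: "0 \<le> ?A v" "?A v \<le> 1" for v
    proof -
      show "0 \<le> ?A v"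
        unfolding ula_average_def w_def[symmetric] using w0 f01 by (intro sum_nonneg mult_nonneg_nonneg) auto
      have "?A v \<le> (\<Sum>k=N+1..N+n. w k * 1)"
        unfolding ula_average_def w_def[symmetric] using w0 f01 by (intro sum_mono mult_left_mono) auto
      then show "?A v \<le> 1"
        using w1 by simp
    qed
    have [measurable]: "random_variable borel (?A)"
      unfolding ula_average_def[abs_def] by measurable
    have "?V \<le> expectation (\<lambda>v. (?A v - 1 / 2)\<^sup>2)"
      using range by (intro expectation_square_deviation[where C=1]) auto
    also have "\<dots> \<le> expectation (\<lambda>v. 1 / 4)"
    proof (rule integral_mono)
      have sq: "(p - 1 / 2)\<^sup>2 \<le> 1 / 4" if "0 \<le> p" "p \<le> 1" for p :: real
      proof -
        have "0 \<le> p * (1 - p)" using that by simp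
        then show ?thesis by (simp add: power2_eq_square field_simps)
      qed
      show pt: "(?A v - 1 / 2)\<^sup>2 \<le> 1 / 4" for v
        using range by (rule sq)
      show "integrable M (\<lambda>v. (?A v - 1 / 2)\<^sup>2)"
        using pt by (intro integrable_const_bound[where B="1 / 4"]) auto
    qed simp
    finally show ?thesis by (simp add: prob_space)
  qed
  have V2: "?V \<le> \<alpha> / T + 8 / 3 * (W / ?K) + 2 * (b\<^sup>2 / ?K)"
  proof -
    have "?V \<le> 2 / \<kappa> * (slope \<omega> H (N + 1))\<^sup>2
      + (\<Sum>j\<in>{N..<H}. (\<omega> (j + 1))\<^sup>2 + 8 / 3 * \<gamma> (j + 1) * (slope \<omega> H (j + 2))\<^sup>2)"
      unfolding avg H_def by (rule variance_weighted_sum_le[OF \<omega> \<omega>0 n])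
    also have "\<dots> = 2 / \<kappa> * (slope w H (N + 1))\<^sup>2 + ((\<Sum>j\<in>{N..<H}. (\<omega> (j + 1))\<^sup>2)
        + 8 / 3 * (\<Sum>j\<in>{N..<H}. \<gamma> (j + 1) * (slope w H (j + 2))\<^sup>2))"
      by (simp add: slope_eq sum.distrib sum_distrib_left mult.assoc)
    also have "2 / \<kappa> * (slope w H (N + 1))\<^sup>2 = 2 * (b\<^sup>2 / ?K)"
      unfolding S1 using \<kappa> by simp
    finally show ?thesis using S3 unfolding S2 by linarith
  qed
  have "?V \<le> 2 * (\<alpha> / T) + 4 * (W / ?K) + b\<^sup>2 / ?K"
  proof -
    have T2: "0 < T\<^sup>2" using T by simp
    have b: "0 \<le> b\<^sup>2 / ?K" by simp
    from numeric_dichotomy have "T\<^sup>2 / 4 \<le> 2 * \<alpha> * T + W / pi \<or> b\<^sup>2 / (4 * pi) \<le> \<alpha> * T + W / (3 * pi)"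
      by (simp add: T_def W_def b_def)
    then show ?thesis
    proof
      assume "T\<^sup>2 / 4 \<le> 2 * \<alpha> * T + W / pi"
      then have "T\<^sup>2 / 4 / T\<^sup>2 \<le> (2 * \<alpha> * T + W / pi) / T\<^sup>2"
        by (intro divide_right_mono) auto
      also have "\<dots> = 2 * (\<alpha> / T) + 4 * (W / ?K)"
        using T by (simp add: add_divide_distrib power2_eq_square)
      finally have "T\<^sup>2 / 4 / T\<^sup>2 \<le> 2 * (\<alpha> / T) + 4 * (W / ?K)" .
      moreover have "T\<^sup>2 / 4 / T\<^sup>2 = 1 / 4" using T by simp
      ultimately show ?thesis using V1 b by linarith
    next
      assume "b\<^sup>2 / (4 * pi) \<le> \<alpha> * T + W / (3 * pi)"
      then have "b\<^sup>2 / (4 * pi) / T\<^sup>2 \<le> (\<alpha> * T + W / (3 * pi)) / T\<^sup>2"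
        by (intro divide_right_mono) auto
      moreover have "(\<alpha> * T + W / (3 * pi)) / T\<^sup>2 = \<alpha> / T + 4 / 3 * (W / ?K)"
        using T by (simp add: add_divide_distrib power2_eq_square)
      ultimately have "b\<^sup>2 / ?K \<le> \<alpha> / T + 4 / 3 * (W / ?K)" by simp
      then show ?thesis using V2 by linarith
    qed
  qed
  moreover have "\<alpha> / T = \<gamma> 1 / \<Gamma>" using \<kappa> by (simp add: \<alpha>_def T_eq)
  moreover have "inverse \<kappa> * (slope w H (N + 1))\<^sup>2 = b\<^sup>2 / ?K"
    unfolding S1 using \<kappa> by (simp add: field_simps)
  moreover have "(\<Sum>k\<in>{N..<H}. \<gamma> (k + 1) * (2 * slope w H (k + 2))\<^sup>2) = 4 * (W / ?K)"
    unfolding S2[symmetric] sum_distrib_left by (intro sum.cong) (auto simp: power_mult_distrib)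
  ultimately show ?thesis
    unfolding H_def[symmetric] \<Gamma>_H by linarith
qed

section \<open>Translation to the extended-real formula and to general observables\<close>

lemma weight_over_sqrt_Lambda:
  assumes \<kappa>: "0 < \<kappa>" and c: "0 < c" and \<gamma>: "\<And>l. j \<le> l \<Longrightarrow> 0 < \<gamma> l" "\<And>l. j \<le> l \<Longrightarrow> \<kappa> * \<gamma> l \<le> 1"
    and ji: "j \<le> i"
  shows "ereal w / ereal_sqrt (ereal c * Lambda \<kappa> \<gamma> j i)
    = ereal (w * (sqrt \<kappa> * lip_rate (\<lambda>l. \<kappa> * \<gamma> l) j i / sqrt c))"
proof (cases "\<exists>l\<in>{j..i}. \<kappa> * \<gamma> l = 1")
  \<comment> \<open>\<open>Lambda\<close> is infinite and a factor of \<open>survival\<close>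
    vanishes, so both sides are 0.\<close>
  case True
  then have "survival (\<lambda>l. \<kappa> * \<gamma> l) j i = 0"
    by (auto simp: survival_def)
  then have "lip_rate (\<lambda>l. \<kappa> * \<gamma> l) j i = 0" by (simp add: lip_rate_def)
  moreover have "ereal c * Lambda \<kappa> \<gamma> j i = \<infinity>" using True c by (simp add: Lambda_def)
  ultimately show ?thesis by (simp add: ereal_sqrt_def)
next
  case False
  let ?P = "survival (\<lambda>l. \<kappa> * \<gamma> l) j i"
  have lt: "\<kappa> * \<gamma> l < 1" if "l \<in> {j..i}" for l
    using \<gamma>(2)[of l] False that by (auto simp: less_le)
  have P0: "0 < ?P" unfolding survival_def using lt by (intro prod_pos) auto
  have P1: "?P < 1"
  proof -
    have "?P = (1 - \<kappa> * \<gamma> j) * (\<Prod>l=Suc j..i. 1 - \<kappa> * \<gamma> l)"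
      unfolding survival_def using ji by (rule prod.atLeast_Suc_atMost)
    also have "\<dots> \<le> (1 - \<kappa> * \<gamma> j) * 1"
      using \<gamma> \<kappa> by (intro mult_left_mono prod_le_1) (auto simp: less_imp_le)
    also have "\<dots> < 1" using \<gamma>(1)[of j] \<kappa> by simp
    finally show ?thesis .
  qed
  have L: "Lambda \<kappa> \<gamma> j i = ereal ((1 - ?P) / (\<kappa> * ?P))"
  proof -
    have "(\<Prod>l=j..i. inverse (1 - \<kappa> * \<gamma> l)) = inverse ?P"
      using prod_inversef[of "\<lambda>l. 1 - \<kappa> * \<gamma> l" "{j..i}"] by (simp add: survival_def o_def)
    then show ?thesis using False P0 \<kappa> by (simp add: Lambda_def field_simps)
  qed
  have pos: "0 < c * ((1 - ?P) / (\<kappa> * ?P))" using P0 P1 \<kappa> c by simp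
  have "ereal w / ereal_sqrt (ereal c * Lambda \<kappa> \<gamma> j i)
      = ereal w / ereal (sqrt (c * ((1 - ?P) / (\<kappa> * ?P))))"
    by (simp add: L ereal_sqrt_def)
  also have "\<dots> = ereal (w / sqrt (c * ((1 - ?P) / (\<kappa> * ?P))))"
    using P0 P1 \<kappa> c by (subst ereal_divide) auto
  also have "w / sqrt (c * ((1 - ?P) / (\<kappa> * ?P))) = w * (sqrt \<kappa> * lip_rate (\<lambda>l. \<kappa> * \<gamma> l) j i / sqrt c)"
    unfolding lip_rate_def real_sqrt_mult real_sqrt_divide by simp
  finally show ?thesis .
qed

text \<open>\<open>sqrt (4 * pi) = 2 * sqrt pi\<close> accounts for the 2 in front of the slopes of
  the first sum.\<close>

lemma (in ula_contraction) u4_eq: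
  "u4 \<kappa> \<gamma> N n = ereal ((\<Sum>k\<in>{N..<N+n}. \<gamma> (k + 1) * (2 * slope (weight \<gamma> N n) (N + n) (k + 2))\<^sup>2)
    + inverse \<kappa> * (slope (weight \<gamma> N n) (N + n) (N + 1))\<^sup>2)"
proof -
  let ?w = "weight \<gamma> N n"
  have summand: "ereal (?w i) / ereal_sqrt (ereal c * Lambda \<kappa> \<gamma> j i)
      = ereal (?w i * (sqrt \<kappa> * lip_rate (\<lambda>l. \<kappa> * \<gamma> l) j i / sqrt c))"
    if "1 \<le> j" "j \<le> i" "0 < c" for i j c
    using that \<gamma>_pos \<kappa>\<gamma>_le by (intro weight_over_sqrt_Lambda \<kappa>) auto
  have s4: "sqrt (4 * pi) = 2 * sqrt pi" by (simp add: real_sqrt_mult)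
  have 1: "(\<Sum>i=k+2..N+n. ereal (?w i) / ereal_sqrt (ereal pi * Lambda \<kappa> \<gamma> (k + 2) i))
      = ereal (2 * slope ?w (N + n) (k + 2))" for k
  proof -
    have "(\<Sum>i=k+2..N+n. ereal (?w i) / ereal_sqrt (ereal pi * Lambda \<kappa> \<gamma> (k + 2) i))
        = (\<Sum>i=k+2..N+n. ereal (2 * (?w i * rate (k + 2) i)))"
      by (intro sum.cong refl, subst summand) (auto simp: rate_def s4)
    then show ?thesis by (simp add: slope_def sum_distrib_left)
  qed
  have 2: "(\<Sum>i=N+1..N+n. ereal (?w i) / ereal_sqrt (ereal (4 * pi) * Lambda \<kappa> \<gamma> (N + 1) i))
      = ereal (slope ?w (N + n) (N + 1))"
  proof -
    have "(\<Sum>i=N+1..N+n. ereal (?w i) / ereal_sqrt (ereal (4 * pi) * Lambda \<kappa> \<gamma> (N + 1) i))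
        = (\<Sum>i=N+1..N+n. ereal (?w i * rate (N + 1) i))"
      by (intro sum.cong refl, subst summand) (auto simp: rate_def)
    then show ?thesis by (simp add: slope_def)
  qed
  show ?thesis
    unfolding u4_def 1 2 by (simp add: power2_eq_square)
qed

lemma abs_diff_le_osc:
  assumes "bounded (range f)"
  shows "\<bar>f x - f y\<bar> \<le> osc f"
proof -
  obtain B where B: "\<And>x. \<bar>f x\<bar> \<le> B" using assms by (auto simp: bounded_iff)
  have "\<bar>f (fst p) - f (snd p)\<bar> \<le> 2 * B" for p using B[of "fst p"] B[of "snd p"] by linarith
  then have "bdd_above (range (\<lambda>p. \<bar>f (fst p) - f (snd p)\<bar>))" by (intro bdd_aboveI) auto
  then show ?thesis
    unfolding osc_def using cSUP_upper[of "(x, y)" UNIV "\<lambda>p. \<bar>f (fst p) - f (snd p)\<bar>"] by simp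
qed

lemma (in prob_space) variance_add_cmult:
  assumes "integrable M X"
  shows "variance (\<lambda>w. l + D * X w) = D\<^sup>2 * variance (X :: 'a \<Rightarrow> real)"
proof -
  have "variance (\<lambda>w. l + D * X w) = expectation (\<lambda>w. D\<^sup>2 * (X w - expectation X)\<^sup>2)"
    using assms by (intro Bochner_Integration.integral_cong refl)
      (simp add: prob_space power2_eq_square algebra_simps)
  then show ?thesis by simp
qed

theorem theorem16:
  fixes U f :: "real ^ 'd \<Rightarrow> real"
    and gradU :: "real ^ 'd \<Rightarrow> real ^ 'd"
    and m L :: real
    and \<gamma> :: "nat \<Rightarrow> real"
    and M :: "'w measure"
    and Z :: "nat \<Rightarrow> 'w \<Rightarrow> real ^ 'd"
    and N n :: nat
    and x :: "real ^ 'd"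
  assumes "\<And>y. GDERIV U y :> gradU y"
    and "continuous_on UNIV gradU"
    and "L \<ge> 0" and "m > 0"
    and "\<And>y z. norm (gradU y - gradU z) \<le> L * norm (y - z)"
    and "\<And>y z. U z \<ge> U y + gradU y \<bullet> (z - y) + (m / 2) * (norm (y - z))\<^sup>2"
    and "\<And>k. k \<ge> 1 \<Longrightarrow> \<gamma> k > 0"
    and "\<And>k. k \<ge> 1 \<Longrightarrow> \<gamma> (k + 1) \<le> \<gamma> k"
    and "\<gamma> 1 \<le> 2 / (m + L)"
    and "f \<in> borel_measurable borel"
    and "bounded (range f)"
    and "prob_space M"
    and "prob_space.indep_vars M (\<lambda>_. borel) Z {1..}"
    and "\<And>k. k \<ge> 1 \<Longrightarrow> distributed M lborel (Z k) (\<lambda>z. ennreal (std_gaussian_density z))"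
    and "n \<ge> 1"
  shows "ereal (prob_space.variance M (ula_average gradU \<gamma> Z x N n f))
    \<le> ereal ((osc f)\<^sup>2) *
        (ereal (2 * \<gamma> 1 / step_sum \<gamma> (N + 2) (N + n + 1)) + u4 (kappa m L) \<gamma> N n)"
proof -
  note lip = assms(5) and conv = assms(6) and \<gamma>_pos = assms(7) and \<gamma>_dec = assms(8) and n = assms(15)
  interpret prob_space M by (rule assms(12))
  define \<kappa> where "\<kappa> = kappa m L"
  define l where "l = (INF y. f y)"
  let ?D = "osc f" and ?w = "weight \<gamma> N n"
  have \<open>m \<le> L\<close> by (rule strong_convexity_le_lipschitz[OF lip conv])
  have \<kappa>: "0 < \<kappa>" using \<open>m \<le> L\<close> assms(4) by (simp add: \<kappa>_def kappa_def)
  have \<gamma>_le: "\<gamma> k \<le> \<gamma> 1" if "1 \<le> k" for k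
    using that
  proof (induction k rule: dec_induct)
    case (step k)
    then show ?case using \<gamma>_dec[of k] by simp
  qed simp
  \<comment> \<open>The AM-GM inequality \<open>4 * m * L \<le> (m + L)\<^sup>2\<close> keeps all
    factors \<open>1 - \<kappa> * \<gamma> k\<close> nonnegative.\<close>
  have \<gamma>_one: "\<kappa> * \<gamma> 1 \<le> 1"
  proof -
    have "\<kappa> * \<gamma> 1 \<le> \<kappa> * (2 / (m + L))" using assms(9) \<kappa> by (intro mult_left_mono) auto
    also have "\<dots> = 4 * m * L / (m + L)\<^sup>2" by (simp add: \<kappa>_def kappa_def power2_eq_square)
    also have "\<dots> \<le> 1"
    proof -
      have "0 \<le> (m - L)\<^sup>2" by simp
      then have "4 * m * L \<le> (m + L)\<^sup>2" by (simp add: power2_eq_square algebra_simps)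
      moreover have "0 < (m + L)\<^sup>2" using \<open>m \<le> L\<close> assms(4) by simp
      ultimately show ?thesis by simp
    qed
    finally show ?thesis .
  qed
  have contr: "norm ((x - \<gamma> k *\<^sub>R gradU x) - (y - \<gamma> k *\<^sub>R gradU y)) \<le> sqrt (1 - \<kappa> * \<gamma> k) * norm (x - y)"
    if "1 \<le> k" for k x y
  proof (rule power2_le_imp_le)
    have k1: "0 \<le> 1 - \<kappa> * \<gamma> k"
      using mult_left_mono[OF \<gamma>_le[OF that], of \<kappa>] \<kappa> \<gamma>_one by linarith
    have "\<gamma> k \<le> 2 / (m + L)" using \<gamma>_le[OF that] assms(9) by linarith
    then have "(norm ((x - \<gamma> k *\<^sub>R gradU x) - (y - \<gamma> k *\<^sub>R gradU y)))\<^sup>2 \<le> (1 - \<kappa> * \<gamma> k) * (norm (x - y))\<^sup>2"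
      unfolding \<kappa>_def kappa_def
      by (intro gradient_step_contraction[OF assms(1) lip conv assms(4) \<gamma>_pos[OF that]])
    then show "(norm ((x - \<gamma> k *\<^sub>R gradU x) - (y - \<gamma> k *\<^sub>R gradU y)))\<^sup>2
        \<le> (sqrt (1 - \<kappa> * \<gamma> k) * norm (x - y))\<^sup>2"
      using k1 by (simp add: power_mult_distrib)
    show "0 \<le> sqrt (1 - \<kappa> * \<gamma> k) * norm (x - y)" using k1 by simp
  qed
  have G: "gradU \<in> borel_measurable borel"
    using assms(2) by (rule borel_measurable_continuous_onI)
  have D: "\<bar>f y - f z\<bar> \<le> ?D" for y z by (rule abs_diff_le_osc[OF assms(11)])
  show ?thesis
  \<comment> \<open>The normalisation of \<open>f\<close> divides by \<open>osc f\<close>. For a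
    constant \<open>f\<close> the average is constant and both sides are 0.\<close>
  proof (cases "?D = 0")
    case True
    then have const: "f y = f 0" for y using D[of y 0] by simp
    have "ula_average gradU \<gamma> Z x N n f = (\<lambda>v. \<Sum>k=N+1..N+n. ?w k * f 0)"
      unfolding ula_average_def by (intro ext sum.cong refl arg_cong2[where f="(*)"] const)
    then have "variance (ula_average gradU \<gamma> Z x N n f) = 0" by (simp add: prob_space)
    then show ?thesis by (simp add: True flip: zero_ereal_def)
  next
    case False
    then have Dpos: "0 < ?D" using D[of 0 0] by simp
    \<comment> \<open>The affine rescaling of \<open>f\<close> to [0, 1]. Since the weights sum to 1
      it acts on the average in the same way and takes the factor \<open>(osc f)\<^sup>2\<close> out
      of the variance.\<close>
    define f1 where "f1 y = (f y - l) / ?D" for y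
    have bdd: "bdd_below (range f)" using assms(11) by (rule bounded_imp_bdd_below)
    have f01: "0 \<le> f1 y" "f1 y \<le> 1" for y
    proof -
      have "l \<le> f y" unfolding l_def by (rule cINF_lower[OF bdd]) simp
      then show "0 \<le> f1 y" using Dpos by (simp add: f1_def)
      have "f y - ?D \<le> l" unfolding l_def
      proof (rule cINF_greatest)
        show "f y - ?D \<le> f z" for z using D[of y z] by linarith
      qed simp
      then show "f1 y \<le> 1" using Dpos by (simp add: f1_def)
    qed
    have f1: "f1 \<in> borel_measurable borel" unfolding f1_def using assms(10) by measurable
    interpret ula_contraction M Z gradU \<gamma> \<kappa> f1
      using assms(13,14) G f1 f01 \<kappa> \<gamma>_pos \<gamma>_dec \<gamma>_one contr by unfold_locales auto
    let ?Y = "ula_average gradU \<gamma> Z x N n f1"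
    have w1: "(\<Sum>k=N+1..N+n. ?w k) = 1" by (rule sum_weight[OF \<gamma>_pos n])
    have "ula_average gradU \<gamma> Z x N n f = (\<lambda>v. l + ?D * ?Y v)"
    proof
      fix v
      have "f y = l + ?D * f1 y" for y using Dpos by (simp add: f1_def)
      then have "ula_average gradU \<gamma> Z x N n f v
          = (\<Sum>k=N+1..N+n. ?w k * l + ?D * (?w k * f1 (ula_chain gradU \<gamma> Z x k v)))"
        unfolding ula_average_def by (intro sum.cong) (simp_all add: algebra_simps)
      also have "\<dots> = (\<Sum>k=N+1..N+n. ?w k) * l + ?D * ?Y v"
        by (simp only: sum.distrib ula_average_def sum_distrib_left sum_distrib_right)
      finally show "ula_average gradU \<gamma> Z x N n f v = l + ?D * ?Y v"
        using w1 by simp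
    qed
    moreover have "integrable M ?Y"
    proof -
      note [measurable] = chain_measurable f1
      have "integrable M (\<lambda>v. ?w k * f1 (ula_chain gradU \<gamma> Z x k v))" for k
        using f01 by (intro integrable_mult_right integrable_const_bound[where B=1]) auto
      then show ?thesis unfolding ula_average_def[abs_def] by (intro Bochner_Integration.integrable_sum)
    qed
    ultimately have "variance (ula_average gradU \<gamma> Z x N n f) = ?D\<^sup>2 * variance ?Y"
      by (simp only: variance_add_cmult)
    also have "\<dots> \<le> ?D\<^sup>2 * (2 * \<gamma> 1 / step_sum \<gamma> (N + 2) (N + n + 1)
      + (\<Sum>k\<in>{N..<N+n}. \<gamma> (k + 1) * (2 * slope ?w (N + n) (k + 2))\<^sup>2)
      + inverse \<kappa> * (slope ?w (N + n) (N + 1))\<^sup>2)"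
      by (intro mult_left_mono variance_average_le n) simp
    finally show ?thesis
      unfolding \<kappa>_def[symmetric] u4_eq by (simp add: add.assoc)
  qed
qed

end
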